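(* Let $n\ge 2$. Let $Z=\{f_i,g_i,h_i:1\le i<n\}$ be an alphabet, and let $\xi:Z^*\to\mathscr P\mathcal P_n^{\mathrm{fd}}$ be the monoid morphism determined by $f_i\mapsto\overline f_i$, $g_i\mapsto\overline g_i$, $h_i\mapsto\overline h_i$. Let $O$ be the following set of relations over $Z$ (for all indices for which the letters involved belong to $Z$): $$x_iy_i=y_i\ \text{ for } x,y\in\{f,g,h\},$$ $$f_if_j=f_jf_i\ \text{ if }|i-j|>1,\qquad g_ig_j=g_jg_i\ \text{ if }|i-j|>1,\qquad h_ih_j=h_jh_i,$$ $$f_if_{i+1}f_i=f_{i+1}f_if_{i+1}=f_{i+1}f_i,\qquad g_ig_{i+1}g_i=g_{i+1}g_ig_{i+1}=g_ig_{i+1},$$ $$f_ig_j=g_jf_i\ \text{ if } j\notin\{i,i+1\},\qquad h_if_j=f_jh_i\ \text{ if } j\notin\{i,i-1\},\qquad h_ig_j=g_jh_i\ \text{ if } j\notin\{i,i+1\},$$ $$f_ig_{i+1}=f_i,\qquad g_{i+1}f_i=g_{i+1},\qquad h_ig_{i+1}=h_{i+1}f_i.$$ Then the monoid $\mathscr P\mathcal P_n^{\mathrm{fd}}$ has monoid presentation $\langle Z:O\rangle$ via $\xi$. Consequently, $\mathscr P\mathcal P_n^{\mathrm{fd}}$ is idempotent-generated.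
   Context: Partition monoid: let $\mathbf n=\{1,\dots,n\}$, and let $\mathbf n'=\{1',\dots,n'\}$ and $\mathbf n''=\{1'',\dots,n''\}$ be disjoint copies of $\mathbf n$. The partition monoid $\mathcal P_n$ is the set of all set partitions of $\mathbf n\cup\mathbf n'$, with product defined as follows. For $a,b\in\mathcal P_n$, let $a^\downarrow$ be the partition of $\mathbf n\cup\mathbf n''$ obtained from $a$ by renaming each $x'$ as $x''$, and $b^\uparrow$ the partition of $\mathbf n''\cup\mathbf n'$ obtained from $b$ by renaming each $x\in\mathbf n$ as $x''$. Then $x,y\in\mathbf n\cup\mathbf n'$ belong to the same block of $ab$ iff they are related by the smallest equivalence relation on $\mathbf n\cup\mathbf n''\cup\mathbf n'$ that relates any two elements lying in a common block of $a^\downarrow$ or of $b^\uparrow$. The identity is the partition $1$ with blocks $\{x,x'\}$, $x\in\mathbf n$. The full-domain partition monoid $\mathcal P_n^{\mathrm{fd}}$ is the submonoid of all $a\in\mathcal P_n$ such that every element of $\mathbf n$ lies in a block containing at least one element of $\mathbf n'$. A partition $a\in\mathcal P_n$ is planar if, with vertices $1<\dots<n$ placed on an upper row and $1'<\dots<n'$ on a lower row (increasing from left to right), there is a graph on these vertices whose connected components are the blocks of $a$ and which can be drawn with all edges inside the rectangle spanned by the vertices and with no edge crossings. $\mathscr P\mathcal P_n^{\mathrm{fd}}$ is the submonoid of all planar elements of $\mathcal P_n^{\mathrm{fd}}$. For $1\le i<n$: $\overline f_i$ has blocks $\{i,i+1,i'\}$, $\{(i+1)'\}$ and $\{x,x'\}$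 for $x\ne i,i+1$; $\overline g_i$ has blocks $\{i,i+1,(i+1)'\}$, $\{i'\}$ and $\{x,x'\}$ for $x\neq i,i+1$; $\overline h_i$ has blocks $\{i,i+1,i',(i+1)'\}$ and $\{x,x'\}$ for $x\ne i,i+1$. Presentations: $Z^*$ is the free monoid over $Z$. A relation $u=v$ stands for the pair $(u,v)$. A monoid $M$ has monoid presentation $\langle Z:O\rangle$ via $\xi:Z^*\to M$ if $\xi$ is a surjective monoid morphism whose kernel $\{(u,v):u\xi=v\xi\}$ is the congruence on $Z^*$ generated by $O$. *)

theory Defs
  imports
    "HOL-Library.Disjoint_Sets"
    "HOL-Analysis.Analysis"
    "HOL-Algebra.Group"
begin

section \<open>The partition monoid\<close>

text \<open>
  The vertices \<open>x\<close>, \<open>x''\<close> and \<open>x'\<close> are \<open>Upper x\<close>, \<open>Middle x\<close> and \<open>Lower x\<close>. The middle row is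
  used only for forming products.
\<close>

datatype vertex = Upper nat | Middle nat | Lower nat

definition verts :: "nat \<Rightarrow> vertex set" where
  "verts n = Upper ` {1..n} \<union> Lower ` {1..n}"

definition verts3 :: "nat \<Rightarrow> vertex set" where
  "verts3 n = Upper ` {1..n} \<union> Middle ` {1..n} \<union> Lower ` {1..n}"

primrec lower_to_middle :: "vertex \<Rightarrow> vertex" where
  "lower_to_middle (Upper x) = Upper x"
| "lower_to_middle (Middle x) = Middle x"
| "lower_to_middle (Lower x) = Middle x"

primrec upper_to_middle :: "vertex \<Rightarrow> vertex" where
  "upper_to_middle (Upper x) = Middle x"
| "upper_to_middle (Middle x) = Middle x"
| "upper_to_middle (Lower x) = Lower x"

definition down :: "vertex set set \<Rightarrow> vertex set set" where
  "down a = (\<lambda>B. lower_to_middle ` B) ` a"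

definition up :: "vertex set set \<Rightarrow> vertex set set" where
  "up b = (\<lambda>B. upper_to_middle ` B) ` b"

definition generated_equiv :: "'a set \<Rightarrow> ('a \<times> 'a) set \<Rightarrow> ('a \<times> 'a) set" where
  "generated_equiv A r = \<Inter>{s. equiv A s \<and> r \<subseteq> s}"

definition product_equiv :: "nat \<Rightarrow> vertex set set \<Rightarrow> vertex set set \<Rightarrow> (vertex \<times> vertex) set" where
  "product_equiv n a b =
     generated_equiv (verts3 n) {(x, y). \<exists>B \<in> down a \<union> up b. x \<in> B \<and> y \<in> B}"

definition partition_mult :: "nat \<Rightarrow> vertex set set \<Rightarrow> vertex set set \<Rightarrow> vertex set set" where
  "partition_mult n a b = verts n // (product_equiv n a b \<inter> verts n \<times> verts n)"

definition partition_monoid :: "nat \<Rightarrow> vertex set set monoid" where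
  "partition_monoid n =
     \<lparr>carrier = {a. partition_on (verts n) a},
      mult = partition_mult n,
      one = {{Upper x, Lower x} |x. x \<in> {1..n}}\<rparr>"

definition full_domain :: "nat \<Rightarrow> vertex set set \<Rightarrow> bool" where
  "full_domain n a \<longleftrightarrow> (\<forall>x \<in> {1..n}. \<exists>B \<in> a. Upper x \<in> B \<and> (\<exists>y \<in> {1..n}. Lower y \<in> B))"

section \<open>Planarity\<close>

definition graph_components :: "'v set \<Rightarrow> 'v set set \<Rightarrow> 'v set set" where
  "graph_components V E =
     V // {(u, v). u \<in> V \<and> v \<in> V \<and> (u, v) \<in> {(x, y). {x, y} \<in> E}\<^sup>*}"

text \<open>The position of middle vertices is irrelevant, as they never occur in a planar drawing.\<close>

primrec position :: "vertex \<Rightarrow> real^2" where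
  "position (Upper x) = vector [real x, 1]"
| "position (Middle x) = vector [real x, 1 / 2]"
| "position (Lower x) = vector [real x, 0]"

text \<open>
  Edges are two-element sets of vertices (loops and parallel edges affect neither components nor
  drawability). An edge is drawn as an arc in the closed rectangle spanned by the vertices; it
  meets no vertices other than its end points, and meets other edges only in common end points.
\<close>

definition planar_drawing ::
  "nat \<Rightarrow> vertex set set \<Rightarrow> (vertex set \<Rightarrow> real \<Rightarrow> real^2) \<Rightarrow> bool" where
  "planar_drawing n E \<gamma> \<longleftrightarrow>
     (\<forall>e \<in> E. arc (\<gamma> e)
        \<and> {pathstart (\<gamma> e), pathfinish (\<gamma> e)} = position ` e
        \<and> path_image (\<gamma> e) \<subseteq> convex hull (position ` verts n)
        \<and> path_image (\<gamma> e) \<inter> position ` verts n = position ` e) \<and>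
     (\<forall>e \<in> E. \<forall>e' \<in> E. e \<noteq> e' \<longrightarrow>
        path_image (\<gamma> e) \<inter> path_image (\<gamma> e') \<subseteq> position ` (e \<inter> e'))"

definition planar :: "nat \<Rightarrow> vertex set set \<Rightarrow> bool" where
  "planar n a \<longleftrightarrow>
     (\<exists>E \<gamma>. E \<subseteq> {e. e \<subseteq> verts n \<and> card e = 2}
        \<and> graph_components (verts n) E = a \<and> planar_drawing n E \<gamma>)"

definition planar_fd_monoid :: "nat \<Rightarrow> vertex set set monoid" where
  "planar_fd_monoid n = (partition_monoid n)
     \<lparr>carrier := {a \<in> carrier (partition_monoid n). full_domain n a \<and> planar n a}\<rparr>"

section \<open>Monoid presentations and generation by idempotents\<close>

definition free_monoid :: "'z set \<Rightarrow> 'z list monoid" where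
  "free_monoid Z = \<lparr>carrier = lists Z, mult = (@), one = []\<rparr>"

text \<open>The set \<open>hom\<close> only requires compatibility with multiplication.\<close>

definition monoid_morphism :: "('a, 'm) monoid_scheme \<Rightarrow> ('b, 'k) monoid_scheme \<Rightarrow> ('a \<Rightarrow> 'b) \<Rightarrow> bool"
  where "monoid_morphism M N \<phi> \<longleftrightarrow> \<phi> \<in> hom M N \<and> \<phi> \<one>\<^bsub>M\<^esub> = \<one>\<^bsub>N\<^esub>"

definition monoid_congruence :: "('a, 'm) monoid_scheme \<Rightarrow> ('a \<times> 'a) set \<Rightarrow> bool" where
  "monoid_congruence M r \<longleftrightarrow> equiv (carrier M) r \<and>
     (\<forall>(u, v) \<in> r. \<forall>w \<in> carrier M. (w \<otimes>\<^bsub>M\<^esub> u, w \<otimes>\<^bsub>M\<^esub> v) \<in> r \<and> (u \<otimes>\<^bsub>M\<^esub> w, v \<otimes>\<^bsub>M\<^esub> w) \<in> r)"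

definition generated_congruence :: "('a, 'm) monoid_scheme \<Rightarrow> ('a \<times> 'a) set \<Rightarrow> ('a \<times> 'a) set" where
  "generated_congruence M R = \<Inter>{r. monoid_congruence M r \<and> R \<subseteq> r}"

definition has_monoid_presentation ::
  "('a, 'm) monoid_scheme \<Rightarrow> 'z set \<Rightarrow> ('z list \<times> 'z list) set \<Rightarrow> ('z list \<Rightarrow> 'a) \<Rightarrow> bool" where
  "has_monoid_presentation M Z R \<xi> \<longleftrightarrow>
     monoid M \<and> monoid_morphism (free_monoid Z) M \<xi> \<and> \<xi> ` lists Z = carrier M \<and>
     {(u, v). u \<in> lists Z \<and> v \<in> lists Z \<and> \<xi> u = \<xi> v} = generated_congruence (free_monoid Z) R"

text \<open>The extension of a map on letters to a morphism on words.\<close>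

definition word_morphism :: "('a, 'm) monoid_scheme \<Rightarrow> ('z \<Rightarrow> 'a) \<Rightarrow> 'z list \<Rightarrow> 'a" where
  "word_morphism M \<phi> w = foldr (\<otimes>\<^bsub>M\<^esub>) (map \<phi> w) \<one>\<^bsub>M\<^esub>"

definition generated_submonoid :: "('a, 'm) monoid_scheme \<Rightarrow> 'a set \<Rightarrow> 'a set" where
  "generated_submonoid M A = \<Inter>{H. submonoid H M \<and> A \<subseteq> H}"

definition idempotent_generated :: "('a, 'm) monoid_scheme \<Rightarrow> bool" where
  "idempotent_generated M \<longleftrightarrow>
     generated_submonoid M {e \<in> carrier M. e \<otimes>\<^bsub>M\<^esub> e = e} = carrier M"

section \<open>Generators and relations\<close>

definition fbar :: "nat \<Rightarrow> nat \<Rightarrow> vertex set set" where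
  "fbar n i = {{Upper i, Upper (i+1), Lower i}, {Lower (i+1)}}
     \<union> {{Upper x, Lower x} |x. x \<in> {1..n} - {i, i+1}}"

definition gbar :: "nat \<Rightarrow> nat \<Rightarrow> vertex set set" where
  "gbar n i = {{Upper i, Upper (i+1), Lower (i+1)}, {Lower i}}
     \<union> {{Upper x, Lower x} |x. x \<in> {1..n} - {i, i+1}}"

definition hbar :: "nat \<Rightarrow> nat \<Rightarrow> vertex set set" where
  "hbar n i = {{Upper i, Upper (i+1), Lower i, Lower (i+1)}}
     \<union> {{Upper x, Lower x} |x. x \<in> {1..n} - {i, i+1}}"

datatype letter = Lf nat | Lg nat | Lh nat

definition alphabet :: "nat \<Rightarrow> letter set" where
  "alphabet n = Lf ` {1..<n} \<union> Lg ` {1..<n} \<union> Lh ` {1..<n}"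

primrec letter_image :: "nat \<Rightarrow> letter \<Rightarrow> vertex set set" where
  "letter_image n (Lf i) = fbar n i"
| "letter_image n (Lg i) = gbar n i"
| "letter_image n (Lh i) = hbar n i"

definition xi :: "nat \<Rightarrow> letter list \<Rightarrow> vertex set set" where
  "xi n = word_morphism (planar_fd_monoid n) (letter_image n)"

text \<open>
  The intersection with the words over \<open>alphabet n\<close> leaves precisely the instances all of whose
  letters exist. A chain \<open>u = v = w\<close> contributes the pairs \<open>(u, v)\<close> and \<open>(v, w)\<close>.
\<close>

definition relations :: "nat \<Rightarrow> (letter list \<times> letter list) set" where
  "relations n = (lists (alphabet n) \<times> lists (alphabet n)) \<inter>
    ({([X i, Y i], [Y i]) |X Y i. X \<in> {Lf, Lg, Lh} \<and> Y \<in> {Lf, Lg, Lh}}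
     \<union> {([Lf i, Lf j], [Lf j, Lf i]) |i j. \<bar>int i - int j\<bar> > 1}
     \<union> {([Lg i, Lg j], [Lg j, Lg i]) |i j. \<bar>int i - int j\<bar> > 1}
     \<union> {([Lh i, Lh j], [Lh j, Lh i]) |i j. True}
     \<union> {([Lf i, Lf (i+1), Lf i], [Lf (i+1), Lf i, Lf (i+1)]) |i. True}
     \<union> {([Lf (i+1), Lf i, Lf (i+1)], [Lf (i+1), Lf i]) |i. True}
     \<union> {([Lg i, Lg (i+1), Lg i], [Lg (i+1), Lg i, Lg (i+1)]) |i. True}
     \<union> {([Lg (i+1), Lg i, Lg (i+1)], [Lg i, Lg (i+1)]) |i. True}
     \<union> {([Lf i, Lg j], [Lg j, Lf i]) |i j. j \<notin> {i, i+1}}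
     \<union> {([Lh i, Lf j], [Lf j, Lh i]) |i j. j \<notin> {i, i-1}}
     \<union> {([Lh i, Lg j], [Lg j, Lh i]) |i j. j \<notin> {i, i+1}}
     \<union> {([Lf i, Lg (i+1)], [Lf i]) |i. True}
     \<union> {([Lg (i+1), Lf i], [Lg (i+1)]) |i. True}
     \<union> {([Lh i, Lg (i+1)], [Lh (i+1), Lf i]) |i. True})"

end

theory Submission
  imports Defs
begin

text \<open>
The generators become transparent when partitions act on two-colourings. A colouring \<open>t\<close> of the
lower row of a full-domain partition leaves at most one colouring \<open>s\<close> of the upper row for which
both together are constant on blocks. The resulting partial map \<open>t \<mapsto> s\<close> determines the partition,
and products of partitions become compositions. Under it \<open>f\<^sub>i\<close> copies the colour at \<open>i\<close> to \<open>i + 1\<close>,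
\<open>g\<^sub>i\<close> copies the colour at \<open>i + 1\<close> to \<open>i\<close>, and \<open>h\<^sub>i\<close> is the identity on the colourings that agree
at \<open>i\<close> and \<open>i + 1\<close>. This yields associativity of the product, soundness of the relations, and the
equivalence of \<open>xi n u = xi n v\<close> with equality of the actions of \<open>u\<close> and \<open>v\<close> (\<open>xi_eq_iff_colour\<close>).

That words with the same action are congruent (\<open>congr_complete\<close>) is shown by induction on the number
\<open>N + 1\<close> of points. Put \<open>e = f\<^sub>N\<close>. For words \<open>x\<close> on \<open>N\<close> points \<open>e x e = e x\<close>, and every product
\<open>e u\<close> is congruent to some \<open>e x T\<^sub>q\<close> with \<open>x\<close> on \<open>N\<close> points, where the word \<open>T\<^sub>q\<close> inserts into the
lower row of \<open>x\<close> either an isolated vertex or a duplicate of a vertex (\<open>word_to_insertion\<close>). If two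
such words act equally with the same \<open>q\<close>, then the insertion can be cancelled and the induction
hypothesis applies; if the \<open>q\<close> differ, the lower row shows both insertions, and the order of the
insertions can be exchanged (\<open>exchange_insertions\<close>, \<open>compare_insertions\<close>). An arbitrary nonempty word
\<open>u\<close> has two neighbours \<open>p\<close>, \<open>p + 1\<close> joined in its upper row. Every word with this property absorbs
\<open>h\<^sub>p\<close> on its left (\<open>merge_or_cut\<close>), and
\<open>h\<^sub>p = f\<^sub>p \<dots> f\<^sub>N g\<^sub>N \<dots> g\<^sub>p\<^sub>+\<^sub>1 h\<^sub>p\<close> (\<open>F_ascent_G\<close>) leads back to words that begin with \<open>e\<close>.

It remains to see that the partitions of words are the planar full-domain ones. Planarity is replaced
by the condition that no two blocks cross with respect to the order of the vertices along the boundary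
of the rectangle. The generators preserve this condition (\<open>xi_noncrossing_full_domain\<close>). Conversely, a
noncrossing full-domain partition other than the identity has two joined neighbours in its upper row,
and in its lower row an isolated vertex or two joined neighbours; deleting one vertex in each row leaves
a smaller partition, and a word \<open>x\<close> for this one yields the word \<open>f\<^sub>m \<dots> f\<^sub>N x T\<^sub>q\<close> for the given one
(\<open>noncrossing_realised\<close>). A planar
partition is noncrossing because arcs that lead from one block around the rectangle would otherwise
have to meet those of another by the Fashoda meet theorem (\<open>planar_imp_noncrossing\<close>). A noncrossing
full-domain partition is drawn with straight segments, except that consecutive lower vertices of a
block are joined by parabolas so flat that they stay below all segments between the rows
(\<open>planar_quotient\<close>).
\<close>

section \<open>Calculating with the relations\<close>

abbreviation words :: "nat \<Rightarrow> letter list set" where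
  "words n \<equiv> lists (alphabet n)"

definition g_descent :: "nat \<Rightarrow> nat \<Rightarrow> letter list" where
  "g_descent m i = map Lg (rev [i..<m])"

text \<open>
After \<open>f\<^sub>m\<^sub>-\<^sub>1\<close> and a word on \<open>m - 1\<close> points this word inserts one vertex into the lower row: for
\<open>q = 2 i - 1\<close> an isolated vertex \<open>i\<close>, for \<open>q = 2 i\<close> a vertex \<open>i + 1\<close> joined to \<open>i\<close>. The values
\<open>1 \<le> q < 2 m\<close> list the possibilities from left to right. If every vertex is doubled into two
strands, as in the Temperley-Lieb picture of planar partitions, then \<open>q\<close> is the left end of the
inserted cup.
\<close>

definition insertion :: "nat \<Rightarrow> nat \<Rightarrow> letter list" where
  "insertion m q = g_descent m (q div 2 + 1) @ (if even q then [Lh (q div 2)] else [])"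

lemma g_descent_self [simp]: "m \<le> i \<Longrightarrow> g_descent m i = []"
  by (simp add: g_descent_def)

lemma g_descent_snoc: "i < m \<Longrightarrow> g_descent m i = g_descent m (Suc i) @ [Lg i]"
  by (simp add: g_descent_def upt_conv_Cons)

lemma g_descent_split: "i \<le> p \<Longrightarrow> p < m \<Longrightarrow> g_descent m i = g_descent m (Suc p) @ Lg p # g_descent p i"
proof -
  assume "i \<le> p" "p < m"
  then have "[i..<m] = [i..<p] @ p # [Suc p..<m]"
    by (metis le_add_diff_inverse less_imp_le_nat upt_add_eq_append upt_conv_Cons)
  then show ?thesis by (simp add: g_descent_def)
qed

lemma set_g_descent: "set (g_descent m i) = Lg ` {i..<m}"
  by (simp add: g_descent_def)

lemma g_descent_in_alphabet: "1 \<le> i \<Longrightarrow> m \<le> k \<Longrightarrow> g_descent m i \<in> words k"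
  by (auto simp: g_descent_def alphabet_def)

lemma insertion_in_alphabet: "1 \<le> q \<Longrightarrow> q < 2 * k \<Longrightarrow> insertion k q \<in> words k"
  using g_descent_in_alphabet[of "q div 2 + 1" k k] by (auto simp: insertion_def alphabet_def elim!: evenE)

lemma insertion_odd: "1 \<le> i \<Longrightarrow> insertion m (2 * i - 1) = g_descent m i"
  unfolding insertion_def by (cases i) auto

lemma insertion_even: "insertion m (2 * i) = g_descent m (Suc i) @ [Lh i]"
  unfolding insertion_def by auto

lemma insertion_cases:
  assumes "1 \<le> q" "q \<le> 2 * N + 1"
  obtains (single) i where "q = 2 * i - 1" "1 \<le> i" "i \<le> Suc N" "insertion m q = g_descent m i"
  | (pair) i where "q = 2 * i" "1 \<le> i" "i \<le> N" "insertion m q = g_descent m (Suc i) @ [Lh i]"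
proof (cases "even q")
  case True
  then obtain i where "q = 2 * i" by blast
  then show ?thesis using pair[of i] assms by (auto simp: insertion_even)
next
  case False
  then obtain i where "q = 2 * i + 1" by (metis oddE)
  then show ?thesis using single[of "Suc i"] assms insertion_odd[of "Suc i"] by auto
qed

text \<open>
A left action of the presented monoid on an arbitrary type. Calculating with the relations then means
rewriting nested function applications, so that the letters around a rewritten subword need not be
mentioned. The two actions used later are that on colourings and that on sets of words.
\<close>

locale letter_action =
  fixes N :: nat and act :: "letter \<Rightarrow> 's \<Rightarrow> 's"
  assumes act_relation: "(u, v) \<in> relations (Suc N) \<Longrightarrow> foldr act u c = foldr act v c"
begin

abbreviation "F i \<equiv> act (Lf i)"
abbreviation "G i \<equiv> act (Lg i)"
abbreviation "H i \<equiv> act (Lh i)"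
abbreviation "W \<equiv> foldr act"

lemma same_index:
  assumes "1 \<le> i" "i \<le> N" "X \<in> {Lf, Lg, Lh}" "Y \<in> {Lf, Lg, Lh}"
  shows "act (X i) (act (Y i) c) = act (Y i) c"
proof -
  have "([X i, Y i], [Y i]) \<in> relations (Suc N)"
    using assms unfolding relations_def alphabet_def by auto
  from act_relation[OF this] show ?thesis by simp
qed

lemma same [simp]:
  assumes "1 \<le> i" "i \<le> N"
  shows "F i (F i c) = F i c" "F i (G i c) = G i c" "F i (H i c) = H i c"
    "G i (F i c) = F i c" "G i (G i c) = G i c" "G i (H i c) = H i c"
    "H i (F i c) = F i c" "H i (G i c) = G i c" "H i (H i c) = H i c"
  using same_index[OF assms] by auto

lemma commuting:
  assumes "1 \<le> i" "i \<le> N" "1 \<le> j" "j \<le> N"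
  shows FF: "\<bar>int i - int j\<bar> > 1 \<Longrightarrow> F i (F j c) = F j (F i c)"
    and GG: "\<bar>int i - int j\<bar> > 1 \<Longrightarrow> G i (G j c) = G j (G i c)"
    and HH: "H i (H j c) = H j (H i c)"
    and FG: "\<lbrakk>j \<noteq> i; j \<noteq> Suc i\<rbrakk> \<Longrightarrow> F i (G j c) = G j (F i c)"
    and HF: "\<lbrakk>j \<noteq> i; i \<noteq> Suc j\<rbrakk> \<Longrightarrow> H i (F j c) = F j (H i c)"
    and HG: "\<lbrakk>j \<noteq> i; j \<noteq> Suc i\<rbrakk> \<Longrightarrow> H i (G j c) = G j (H i c)"
proof -
  have *: "\<bar>int i - int j\<bar> > 1 \<Longrightarrow> ([Lf i, Lf j], [Lf j, Lf i]) \<in> relations (Suc N)"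
    "\<bar>int i - int j\<bar> > 1 \<Longrightarrow> ([Lg i, Lg j], [Lg j, Lg i]) \<in> relations (Suc N)"
    "([Lh i, Lh j], [Lh j, Lh i]) \<in> relations (Suc N)"
    "\<lbrakk>j \<noteq> i; j \<noteq> Suc i\<rbrakk> \<Longrightarrow> ([Lf i, Lg j], [Lg j, Lf i]) \<in> relations (Suc N)"
    "\<lbrakk>j \<noteq> i; i \<noteq> Suc j\<rbrakk> \<Longrightarrow> ([Lh i, Lf j], [Lf j, Lh i]) \<in> relations (Suc N)"
    "\<lbrakk>j \<noteq> i; j \<noteq> Suc i\<rbrakk> \<Longrightarrow> ([Lh i, Lg j], [Lg j, Lh i]) \<in> relations (Suc N)"
    using assms unfolding relations_def alphabet_def by auto
  note ** = *[THEN act_relation, of c, simplified foldr.simps o_apply id_apply]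
  show "\<bar>int i - int j\<bar> > 1 \<Longrightarrow> F i (F j c) = F j (F i c)" by (rule **(1))
  show "\<bar>int i - int j\<bar> > 1 \<Longrightarrow> G i (G j c) = G j (G i c)" by (rule **(2))
  show "H i (H j c) = H j (H i c)" by (rule **(3))
  show "\<lbrakk>j \<noteq> i; j \<noteq> Suc i\<rbrakk> \<Longrightarrow> F i (G j c) = G j (F i c)" by (rule **(4))
  show "\<lbrakk>j \<noteq> i; i \<noteq> Suc j\<rbrakk> \<Longrightarrow> H i (F j c) = F j (H i c)" by (rule **(5))
  show "\<lbrakk>j \<noteq> i; j \<noteq> Suc i\<rbrakk> \<Longrightarrow> H i (G j c) = G j (H i c)" by (rule **(6))
qed

lemma adjacent:
  assumes "1 \<le> i" "Suc i \<le> N"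
  shows "F i (F (Suc i) (F i c)) = F (Suc i) (F i c)"
    "F (Suc i) (F i (F (Suc i) c)) = F (Suc i) (F i c)"
    "G i (G (Suc i) (G i c)) = G i (G (Suc i) c)"
    "G (Suc i) (G i (G (Suc i) c)) = G i (G (Suc i) c)"
    "F i (G (Suc i) c) = F i c"
    "G (Suc i) (F i c) = G (Suc i) c"
    "H i (G (Suc i) c) = H (Suc i) (F i c)"
proof -
  have *: "([Lf i, Lf (Suc i), Lf i], [Lf (Suc i), Lf i, Lf (Suc i)]) \<in> relations (Suc N)"
    "([Lf (Suc i), Lf i, Lf (Suc i)], [Lf (Suc i), Lf i]) \<in> relations (Suc N)"
    "([Lg i, Lg (Suc i), Lg i], [Lg (Suc i), Lg i, Lg (Suc i)]) \<in> relations (Suc N)"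
    "([Lg (Suc i), Lg i, Lg (Suc i)], [Lg i, Lg (Suc i)]) \<in> relations (Suc N)"
    "([Lf i, Lg (Suc i)], [Lf i]) \<in> relations (Suc N)"
    "([Lg (Suc i), Lf i], [Lg (Suc i)]) \<in> relations (Suc N)"
    "([Lh i, Lg (Suc i)], [Lh (Suc i), Lf i]) \<in> relations (Suc N)"
    using assms unfolding relations_def alphabet_def by auto
  show "F i (F (Suc i) (F i c)) = F (Suc i) (F i c)"
    "F (Suc i) (F i (F (Suc i) c)) = F (Suc i) (F i c)"
    "G i (G (Suc i) (G i c)) = G i (G (Suc i) c)"
    "G (Suc i) (G i (G (Suc i) c)) = G i (G (Suc i) c)"
    "F i (G (Suc i) c) = F i c"
    "G (Suc i) (F i c) = G (Suc i) c"
    "H i (G (Suc i) c) = H (Suc i) (F i c)"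
    using *[THEN act_relation] by simp_all
qed

lemma absorb_letter:
  assumes "z \<in> alphabet N"
  shows "F N (act z (F N c)) = F N (act z c)"
proof -
  from assms obtain i where i: "1 \<le> i" "i < N" "z = Lf i \<or> z = Lg i \<or> z = Lh i"
    unfolding alphabet_def by auto
  from i(3) show ?thesis
  proof (elim disjE)
    assume z: "z = Lf i"
    show ?thesis
    proof (cases "N = Suc i")
      case True
      then show ?thesis using z i adjacent(2)[of i c] by simp
    next
      case False
      then show ?thesis using z i FF[of i N c] by simp
    qed
  next
    assume z: "z = Lg i"
    then show ?thesis using i FG[of N i "F N c"] FG[of N i "c"] by simp
  next
    assume z: "z = Lh i"
    then show ?thesis using i HF[of i N] by simp
  qed
qed

text \<open>
The letter \<open>f\<^sub>N\<close> commutes with all letters of smaller index except \<open>f\<^sub>N\<^sub>-\<^sub>1\<close>, where a braid relation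
takes over. So \<open>x \<mapsto> f\<^sub>N x\<close> is multiplicative on the words on \<open>N\<close> points.
\<close>

lemma absorb_word:
  assumes "1 \<le> N" "x \<in> words N"
  shows "F N (W x (F N c)) = F N (W x c)"
  using assms(2)
proof (induction x)
  case (Cons z x)
  then have z: "z \<in> alphabet N" by simp
  have "F N (W (z # x) (F N c)) = F N (act z (F N (W x (F N c))))"
    by (simp add: absorb_letter[OF z])
  also have "\<dots> = F N (act z (F N (W x c)))"
    using Cons by simp
  also have "\<dots> = F N (W (z # x) c)"
    by (simp add: absorb_letter[OF z])
  finally show ?case .
qed (use assms(1) in simp)

lemma W_g_descent_commute:
  assumes "\<And>j d. i \<le> j \<Longrightarrow> j < m \<Longrightarrow> act z (G j d) = G j (act z d)"
  shows "act z (W (g_descent m i) c) = W (g_descent m i) (act z c)"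
proof -
  have "act z (W w c) = W w (act z c)" if "set w \<subseteq> Lg ` {i..<m}" for w
    using that by (induction w) (use assms in \<open>auto\<close>)
  then show ?thesis by (simp add: set_g_descent)
qed

abbreviation "S i \<equiv> W (g_descent (Suc N) i)"

lemma S_step: "i \<le> N \<Longrightarrow> S i c = S (Suc i) (G i c)"
  by (simp add: g_descent_snoc)

lemma S_split: "i \<le> p \<Longrightarrow> p \<le> N \<Longrightarrow> S i c = S (Suc p) (G p (W (g_descent p i) c))"
  by (simp add: g_descent_split)

lemma S_F_less: "1 \<le> p \<Longrightarrow> Suc p < i \<Longrightarrow> p \<le> N \<Longrightarrow> F p (S i c) = S i (F p c)"
  by (rule W_g_descent_commute) (rule FG; simp)

lemma S_G_less: "1 \<le> p \<Longrightarrow> Suc p < i \<Longrightarrow> p \<le> N \<Longrightarrow> G p (S i c) = S i (G p c)"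
  by (rule W_g_descent_commute) (rule GG; simp)

lemma S_H_less: "1 \<le> p \<Longrightarrow> Suc p < i \<Longrightarrow> p \<le> N \<Longrightarrow> H p (S i c) = S i (H p c)"
  by (rule W_g_descent_commute) (rule HG; simp)

lemma S_F_pred:
  assumes "1 \<le> p" "p \<le> N"
  shows "F N (S (Suc p) (F p c)) = F N (S (Suc p) c)"
proof (cases "p = N")
  case False
  then show ?thesis using assms by (simp add: S_step[of "Suc p"] adjacent(6))
qed (use assms in simp)

lemma S_F_self:
  assumes "1 \<le> p" "p \<le> N"
  shows "F N (S p (F p c)) = F N (S (Suc p) c)"
  using assms by (simp add: S_step[of p] S_F_pred)

lemma S_H_self:
  assumes "1 \<le> p" "p \<le> N"
  shows "S p (H p c) = S (Suc p) (H p c)"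
  using assms by (simp add: S_step[of p])

text \<open>
A letter that acts to the right of the inserted vertex passes through the insertion, and its index drops
by one. The lemmas \<open>S\<close> concern isolated vertices, the lemmas \<open>D\<close> duplicated ones.
\<close>

lemma S_F_greater:
  assumes "1 \<le> i" "i \<le> p" "Suc p \<le> N"
  shows "F N (S i (F (Suc p) c)) = F N (F p (S i c))"
proof -
  define y where "y = W (g_descent (Suc p) i) c"
  have y: "F p y = y"
    using assms g_descent_split[of i p "Suc p"] by (simp add: y_def)
  have S: "S i d = S (Suc (Suc p)) (G (Suc p) (W (g_descent (Suc p) i) d))" for d
    using assms by (intro S_split) auto
  have "W (g_descent (Suc p) i) (F (Suc p) c) = F (Suc p) y"
    unfolding y_def by (rule W_g_descent_commute[symmetric]) (rule FG; use assms in simp)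
  then have "F N (S i (F (Suc p) c)) = F N (S (Suc (Suc p)) y)"
    using assms by (simp add: S S_F_pred)
  moreover have "F N (F p (S i c)) = F N (S (Suc (Suc p)) y)"
    using assms by (simp add: S S_F_less adjacent y_def[symmetric] y)
  ultimately show ?thesis by simp
qed

lemma S_G_greater:
  assumes "1 \<le> i" "i \<le> p" "Suc p \<le> N"
  shows "S i (G (Suc p) c) = G p (S i c)"
proof -
  define y where "y = W (g_descent p i) c"
  have S: "S i d = S (Suc (Suc p)) (G (Suc p) (G p (W (g_descent p i) d)))" for d
    using assms S_split[of i "Suc p"] g_descent_split[of i p "Suc p"] by simp
  have "W (g_descent p i) (G (Suc p) c) = G (Suc p) y"
    unfolding y_def by (rule W_g_descent_commute[symmetric]) (rule GG; use assms in simp)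
  then show ?thesis
    using assms by (simp add: S S_G_less adjacent y_def)
qed

lemma S_H_greater:
  assumes "1 \<le> i" "i \<le> p" "Suc p \<le> N"
  shows "S i (H (Suc p) c) = H p (S i c)"
proof -
  define y where "y = W (g_descent (Suc p) i) c"
  have y: "F p y = y"
    using assms g_descent_split[of i p "Suc p"] by (simp add: y_def)
  have S: "S i d = S (Suc (Suc p)) (G (Suc p) (W (g_descent (Suc p) i) d))" for d
    using assms by (intro S_split) auto
  have "W (g_descent (Suc p) i) (H (Suc p) c) = H (Suc p) y"
    unfolding y_def by (rule W_g_descent_commute[symmetric]) (rule HG; use assms in simp)
  then show ?thesis
    using assms by (simp add: S S_H_less adjacent y_def[symmetric] y)
qed

abbreviation "D i c \<equiv> S (Suc i) (H i c)"

lemma D_F_pred: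
  assumes "1 \<le> p" "Suc p \<le> N"
  shows "D (Suc p) (F p c) = H p (S (Suc p) c)"
  using assms by (simp add: S_step[of "Suc p"] S_H_less adjacent(7)[symmetric])

lemma D_F_greater:
  assumes "1 \<le> i" "i \<le> p" "Suc p \<le> N"
  shows "F N (D i (F (Suc p) c)) = F N (F p (D i c))"
proof (cases "i = p")
  case True
  then show ?thesis using assms S_F_self[of "Suc p" "H p c"]
    by (simp add: HF S_step[of "Suc p"] S_F_less adjacent)
next
  case False
  then show ?thesis using assms S_F_greater[of "Suc i" p "H i c"] by (simp add: HF)
qed

lemma D_G_next:
  assumes "1 \<le> i" "Suc i \<le> N"
  shows "D i (G (Suc i) c) = H i (S (Suc i) c)"
  using assms S_H_self[of "Suc i" "F i c"] D_F_pred[of i] by (simp add: adjacent)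

lemma D_G_greater:
  assumes "1 \<le> i" "Suc i \<le> p" "Suc p \<le> N"
  shows "D i (G (Suc p) c) = G p (D i c)"
  using assms S_G_greater[of "Suc i" p "H i c"] by (simp add: HG)

lemma D_H_greater:
  assumes "1 \<le> i" "i \<le> p" "Suc p \<le> N"
  shows "D i (H (Suc p) c) = H p (D i c)"
proof (cases "i = p")
  case True
  then show ?thesis using assms
    by (simp add: S_step[of "Suc p"] HH[of p "Suc p"] S_H_less adjacent)
next
  case False
  then show ?thesis using assms S_H_greater[of "Suc i" p "H i c"] by (simp add: HH)
qed

abbreviation "T q \<equiv> W (insertion (Suc N) q)"

text \<open>
Right multiplication by a letter, in the manner of Reidemeister and Schreier. A letter to the left of
the inserted vertex passes through the insertion unchanged and one to the right with lowered index. A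
letter next to the inserted vertex is absorbed or changes the insertion, in some cases leaving a letter
behind.
\<close>

lemma T_letter:
  assumes N: "1 \<le> N" and z: "z \<in> alphabet (Suc N)" and q: "1 \<le> q" "q \<le> 2 * N + 1"
  obtains (that_main) x q' where "x \<in> words N" "1 \<le> q'" "q' \<le> 2 * N + 1"
    "\<And>c. F N (T q (act z c)) = F N (W x (T q' c))"
proof -
  from z obtain p where p: "1 \<le> p" "p \<le> N" "z = Lf p \<or> z = Lg p \<or> z = Lh p"
    unfolding alphabet_def by auto
  define z' where "z' j = (case z of Lf _ \<Rightarrow> Lf j | Lg _ \<Rightarrow> Lg j | Lh _ \<Rightarrow> Lh j)" for j
  have goal: thesis if "set x \<subseteq> alphabet N" "1 \<le> q'" "q' \<le> 2 * N + 1"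
      "\<And>c. F N (T q (act z c)) = F N (W x (T q' c))" for x q'
    using that by (intro that_main) auto
  have low: "\<lbrakk>1 \<le> j; j < N\<rbrakk> \<Longrightarrow> {Lf j, Lg j, Lh j} \<subseteq> alphabet N" for j
    by (auto simp: alphabet_def)
  from q show thesis
  proof (cases rule: insertion_cases[of q N "Suc N"])
    case (single i)
    note i = single
    consider "Suc p < i" | "Suc p = i" | "p = i" | p' where "p = Suc p'" "i \<le> p'"
      by (metis Suc_lessI linorder_neqE_nat not_less_eq_eq less_iff_Suc_add le_add1)
    then show thesis
    proof cases
      case 1
      then show thesis using p i low[of p]
        by (intro goal[of "[z' p]" q])
          (auto simp: z'_def S_F_less S_G_less S_H_less)
    next
      case 2
      then show thesis using p i N S_F_pred[of p] insertion_odd[of p "Suc N"]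
        by (intro goal[of "[]" "case z of Lf _ \<Rightarrow> q | Lg _ \<Rightarrow> 2 * p - 1 | Lh _ \<Rightarrow> 2 * p"])
          (auto simp: insertion_odd insertion_even S_step[of p])
    next
      case 3
      then show thesis using p i S_F_self[of p] S_H_self[of p] insertion_odd[of "Suc p" "Suc N"]
        by (intro goal[of "[]" "case z of Lf _ \<Rightarrow> 2 * Suc p - 1 | Lg _ \<Rightarrow> q | Lh _ \<Rightarrow> 2 * p"])
          (auto simp: insertion_even S_step[of i])
    next
      case 4
      then show thesis using p i low[of p']
        by (intro goal[of "[z' p']" q])
          (auto simp: z'_def S_F_greater S_G_greater S_H_greater)
    qed
  next
    case (pair i)
    note i = pair
    consider "Suc p < i" | "Suc p = i" | "p = i" | "p = Suc i" | p' where "p = Suc p'" "Suc i \<le> p'"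
      by (metis Suc_lessI linorder_neqE_nat not_less_eq_eq less_iff_Suc_add le_add1)
    then show thesis
    proof cases
      case 1
      then show thesis using p i low[of p]
        by (intro goal[of "[z' p]" q])
          (auto simp: z'_def S_F_less S_G_less S_H_less HF HG HH)
    next
      case 2
      then show thesis using p i low[of p] D_F_pred[of p] insertion_odd[of i "Suc N"]
        by (intro goal[of "[case z of Lf _ \<Rightarrow> Lh p | Lg _ \<Rightarrow> Lg p | Lh _ \<Rightarrow> Lh p]"
              "case z of Lf _ \<Rightarrow> 2 * i - 1 | Lg _ \<Rightarrow> q | Lh _ \<Rightarrow> q"])
          (auto simp: S_G_less S_H_less HG HH[of "Suc p" p])
    next
      case 3
      then show thesis using p i S_F_pred[of p] insertion_odd[of "Suc p" "Suc N"] insertion_odd[of p "Suc N"]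
        by (intro goal[of "[]" "case z of Lf _ \<Rightarrow> 2 * Suc p - 1 | Lg _ \<Rightarrow> 2 * p - 1 | Lh _ \<Rightarrow> q"])
          (auto simp: S_step[of i])
    next
      case 4
      then show thesis using p i low[of i] D_F_greater[of i i] D_G_next[of i] D_H_greater[of i i]
          insertion_odd[of "Suc i" "Suc N"]
        by (intro goal[of "[case z of Lf _ \<Rightarrow> Lf i | Lg _ \<Rightarrow> Lh i | Lh _ \<Rightarrow> Lh i]"
              "case z of Lf _ \<Rightarrow> q | Lg _ \<Rightarrow> 2 * Suc i - 1 | Lh _ \<Rightarrow> q"]) auto
    next
      case 5
      then show thesis using p i low[of p'] D_F_greater[of i p'] D_G_greater[of i p'] D_H_greater[of i p']
        by (intro goal[of "[z' p']" q]) (auto simp: z'_def)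
    qed
  qed
qed

lemma word_to_insertion:
  assumes N: "1 \<le> N" and "u \<in> words (Suc N)"
  shows "\<exists>x q. x \<in> words N \<and> 1 \<le> q \<and> q \<le> 2 * N + 1 \<and>
    (\<forall>c. F N (W u c) = F N (W x (T q c)))"
  using assms(2)
proof (induction u rule: rev_induct)
  case Nil
  show ?case
    by (rule exI[of _ "[]"], rule exI[of _ "2 * N + 1"]) (simp add: insertion_def)
next
  case (snoc z u)
  then obtain x q where x: "x \<in> words N" "1 \<le> q" "q \<le> 2 * N + 1"
    "\<forall>c. F N (W u c) = F N (W x (T q c))" by auto
  from snoc.prems have "z \<in> alphabet (Suc N)" by simp
  then obtain x' q' where x': "x' \<in> words N" "1 \<le> q'" "q' \<le> 2 * N + 1"
    "\<And>c. F N (T q (act z c)) = F N (W x' (T q' c))"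
    using T_letter[OF N _ x(2,3)] by metis
  have "F N (W (u @ [z]) c) = F N (W (x @ x') (T q' c))" for c
    using x(4) x'(4) absorb_word[OF N x(1), of "T q (act z c)"] absorb_word[OF N x(1), of "W x' (T q' c)"]
    by simp
  then show ?case using x x' by (intro exI[of _ "x @ x'"] exI[of _ q']) auto
qed

lemma shift_word:
  assumes N: "1 \<le> N"
    and "\<And>z. z \<in> set zs \<Longrightarrow> z \<in> alphabet N \<and> (\<forall>d. F N (act z (T q d)) = F N (T q (act (raise z) d)))"
  shows "F N (W zs (T q c)) = F N (T q (W (map raise zs) c))"
  using assms(2)
proof (induction zs)
  case (Cons z zs)
  then have z: "z \<in> alphabet N" "\<And>d. F N (act z (T q d)) = F N (T q (act (raise z) d))" by auto
  have "F N (W (z # zs) (T q c)) = F N (act z (F N (W zs (T q c))))"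
    by (simp add: absorb_letter[OF z(1)])
  also have "\<dots> = F N (act z (T q (W (map raise zs) c)))"
    using Cons by (simp add: absorb_letter[OF z(1)])
  finally show ?case by (simp add: z(2))
qed simp

lemma T_top:
  assumes "1 \<le> q" "q + 1 \<le> 2 * N"
  shows "T q (F N c) = F N (W (insertion N q) c)"
proof -
  have S: "S i (F N d) = F N (W (g_descent N i) d)" if "1 \<le> i" "i \<le> N" for i d
  proof -
    have "W (g_descent N i) (F N d) = F N (W (g_descent N i) d)"
      by (rule W_g_descent_commute[symmetric]) (rule FG; use that in simp)
    then show ?thesis using that by (simp add: S_split[of i N])
  qed
  have "1 \<le> q" "q \<le> 2 * N + 1" using assms by auto
  then show ?thesis
  proof (cases rule: insertion_cases[of q N "Suc N"])
    case (single i)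
    then show ?thesis using assms insertion_odd[of i N] by (simp add: S)
  next
    case (pair i)
    then show ?thesis using assms by (simp add: S insertion_even HF)
  qed
qed

text \<open>
Inserting at \<open>q' - 2\<close> and then at \<open>q \<le> q' - 2\<close> amounts to inserting at \<open>q\<close> and then at \<open>q'\<close>.
The letters of the first insertion pass through the second one with raised indices; the letter
\<open>f\<^sub>N\<close> that arises from \<open>f\<^sub>N\<^sub>-\<^sub>1\<close> then removes the topmost \<open>g\<close> of \<open>T q\<close>, which leaves a word on \<open>N\<close>
points.
\<close>

lemma exchange_insertions:
  assumes q: "1 \<le> q" "q + 2 \<le> q'" "q' \<le> 2 * N + 1" and N: "2 \<le> N"
  obtains y where "y \<in> words N"
    "\<And>c. F N (F (N - 1) (W (insertion N (q' - 2)) (T q c))) = F N (W y (T q' c))"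
proof -
  define raise where "raise z = (case z of Lf i \<Rightarrow> Lf (Suc i) | Lg i \<Rightarrow> Lg (Suc i) | Lh i \<Rightarrow> Lh (Suc i))" for z
  have raise_simps: "raise (Lf i) = Lf (Suc i)" "raise (Lg i) = Lg (Suc i)" "raise (Lh i) = Lh (Suc i)" for i
    by (auto simp: raise_def)
  have raise_g_descent: "map raise (g_descent m i) = g_descent (Suc m) (Suc i)" for m i
  proof -
    have "[Suc i..<Suc m] = map Suc [i..<m]" by (simp add: map_Suc_upt)
    then show ?thesis by (simp add: g_descent_def rev_map raise_simps o_def)
  qed
  have raise_insertion: "map raise (insertion N (q' - 2)) = insertion (Suc N) q'"
  proof -
    have "q' div 2 = Suc ((q' - 2) div 2)" "even q' \<longleftrightarrow> even (q' - 2)" using q by auto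
    then show ?thesis by (simp add: insertion_def raise_g_descent raise_simps)
  qed
  show thesis
  proof (cases "q = 2 * N - 1")
    case True
    then have q': "q' = 2 * N + 1" using q by simp
    \<comment> \<open>Here \<open>f\<^sub>N\<^sub>-\<^sub>1\<close> absorbs the inserting letter instead of passing through it.\<close>
    have "insertion N (q' - 2) = []" "insertion (Suc N) q' = []" "insertion (Suc N) q = [Lg N]"
      using q' True N insertion_odd[of N N] insertion_odd[of N "Suc N"] insertion_odd[of "Suc N" "Suc N"]
      by (simp_all add: g_descent_snoc)
    then have "F N (F (N - 1) (W (insertion N (q' - 2)) (T q c))) = F N (W [Lf (N - 1)] (T q' c))" for c
      using N adjacent(5)[of "N - 1" c] by simp
    then show thesis using N by (intro that[of "[Lf (N - 1)]"]) (auto simp: alphabet_def)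
  next
    case False
    define zs where "zs = Lf (N - 1) # insertion N (q' - 2)"
    have "z \<in> alphabet N \<and> (\<forall>d. F N (act z (T q d)) = F N (T q (act (raise z) d)))"
      if z: "z \<in> set zs" for z
    proof -
      have q2: "1 \<le> q' - 2" "q' - 2 \<le> 2 * (N - 1) + 1" using q N by auto
      have "z = Lf (N - 1) \<or> (\<exists>j. z = Lg j \<and> q' - 2 \<le> 2 * j - 1 \<and> 1 \<le> j \<and> j < N) 
          \<or> (\<exists>j. z = Lh j \<and> q' - 2 = 2 * j \<and> j < N \<and> 1 \<le> j)" (is ?z_cases)
        using q2
        by (cases rule: insertion_cases[of "q' - 2" "N - 1" N]) (use z N in \<open>auto simp: zs_def set_g_descent\<close>)
      then have z_cases: ?z_cases .
      have "1 \<le> q" "q \<le> 2 * N + 1" using q by auto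
      then show ?thesis
      proof (cases rule: insertion_cases[of q N "Suc N"])
        case (single i)
        have z': "(z = Lf (N - 1) \<and> i \<le> N - 1) \<or> (\<exists>j. z = Lg j \<and> i \<le> j \<and> j < N) 
            \<or> (\<exists>j. z = Lh j \<and> i \<le> j \<and> j < N)"
          using z_cases single(1,2) q N False by auto
        have "Suc (N - 1) = N" using N by simp
        then show ?thesis using single N z' S_F_greater[of i "N - 1"]
          by (auto simp: raise_simps alphabet_def S_G_greater S_H_greater)
      next
        case (pair i)
        have z': "(z = Lf (N - 1) \<and> i \<le> N - 1) \<or> (\<exists>j. z = Lg j \<and> Suc i \<le> j \<and> j < N) 
            \<or> (\<exists>j. z = Lh j \<and> i \<le> j \<and> j < N)"
          using z_cases pair(1,2) q N False by auto
        have "Suc (N - 1) = N" using N by simp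
        then show ?thesis using pair N z' D_F_greater[of i "N - 1"]
          by (auto simp: raise_simps alphabet_def D_G_greater D_H_greater)
      qed
    qed
    then have shift: "F N (W zs (T q c)) = F N (T q (W (map raise zs) c))" for c
      using N by (intro shift_word) auto
    have "F N (F (N - 1) (W (insertion N (q' - 2)) (T q c))) = F N (W (insertion N q) (T q' c))" for c
      using shift[of c] q False N T_top[of q] by (simp add: zs_def raise_simps raise_insertion)
    moreover have "insertion N q \<in> words N"
      by (rule insertion_in_alphabet) (use q in auto)
    ultimately show thesis using that by blast
  qed
qed

text \<open>
As \<open>f\<^sub>p h\<^sub>p = h\<^sub>p\<close>, this writes \<open>h\<^sub>p\<close> as \<open>f\<^sub>p \<dots> f\<^sub>N\<^sub>-\<^sub>1\<close> followed by a word that begins with \<open>f\<^sub>N\<close>.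
\<close>

lemma F_ascent_G:
  assumes "p \<le> N" "1 \<le> p"
  shows "W (map Lf [p..<Suc N]) (S (Suc p) c) = F p c"
  using assms
proof (induction p arbitrary: c rule: inc_induct)
  case (step p)
  have "W (map Lf [p..<Suc N]) (S (Suc p) c)
      = F p (W (map Lf [Suc p..<Suc N]) (S (Suc (Suc p)) (G (Suc p) c)))"
    using step.hyps by (subst upt_conv_Cons) (auto simp: S_step[of "Suc p"])
  then show ?case using step adjacent(5)[of p] by simp
qed simp

end

section \<open>Colourings\<close>

text \<open>
The colouring of the upper row of a generator for a given colouring of its lower row, if there is one
with which both rows together are constant on blocks.
\<close>

primrec colour_step :: "letter \<Rightarrow> (nat \<Rightarrow> bool) \<Rightarrow> (nat \<Rightarrow> bool) option" where
  "colour_step (Lf i) t = Some (t(Suc i := t i))"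
| "colour_step (Lg i) t = Some (t(i := t (Suc i)))"
| "colour_step (Lh i) t = (if t i = t (Suc i) then Some t else None)"

definition colour_act :: "letter \<Rightarrow> (nat \<Rightarrow> bool) option \<Rightarrow> (nat \<Rightarrow> bool) option" where
  "colour_act z c = Option.bind c (colour_step z)"

definition colour :: "letter list \<Rightarrow> (nat \<Rightarrow> bool) \<Rightarrow> (nat \<Rightarrow> bool) option" where
  "colour w t = foldr colour_act w (Some t)"

lemma colour_act_simps [simp]: "colour_act z None = None" "colour_act z (Some t) = colour_step z t"
  by (simp_all add: colour_act_def)

lemma foldr_colour_act_None [simp]: "foldr colour_act w None = None"
  by (induction w) auto

lemma colour_Nil [simp]: "colour [] t = Some t"
  by (simp add: colour_def)

lemma colour_Cons: "colour (z # w) t = Option.bind (colour w t) (colour_step z)"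
  by (simp add: colour_def colour_act_def)

lemma colour_append: "colour (u @ v) t = Option.bind (colour v t) (colour u)"
  by (cases "colour v t") (simp_all add: colour_def)

lemma colour_relation:
  assumes "(u, v) \<in> relations n"
  shows "foldr colour_act u c = foldr colour_act v c"
proof (cases c)
  case (Some t)
  from assms have "foldr colour_act u (Some t) = foldr colour_act v (Some t)"
    unfolding relations_def
    by (elim IntE UnE CollectE exE conjE) (auto simp: fun_eq_iff)
  then show ?thesis by (simp add: Some)
qed simp

interpretation colouring: letter_action N colour_act for N
  by unfold_locales (rule colour_relation)

text \<open>
The context rule does not restrict the letters of the context. The membership conditions of the free
monoid are thus kept out of the calculations until \<open>congr_in_congruence\<close>.
\<close>

inductive congr :: "nat \<Rightarrow> letter list \<Rightarrow> letter list \<Rightarrow> bool" for n where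
  base: "(u, v) \<in> relations n \<Longrightarrow> congr n u v"
| reflexive [intro, simp]: "congr n u u"
| symmetric: "congr n u v \<Longrightarrow> congr n v u"
| transitive [trans]: "congr n u v \<Longrightarrow> congr n v w \<Longrightarrow> congr n u w"
| embed: "congr n u v \<Longrightarrow> congr n (a @ u @ b) (a @ v @ b)"

lemma congr_Suc: "congr N u v \<Longrightarrow> congr (Suc N) u v"
proof (induction rule: congr.induct)
  case (base u v)
  have "alphabet N \<subseteq> alphabet (Suc N)" by (auto simp: alphabet_def)
  then have "words N \<subseteq> words (Suc N)" by (rule lists_mono)
  then have "relations N \<subseteq> relations (Suc N)" unfolding relations_def by blast
  then show ?case using base by (auto intro: congr.base)
qed (blast intro: congr.intros)+

lemma (in letter_action) congr_act:
  "congr (Suc N) u v \<Longrightarrow> foldr act u c = foldr act v c"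
  by (induction arbitrary: c rule: congr.induct) (auto dest: act_relation)

lemma congr_colour: 
  assumes "congr n u v" shows "colour u = colour v"
proof -
  have "congr (Suc n) u v" using assms by (rule congr_Suc)
  from colouring.congr_act[OF this] show ?thesis
    by (intro ext) (simp only: colour_def)
qed

text \<open>
The regular action of the presented monoid, with arbitrary sets of words in place of congruence classes.
Equality of two words as functions under this action means congruence (\<open>congr_iff_left_mult\<close>).
\<close>

definition left_mult :: "nat \<Rightarrow> letter \<Rightarrow> letter list set \<Rightarrow> letter list set" where
  "left_mult n z C = {v. \<exists>u \<in> C. congr n (z # u) v}"

lemma congr_append_left: "congr n u v \<Longrightarrow> congr n (a @ u) (a @ v)"
  using congr.embed[of n u v a "[]"] by simp

lemma congr_append_right: "congr n u v \<Longrightarrow> congr n (u @ b) (v @ b)"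
  using congr.embed[of n u v "[]" b] by simp

lemma foldr_left_mult:
  assumes "w \<noteq> []"
  shows "foldr (left_mult n) w C = {v. \<exists>u \<in> C. congr n (w @ u) v}"
  using assms
proof (induction w)
  case (Cons z w)
  show ?case
  proof (cases "w = []")
    case False
    then have "foldr (left_mult n) w C = {v. \<exists>u \<in> C. congr n (w @ u) v}"
      using Cons by simp
    then have "foldr (left_mult n) (z # w) C
        = {v. \<exists>u' u. u \<in> C \<and> congr n (w @ u) u' \<and> congr n (z # u') v}"
      by (auto simp: left_mult_def)
    also have "\<dots> = {v. \<exists>u \<in> C. congr n (z # w @ u) v}"
      using congr_append_left[of n _ _ "[z]"] by (auto intro: congr.transitive)
    finally show ?thesis by simp
  qed (simp add: left_mult_def)
qed simp

lemma letter_action_left_mult: "letter_action N (left_mult (Suc N))"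
proof
  fix u v and C :: "letter list set"
  assume uv: "(u, v) \<in> relations (Suc N)"
  then have "u \<noteq> []" "v \<noteq> []" unfolding relations_def by auto
  moreover have "congr (Suc N) (u @ w) x \<longleftrightarrow> congr (Suc N) (v @ w) x" for w x
    using congr_append_right[OF congr.base[OF uv], of w] by (meson congr.symmetric congr.transitive)
  ultimately show "foldr (left_mult (Suc N)) u C = foldr (left_mult (Suc N)) v C"
    by (simp add: foldr_left_mult)
qed

interpretation classes: letter_action N "left_mult (Suc N)" for N
  by (rule letter_action_left_mult)

lemma congr_iff_left_mult:
  "congr (Suc N) u v \<longleftrightarrow> (\<forall>C. foldr (left_mult (Suc N)) u C = foldr (left_mult (Suc N)) v C)"
proof
  assume eq: "\<forall>C. foldr (left_mult (Suc N)) u C = foldr (left_mult (Suc N)) v C"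
  have "foldr (left_mult (Suc N)) w {v. congr (Suc N) [] v} = {v. congr (Suc N) w v}" for w
  proof (induction w)
    case (Cons z w)
    then show ?case using congr_append_left[of "Suc N" _ _ "[z]"]
      by (auto simp: left_mult_def intro: congr.transitive congr.reflexive)
  qed simp
  from this[of u] this[of v] eq have "{w. congr (Suc N) u w} = {w. congr (Suc N) v w}" by metis
  then show "congr (Suc N) u v" by blast
qed (use classes.congr_act in blast)

section \<open>Joined neighbours in the upper row\<close>

text \<open>
Upper blocks are intervals, so \<open>m\<close> and \<open>m + 1\<close> lie in different blocks only if the colouring that
changes just between them is attained. Prepending a letter preserves this step colouring or moves it by
one place. For \<open>f\<^sub>m\<^sub>-\<^sub>1\<close> and \<open>g\<^sub>m\<^sub>+\<^sub>1\<close> it arises from two places; if neither step is attained, then the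
rest of the word absorbs the letters \<open>h\<close> at both places, and these absorb the new letter.
\<close>

lemma (in letter_action) merge_or_cut:
  assumes "w \<in> words (Suc N)" "1 \<le> m" "m \<le> N"
  shows "(\<forall>c. H m (W w c) = W w c) \<or> (\<exists>t. colour w t = Some (\<lambda>x. m < x))"
  using assms
proof (induction w arbitrary: m rule: list.induct)
  case Nil
  then show ?case by auto
next
  case (Cons z w)
  then obtain p where p: "1 \<le> p" "p \<le> N" "z = Lf p \<or> z = Lg p \<or> z = Lh p"
    unfolding alphabet_def by auto
  note IH = Cons.IH[OF _ p(1,2)] Cons.IH[OF _ Cons.prems(2,3)]
  have w: "w \<in> words (Suc N)" using Cons.prems by simp
  have both: "H p (H m d) = H m (H p d)" for d using p Cons.prems by (simp add: HH)
  have step: "colour (z # w) t = colour_step z s" if "colour w t = Some s" for t s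
    using that by (simp add: colour_Cons)
  show ?case
  proof (cases "m = p")
    case True
    then show ?thesis using p by auto
  next
    case mp: False
    from p(3) consider (f) "z = Lf p" "m \<noteq> Suc p" | (f') "z = Lf p" "m = Suc p"
      | (g) "z = Lg p" "p \<noteq> Suc m" | (g') "z = Lg p" "p = Suc m" | (h) "z = Lh p" by blast
    then show ?thesis
    proof cases
      case f
      have keep: "colour_step z (\<lambda>x. m < x) = Some (\<lambda>x. m < x)" using f mp by (auto simp: fun_eq_iff)
      from IH(2)[OF w] show ?thesis
      proof
        assume "\<forall>c. H m (W w c) = W w c"
        then show ?thesis using f mp p Cons.prems by (intro disjI1 allI) (simp add: HF)
      next
        assume "\<exists>t. colour w t = Some (\<lambda>x. m < x)"
        then show ?thesis using step keep by metis
      qed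
    next
      case g
      have keep: "colour_step z (\<lambda>x. m < x) = Some (\<lambda>x. m < x)" using g mp by (auto simp: fun_eq_iff)
      from IH(2)[OF w] show ?thesis
      proof
        assume "\<forall>c. H m (W w c) = W w c"
        then show ?thesis using g mp p Cons.prems by (intro disjI1 allI) (simp add: HG)
      next
        assume "\<exists>t. colour w t = Some (\<lambda>x. m < x)"
        then show ?thesis using step keep by metis
      qed
    next
      case h
      have keep: "colour_step z (\<lambda>x. m < x) = Some (\<lambda>x. m < x)" using h mp by (auto simp: fun_eq_iff)
      from IH(2)[OF w] show ?thesis
      proof
        assume "\<forall>c. H m (W w c) = W w c"
        then show ?thesis using h mp p Cons.prems by (intro disjI1 allI) (simp add: both[symmetric])
      next
        assume "\<exists>t. colour w t = Some (\<lambda>x. m < x)"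
        then show ?thesis using step keep by metis
      qed
    next
      case f'
      have "colour_step z (\<lambda>x. m < x) = Some (\<lambda>x. m < x)" 
        "colour_step z (\<lambda>x. p < x) = Some (\<lambda>x. m < x)" using f' by (auto simp: fun_eq_iff)
      moreover have "H m (W (z # w) c) = W (z # w) c"
        if "H m (W w c) = W w c" "H p (W w c) = W w c" for c
      proof -
        have "F p (W w c) = W w c"
          using same(3)[OF p(1,2), of "W w c"] that(2) by simp
        then show ?thesis using f' that by simp
      qed
      ultimately show ?thesis using IH[OF w] step by metis
    next
      case g'
      have "colour_step z (\<lambda>x. m < x) = Some (\<lambda>x. m < x)" 
        "colour_step z (\<lambda>x. p < x) = Some (\<lambda>x. m < x)" using g' by (auto simp: fun_eq_iff)
      moreover have "H m (W (z # w) c) = W (z # w) c"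
        if "H m (W w c) = W w c" "H p (W w c) = W w c" for c
      proof -
        have "G p (W w c) = W w c"
          using same(6)[OF p(1,2), of "W w c"] that(2) by simp
        then show ?thesis using g' that by simp
      qed
      ultimately show ?thesis using IH[OF w] step by metis
    qed
  qed
qed

section \<open>Isolated vertices and joined neighbours in the lower row\<close>

text \<open>
The property of the lower row produced by \<open>insertion m q\<close>: for \<open>q = 2 i - 1\<close> the vertex \<open>i\<close> is
isolated, as its colour has no influence, and for \<open>q = 2 i\<close> the vertices \<open>i\<close> and \<open>i + 1\<close> are joined.
\<close>

definition cup :: "nat \<Rightarrow> letter list \<Rightarrow> bool" where
  "cup q w \<longleftrightarrow> (if even q
     then \<forall>t. colour w t \<noteq> None \<longrightarrow> t (q div 2) = t (Suc (q div 2))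
     else \<forall>t c. colour w (t(q div 2 + 1 := c)) = colour w t)"

lemma colour_const: "colour w (\<lambda>_. b) = Some (\<lambda>_. b)"
proof (induction w)
  case (Cons z w)
  then show ?case by (cases z) (auto simp: colour_Cons)
qed simp

lemma not_cup_adjacent: "cup q w \<Longrightarrow> \<not> cup (Suc q) w"
proof
  assume c: "cup q w" "cup (Suc q) w"
  have T: "colour w (\<lambda>_. True) = Some (\<lambda>_. True)" by (rule colour_const)
  show False
  proof (cases "even q")
    case True
    then have "colour w ((\<lambda>_. True)(Suc (q div 2) := False)) \<noteq> None"
      using c(2) T by (simp add: cup_def)
    then show False using True c(1) unfolding cup_def
      by (metis fun_upd_other fun_upd_same n_not_Suc_n)
  next
    case False
    then have "colour w ((\<lambda>_. True)(Suc (q div 2) := False)) \<noteq> None"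
      using c(1) T by (simp add: cup_def)
    moreover have "Suc q div 2 = Suc (q div 2)" using False by auto
    ultimately show False using False c(2) unfolding cup_def
      by (metis even_Suc fun_upd_other fun_upd_same n_not_Suc_n)
  qed
qed

lemma colour_g_descent: "colour (g_descent m i) t = Some (\<lambda>x. if i \<le> x \<and> x < m then t (Suc x) else t x)"
proof (cases "i \<le> m")
  case True
  then show ?thesis
  proof (induction i arbitrary: t rule: inc_induct)
    case (step i)
    have "g_descent m i = g_descent m (Suc i) @ [Lg i]" using step by (intro g_descent_snoc) auto
    then show ?case using step by (auto simp: colour_append colour_Cons fun_eq_iff)
  qed auto
qed auto

lemma colour_insertion: "colour (insertion m q) t =
    (if even q \<and> t (q div 2) \<noteq> t (Suc (q div 2)) then None
     else Some (\<lambda>x. if q div 2 < x \<and> x < m then t (Suc x) else t x))"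
  by (auto simp: insertion_def colour_append colour_Cons colour_g_descent fun_eq_iff)

lemma colour_glue:
  assumes "x \<in> words N"
  shows "colour x (\<lambda>i. if i \<le> N then t i else u i)
    = map_option (\<lambda>s i. if i \<le> N then s i else u i) (colour x t)"
  using assms
proof (induction x)
  case (Cons z x)
  then obtain p where p: "1 \<le> p" "p < N" "z = Lf p \<or> z = Lg p \<or> z = Lh p"
    unfolding alphabet_def by auto
  show ?case
  proof (cases "colour x t")
    case (Some s)
    then show ?thesis using Cons p by (auto simp: colour_Cons fun_eq_iff)
  qed (use Cons in \<open>auto simp: colour_Cons\<close>)
qed simp

lemma colour_outside:
  assumes "x \<in> words N" "colour x t = Some s" "N < i"
  shows "s i = t i"
proof -
  have "Some s = map_option (\<lambda>s i. if i \<le> N then s i else t i) (Some s)"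
    using colour_glue[OF assms(1), of t t] unfolding if_cancel assms(2) .
  then have "s = (\<lambda>i. if i \<le> N then s i else t i)" by simp
  from fun_cong[OF this, of i] show ?thesis using assms(3) by simp
qed

definition insert_at :: "nat \<Rightarrow> (nat \<Rightarrow> bool) \<Rightarrow> nat \<Rightarrow> bool" where
  "insert_at k t = (\<lambda>x. if x < k then t x else t (x - 1))"

text \<open>
On colourings with a duplicated value, \<open>f\<^sub>N x T\<^sub>q\<close> acts as \<open>x\<close>, apart from a further upper vertex joined
to the last one. In this way properties of \<open>x\<close> are read off from the longer word.
\<close>

lemma colour_insert:
  assumes "x \<in> words N" "1 \<le> q" "q \<le> 2 * N + 1"
  shows "colour (Lf N # x @ insertion (Suc N) q) (insert_at (Suc (q div 2)) t)
    = map_option (\<lambda>s i. if i \<le> N then s i else if i = Suc N then s N else t (i - 1)) (colour x t)"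
proof -
  have "colour (insertion (Suc N) q) (insert_at (Suc (q div 2)) t)
      = Some (\<lambda>i. if i \<le> N then t i else t (i - 1))"
    using assms by (auto simp: colour_insertion insert_at_def fun_eq_iff)
  then show ?thesis
    by (cases "colour x t") (auto simp: colour_Cons colour_append colour_glue[OF assms(1)] fun_eq_iff)
qed

lemma colour_eqI:
  assumes "x \<in> words N" "y \<in> words N" "\<And>i. N < i \<Longrightarrow> t i = t' i"
    and eq: "map_option \<phi> (colour x t) = map_option \<psi> (colour y t')"
    and inner: "\<And>s i. i \<le> N \<Longrightarrow> \<phi> s i = s i" "\<And>s i. i \<le> N \<Longrightarrow> \<psi> s i = s i"
  shows "colour x t = colour y t'"
proof (cases "colour x t")
  case (Some s)
  then obtain s' where s': "colour y t' = Some s'" "\<phi> s = \<psi> s'"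
    using eq by (cases "colour y t'") simp_all
  have "s i = s' i" for i
  proof (cases "i \<le> N")
    case True
    then show ?thesis using inner[of i] fun_cong[OF s'(2), of i] by simp
  next
    case False
    then show ?thesis
      using colour_outside[OF assms(1) Some] colour_outside[OF assms(2) s'(1)] assms(3) by simp
  qed
  then have "s = s'" by (rule ext)
  then show ?thesis using Some s'(1) by simp
next
  case None
  with eq have "colour y t' = None" by (metis map_option_is_None)
  with None show ?thesis by metis
qed

lemma insertion_cancel:
  assumes "x \<in> words N" "y \<in> words N" "1 \<le> q" "q \<le> 2 * N + 1"
    and "colour (Lf N # x @ insertion (Suc N) q) = colour (Lf N # y @ insertion (Suc N) q)"
  shows "colour x = colour y"
proof
  fix t
  have "map_option (\<lambda>s i. if i \<le> N then s i else if i = Suc N then s N else t (i - 1)) (colour x t)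
      = map_option (\<lambda>s i. if i \<le> N then s i else if i = Suc N then s N else t (i - 1)) (colour y t)"
    using colour_insert[OF assms(1,3,4), of t] colour_insert[OF assms(2,3,4), of t] assms(5) by simp
  then show "colour x t = colour y t"
    by (rule colour_eqI[OF assms(1,2), rotated]) simp_all
qed

lemma cup_insertion:
  assumes "x \<in> words N" "1 \<le> q" "q \<le> 2 * N + 1"
  shows "cup q (Lf N # x @ insertion (Suc N) q)"
proof (cases "even q")
  case True
  then show ?thesis
    by (auto simp: cup_def colour_Cons colour_append colour_insertion split: if_splits)
next
  case False
  define k where "k = q div 2 + 1"
  have less: "q div 2 < i \<longleftrightarrow> k \<le> i" for i by (auto simp: k_def)
  have k: "k \<le> Suc N" using assms False by (auto simp: k_def)
  have "colour (Lf N # x @ insertion (Suc N) q) (t(k := c)) = colour (Lf N # x @ insertion (Suc N) q) t" for t c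
  proof -
    define r where "r = (\<lambda>i. if k \<le> i \<and> i < Suc N then t (Suc i) else t i)"
    have 1: "colour (insertion (Suc N) q) t = Some r"
      using False by (auto simp: colour_insertion less r_def fun_eq_iff)
    have 2: "colour (insertion (Suc N) q) (t(k := c)) = Some (if k = Suc N then r(Suc N := c) else r)"
      using False k by (auto simp: colour_insertion less r_def fun_eq_iff)
    have "(\<lambda>i. if i \<le> N then r i else (r(Suc N := c)) i) = r(Suc N := c)" by auto
    then have 3: "colour x (r(Suc N := c)) = map_option (\<lambda>s i. if i \<le> N then s i else (r(Suc N := c)) i) (colour x r)"
      using colour_glue[OF assms(1), of r "r(Suc N := c)"] by simp
    show ?thesis
    proof (cases "colour x r")
      case (Some s)
      then show ?thesis using colour_outside[OF assms(1) Some]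
        by (auto simp: colour_Cons colour_append 1 2 3 fun_eq_iff)
    qed (simp add: colour_Cons colour_append 1 2 3)
  qed
  then show ?thesis using False by (simp add: cup_def k_def)
qed

lemma cup_before_insertion:
  assumes x: "x \<in> words N" and q: "1 \<le> q" "q + 2 \<le> q'" "q' \<le> 2 * N + 1"
    and cup: "cup q' (Lf N # x @ insertion (Suc N) q)"
  shows "cup (q' - 2) x"
proof -
  define k where "k = Suc (q div 2)"
  have ins: "colour (Lf N # x @ insertion (Suc N) q) (insert_at k t)
    = map_option (\<lambda>s i. if i \<le> N then s i else if i = Suc N then s N else t (i - 1)) (colour x t)" for t
    unfolding k_def by (rule colour_insert) (use x q in auto)
  show ?thesis
  proof (cases "even q'")
    case True
    then obtain j where "q' = 2 * j" by (rule evenE)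
    then obtain l where l: "q' = 2 * Suc l" using q by (cases j) auto
    have "t l = t (Suc l)" if "colour x t \<noteq> None" for t
    proof -
      have "insert_at k t (Suc l) = insert_at k t (Suc (Suc l))"
        using cup that ins[of t] by (auto simp: cup_def l)
      then show ?thesis using q l by (auto simp: insert_at_def k_def split: if_splits)
    qed
    then show ?thesis by (simp add: cup_def l)
  next
    case False
    then obtain l where l': "q' = 2 * l + 1" by (rule oddE)
    then obtain j where j: "l = Suc j" using q by (cases l) auto
    note l = l'[unfolded j]
    have "colour x (t(Suc j := c)) = colour x t" for t c
    proof -
      have "insert_at k (t(Suc j := c)) = (insert_at k t)(Suc (Suc j) := c)"
        using q l by (auto simp: insert_at_def k_def fun_eq_iff)
      then have eq: "colour (Lf N # x @ insertion (Suc N) q) (insert_at k (t(Suc j := c)))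
          = colour (Lf N # x @ insertion (Suc N) q) (insert_at k t)"
        using cup by (simp add: cup_def l)
      have "j < N" using q l by simp
      then show ?thesis
        by (intro colour_eqI[OF x x _ eq[unfolded ins]]) simp_all
    qed
    then show ?thesis by (simp add: cup_def l)
  qed
qed

text \<open>
For suitable \<open>f\<close> the word \<open>f f\<^sub>M T\<^sub>q\<close> acts as one of the idempotents \<open>g\<^sub>i\<close>, \<open>h\<^sub>i\<close>, \<open>f\<^sub>M\<close> that have
the cup \<open>q\<close>, and a word with this cup absorbs that idempotent on its right.
\<close>

lemma cup_absorb:
  assumes "cup q x" "1 \<le> q" "q < 2 * Suc M" "1 \<le> M"
  obtains f where "f \<in> words (Suc M)"
    "colour (x @ f @ Lf M # insertion (Suc M) q) = colour x"
proof -
  define i where "i = (if even q then q div 2 else q div 2 + 1)"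
  have i: "1 \<le> i" using assms(2) by (auto simp: i_def elim!: evenE)
  define z where "z = map Lf [i..<M] @ Lf M # insertion (Suc M) q"
  have snoc: "map Lf [i..<M] @ Lf M # w = map Lf [i..<Suc M] @ w" if "i \<le> M" for w
    using that by simp
  have "colour (x @ z) t = colour x t" for t
  proof (cases "even q")
    case True
    then have iM: "i \<le> M" "q = 2 * i" using assms by (auto simp: i_def)
    have "colour z t = colour_act (Lh i) (Some t)"
      unfolding z_def snoc[OF iM(1)] using True iM i
        colouring.F_ascent_G[of i M "colour_act (Lh i) (Some t)"] colouring.same(3)[of i M "Some t"]
      by (simp add: colour_def insertion_even)
    moreover have "colour x t \<noteq> None \<Longrightarrow> t i = t (Suc i)"
      using True assms(1) iM by (simp add: cup_def)
    ultimately show ?thesis by (cases "colour x t") (auto simp: colour_append)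
  next
    case False
    have "\<exists>c. colour z t = Some (t(i := c))"
    proof (cases "i \<le> M")
      case True
      have q: "insertion (Suc M) q = g_descent (Suc M) (Suc i) @ [Lg i]"
        using True False g_descent_snoc[of i "Suc M"] by (simp add: i_def insertion_def)
      have "colour z t = colour_act (Lg i) (Some t)"
        unfolding z_def snoc[OF True] q using True i
          colouring.F_ascent_G[of i M "colour_act (Lg i) (Some t)"] colouring.same(2)[of i M "Some t"]
        by (simp add: colour_def)
      then show ?thesis by auto
    next
      case iM: False
      then have "i = Suc M" using False assms(3) by (auto simp: i_def elim!: oddE)
      then show ?thesis using False i_def by (auto simp: z_def insertion_def colour_Cons)
    qed
    then show ?thesis using False assms(1) by (auto simp: colour_append cup_def i_def)
  qed
  moreover have "map Lf [i..<M] \<in> words (Suc M)"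
    using i by (auto simp: alphabet_def)
  ultimately show ?thesis using that[of "map Lf [i..<M]"] by (auto simp: z_def)
qed

section \<open>Words with the same action on colourings are congruent\<close>

text \<open>
For \<open>q = q'\<close> the insertion is cancelled. Otherwise \<open>q + 2 \<le> q'\<close>, because the common lower row shows
both cups; then \<open>x\<close> has the cup \<open>q' - 2\<close>, so by the hypothesis on \<open>N\<close> points it can be rewritten to
end with the insertion at \<open>q' - 2\<close>, and exchanging the two insertions leads to the first case.
\<close>

lemma compare_insertions:
  assumes IH: "\<And>u v. \<lbrakk>u \<in> words N; v \<in> words N; colour u = colour v\<rbrakk> \<Longrightarrow> congr N u v"
    and N: "1 \<le> N"
    and x: "x \<in> words N" and y: "y \<in> words N"
    and q: "1 \<le> q" "q \<le> q'" "q' \<le> 2 * N + 1"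
    and eq: "colour (Lf N # x @ insertion (Suc N) q) = colour (Lf N # y @ insertion (Suc N) q')"
  shows "congr (Suc N) (Lf N # x @ insertion (Suc N) q) (Lf N # y @ insertion (Suc N) q')"
proof -
  have same: "congr (Suc N) (Lf N # x @ insertion (Suc N) q') (Lf N # y @ insertion (Suc N) q')"
    if "x \<in> words N"
      "colour (Lf N # x @ insertion (Suc N) q') = colour (Lf N # y @ insertion (Suc N) q')" for x
  proof -
    have "colour x = colour y"
      by (rule insertion_cancel[OF that(1) y]) (use q that in auto)
    then have "congr (Suc N) x y" using IH that y by (intro congr_Suc) auto
    then show ?thesis
      using congr.embed[of "Suc N" x y "[Lf N]" "insertion (Suc N) q'"] by simp
  qed
  have cup': "cup q' (Lf N # x @ insertion (Suc N) q)"
    using cup_insertion[OF y, of q'] q unfolding cup_def eq by simp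
  have cup: "cup q (Lf N # x @ insertion (Suc N) q)"
    by (rule cup_insertion) (use x q in auto)
  have "q' \<noteq> Suc q" using not_cup_adjacent[OF cup] cup' by auto
  then consider "q' = q" | "q + 2 \<le> q'" using q by linarith
  then show ?thesis
  proof cases
    case 1
    then show ?thesis using same x eq by auto
  next
    case 2
    have cx: "cup (q' - 2) x" by (rule cup_before_insertion[OF x q(1) 2 q(3) cup'])
    have "N \<noteq> 1"
    proof
      assume "N = 1"
      then have "x = []" "q' = 3" using x 2 q by (auto simp: alphabet_def)
      then have "colour [] ((\<lambda>_. True)(1 := False)) = colour [] (\<lambda>_. True)"
        using cx unfolding cup_def by (auto simp del: colour_Nil)
      then show False by (auto dest: fun_cong[of _ _ 1])
    qed
    then obtain M where M: "N = Suc M" "1 \<le> M" using N by (cases N) auto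
    have bounds: "1 \<le> q' - 2" "q' - 2 < 2 * Suc M" using q 2 M by auto
    obtain f where f: "f \<in> words N" "colour (x @ f @ Lf M # insertion N (q' - 2)) = colour x"
      unfolding M(1) by (rule cup_absorb[OF cx bounds M(2)])
    have "Lf M # insertion N (q' - 2) \<in> words N"
      using M q 2 insertion_in_alphabet[of "q' - 2" N] by (auto simp: alphabet_def)
    then have "congr N x (x @ f @ Lf M # insertion N (q' - 2))"
      using x f by (intro IH) auto
    then have c1: "congr (Suc N) x (x @ f @ Lf M # insertion N (q' - 2))" by (rule congr_Suc)
    obtain y' where y': "y' \<in> words N"
      "\<And>C. classes.F N N (classes.F N (N - 1) (classes.W N (insertion N (q' - 2)) (classes.T N q C)))
        = classes.F N N (classes.W N y' (classes.T N q' C))"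
      by (rule classes.exchange_insertions[of q q' N]) (use q 2 M in auto)
    define x' where "x' = (x @ f) @ y'"
    have x': "x' \<in> words N" using x f y' by (auto simp: x'_def)
    have "congr (Suc N) (Lf N # x @ insertion (Suc N) q) (Lf N # (x @ f) @ Lf M # insertion N (q' - 2) @ insertion (Suc N) q)"
      using congr.embed[OF c1, of "[Lf N]" "insertion (Suc N) q"] by simp
    also have "congr (Suc N) \<dots> (Lf N # x' @ insertion (Suc N) q')"
    proof (unfold congr_iff_left_mult, intro allI)
      fix C
      have xf: "x @ f \<in> words N" using x f by auto
      note ab = classes.absorb_word[OF N xf, symmetric]
      show "classes.W N (Lf N # (x @ f) @ Lf M # insertion N (q' - 2) @ insertion (Suc N) q) C
          = classes.W N (Lf N # x' @ insertion (Suc N) q') C"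
        using ab[of "classes.F N (N - 1) (classes.W N (insertion N (q' - 2)) (classes.T N q C))"]
          ab[of "classes.W N y' (classes.T N q' C)"] y'(2)[of C] M
        by (simp add: x'_def)
    qed
    finally have c2: "congr (Suc N) (Lf N # x @ insertion (Suc N) q) (Lf N # x' @ insertion (Suc N) q')" .
    from congr_colour[OF c2] eq have "colour (Lf N # x' @ insertion (Suc N) q') = colour (Lf N # y @ insertion (Suc N) q')"
      by simp
    from congr.transitive[OF c2 same[OF x' this]] show ?thesis .
  qed
qed

text \<open>
With \<open>p\<close> the index of the first letter of \<open>u\<close>, both words absorb \<open>h\<^sub>p\<close> on their left, and expanding this
\<open>h\<^sub>p\<close> reduces the claim to two words that begin with \<open>f\<^sub>N\<close>.
\<close>

theorem congr_complete:
  "\<lbrakk>u \<in> words n; v \<in> words n; colour u = colour v\<rbrakk> \<Longrightarrow> congr n u v"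
proof (induction n arbitrary: u v)
  case 0
  then show ?case by (auto simp: alphabet_def)
next
  case (Suc N)
  show ?case
  proof (cases "N = 0")
    case True
    then show ?thesis using Suc by (auto simp: alphabet_def)
  next
    case False
    then have N: "1 \<le> N" by simp
    have top: "congr (Suc N) (Lf N # u) (Lf N # v)"
      if uv: "u \<in> words (Suc N)" "v \<in> words (Suc N)" "colour u = colour v" for u v
    proof -
      obtain x q where x: "x \<in> words N" "1 \<le> q" "q \<le> 2 * N + 1"
        "congr (Suc N) (Lf N # u) (Lf N # x @ insertion (Suc N) q)"
        using classes.word_to_insertion[OF N uv(1)] by (auto simp: congr_iff_left_mult)
      obtain y q' where y: "y \<in> words N" "1 \<le> q'" "q' \<le> 2 * N + 1"
        "congr (Suc N) (Lf N # v) (Lf N # y @ insertion (Suc N) q')"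
        using classes.word_to_insertion[OF N uv(2)] by (auto simp: congr_iff_left_mult)
      have eq: "colour (Lf N # x @ insertion (Suc N) q) = colour (Lf N # y @ insertion (Suc N) q')"
        using congr_colour[OF x(4)] congr_colour[OF y(4)] uv(3) by (auto simp: colour_Cons fun_eq_iff)
      have "congr (Suc N) (Lf N # x @ insertion (Suc N) q) (Lf N # y @ insertion (Suc N) q')"
      proof (cases "q \<le> q'")
        case True
        show ?thesis by (rule compare_insertions[OF Suc.IH N x(1) y(1) x(2) True y(3) eq])
      next
        case False
        then have "q' \<le> q" by simp
        show ?thesis
          by (rule congr.symmetric, rule compare_insertions[OF Suc.IH N y(1) x(1) y(2) \<open>q' \<le> q\<close> x(3) eq[symmetric]])
      qed
      then show ?thesis using x(4) y(4) by (meson congr.symmetric congr.transitive)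
    qed
    have step: "congr (Suc N) u v"
      if uv: "u \<in> words (Suc N)" "v \<in> words (Suc N)" "colour u = colour v" "u \<noteq> []" for u v
    proof -
      from uv(1,4) obtain z u' where u: "u = z # u'" "z \<in> alphabet (Suc N)" by (cases u) auto
      then obtain p where p: "1 \<le> p" "p \<le> N" "z = Lf p \<or> z = Lg p \<or> z = Lh p"
        unfolding alphabet_def by auto
      have merged: "congr (Suc N) w (Lh p # w)"
        if w: "w \<in> words (Suc N)" "colour w = colour u" for w
      proof -
        have "colour u t \<noteq> Some (\<lambda>x. p < x)" for t
        proof
          assume "colour u t = Some (\<lambda>x. p < x)"
          then obtain s where "colour_step z s = Some (\<lambda>x. p < x)"
            unfolding u(1) colour_Cons by (metis bind_eq_Some_conv)
          then show False using p(3) by (auto simp: fun_eq_iff split: if_splits) (metis lessI less_irrefl)+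
        qed
        then have "\<forall>C. classes.H N p (classes.W N w C) = classes.W N w C"
          using classes.merge_or_cut[OF w(1) p(1,2)] w(2) by auto
        then show ?thesis by (simp add: congr_iff_left_mult)
      qed
      have expand: "congr (Suc N) w (map Lf [p..<N] @ Lf N # g_descent (Suc N) (Suc p) @ Lh p # w)"
        if w: "w \<in> words (Suc N)" "colour w = colour u" for w
      proof -
        have "classes.W N (Lh p # w) C
            = classes.W N (map Lf [p..<N] @ Lf N # g_descent (Suc N) (Suc p) @ Lh p # w) C" for C
          using classes.F_ascent_G[OF p(2,1), of "classes.H N p (classes.W N w C)"] p by simp
        then have "congr (Suc N) (Lh p # w) (map Lf [p..<N] @ Lf N # g_descent (Suc N) (Suc p) @ Lh p # w)"
          by (simp add: congr_iff_left_mult)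
        then show ?thesis using merged[OF w] congr.transitive by blast
      qed
      have "g_descent (Suc N) (Suc p) @ [Lh p] \<in> words (Suc N)"
        using p g_descent_in_alphabet[of "Suc p" "Suc N" "Suc N"] by (auto simp: alphabet_def)
      then have "congr (Suc N) (Lf N # g_descent (Suc N) (Suc p) @ Lh p # u) (Lf N # g_descent (Suc N) (Suc p) @ Lh p # v)"
        using uv by (intro top) (auto simp: colour_append colour_Cons fun_eq_iff)
      from congr_append_left[OF this, of "map Lf [p..<N]"]
      show ?thesis using expand[OF uv(1)] expand[OF uv(2)] uv(3) by (metis congr.symmetric congr.transitive)
    qed
    show ?thesis
      using step[of u v] step[of v u] Suc.prems by (metis congr.symmetric congr.reflexive)
  qed
qed

section \<open>Partitions as equivalence relations\<close>

definition same_block :: "'a set set \<Rightarrow> ('a \<times> 'a) set" where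
  "same_block a = {(x, y). \<exists>B \<in> a. x \<in> B \<and> y \<in> B}"

lemma equiv_same_block: 
  assumes "partition_on A a" shows "equiv A (same_block a)"
  unfolding same_block_def by (rule equiv_partition_on[OF assms])

lemma quotient_same_block: "partition_on A a \<Longrightarrow> A // same_block a = a"
  unfolding same_block_def by (rule partition_on_eq_quotient)

lemma same_block_quotient:
  assumes "equiv A r" shows "same_block (A // r) = r"
proof -
  have "\<exists>B \<in> A // r. x \<in> B \<and> y \<in> B" if xy: "(x, y) \<in> r" for x y
  proof -
    have "x \<in> A" using xy equiv_type[OF assms] by auto
    then show ?thesis
      using xy equiv_class_self[OF assms] by (intro bexI[of _ "r `` {x}"] quotientI) auto
  qed
  moreover have "(x, y) \<in> r" if "B \<in> A // r" "x \<in> B" "y \<in> B" for x y B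
    using in_quotient_imp_in_rel[OF assms that(1)] that by simp
  ultimately show ?thesis by (auto simp: same_block_def)
qed

primrec colour_of :: "(nat \<Rightarrow> bool) \<Rightarrow> (nat \<Rightarrow> bool) \<Rightarrow> vertex \<Rightarrow> bool" where
  "colour_of s t (Upper x) = s x"
| "colour_of s t (Middle x) = False"
| "colour_of s t (Lower x) = t x"

definition consistent :: "(vertex \<times> vertex) set \<Rightarrow> (nat \<Rightarrow> bool) \<Rightarrow> (nat \<Rightarrow> bool) \<Rightarrow> bool" where
  "consistent r s t \<longleftrightarrow> (\<forall>(x, y) \<in> r. colour_of s t x = colour_of s t y)"

lemma Upper_in_verts [simp]: "Upper x \<in> verts n \<longleftrightarrow> 1 \<le> x \<and> x \<le> n"
  and Middle_in_verts [simp]: "Middle x \<notin> verts n"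
  and Lower_in_verts [simp]: "Lower x \<in> verts n \<longleftrightarrow> 1 \<le> x \<and> x \<le> n"
  by (auto simp: verts_def)

lemma consistent_cong:
  assumes "r \<subseteq> verts n \<times> verts n" "\<And>i. 1 \<le> i \<Longrightarrow> i \<le> n \<Longrightarrow> s i = s' i" "\<And>i. 1 \<le> i \<Longrightarrow> i \<le> n \<Longrightarrow> t i = t' i"
  shows "consistent r s t = consistent r s' t'"
proof -
  have "colour_of s t x = colour_of s' t' x" if "x \<in> verts n" for x
    using that assms(2,3) by (cases x) auto
  then show ?thesis using assms(1) unfolding consistent_def by fastforce
qed

text \<open>
The block of \<open>x\<close> can be given one colour and all other vertices the other colour.
\<close>

lemma related_iff_consistent:
  assumes r: "equiv (verts n) r"
  shows "(x, y) \<in> r \<longleftrightarrow> x \<in> verts n \<and> y \<in> verts n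
    \<and> (\<forall>s t. consistent r s t \<longrightarrow> colour_of s t x = colour_of s t y)"
proof
  assume xy: "(x, y) \<in> r"
  then have "x \<in> verts n \<and> y \<in> verts n" using equiv_type[OF r] by auto
  with xy show "x \<in> verts n \<and> y \<in> verts n
    \<and> (\<forall>s t. consistent r s t \<longrightarrow> colour_of s t x = colour_of s t y)"
    by (auto simp: consistent_def)
next
  assume *: "x \<in> verts n \<and> y \<in> verts n
    \<and> (\<forall>s t. consistent r s t \<longrightarrow> colour_of s t x = colour_of s t y)"
  define s where "s i \<longleftrightarrow> (x, Upper i) \<in> r" for i
  define t where "t i \<longleftrightarrow> (x, Lower i) \<in> r" for i
  have ind: "colour_of s t v \<longleftrightarrow> (x, v) \<in> r" if "v \<in> verts n" for v
    using that by (cases v) (auto simp: s_def t_def)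
  have "(u, v) \<in> r \<Longrightarrow> u \<in> verts n \<and> v \<in> verts n \<and> ((x, u) \<in> r \<longleftrightarrow> (x, v) \<in> r)" for u v
    using r by (meson equivE equiv_type mem_Sigma_iff subsetD symD transD)
  then have "consistent r s t" unfolding consistent_def using ind by blast
  then show "(x, y) \<in> r" using * ind r by (metis equivE refl_onD)
qed

lemma equiv_eqI_consistent:
  assumes "equiv (verts n) r" "equiv (verts n) r'" "\<And>s t. consistent r s t \<longleftrightarrow> consistent r' s t"
  shows "r = r'"
  using related_iff_consistent[OF assms(1)] related_iff_consistent[OF assms(2)] assms(3) by auto

lemma partition_eqI_consistent:
  assumes "partition_on (verts n) a" "partition_on (verts n) b"
    "\<And>s t. consistent (same_block a) s t \<longleftrightarrow> consistent (same_block b) s t"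
  shows "a = b"
  using equiv_eqI_consistent[OF assms(1,2)[THEN equiv_same_block] assms(3)]
    assms(1,2)[THEN quotient_same_block] by metis

section \<open>Products of partitions\<close>

abbreviation identity_partition :: "nat \<Rightarrow> vertex set set" where
  "identity_partition n \<equiv> {{Upper x, Lower x} |x. x \<in> {1..n}}"

lemma equiv_generated_equiv:
  assumes "r \<subseteq> A \<times> A" shows "equiv A (generated_equiv A r)"
proof -
  have top: "equiv A (A \<times> A)" by (auto simp: equiv_def refl_on_def sym_def trans_def)
  then have sub: "generated_equiv A r \<subseteq> A \<times> A" using assms by (auto simp: generated_equiv_def)
  show ?thesis
  proof (rule equivI)
    show "refl_on A (generated_equiv A r)"
      by (auto simp: refl_on_def generated_equiv_def equiv_def)
    show "sym (generated_equiv A r)"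
      unfolding sym_def generated_equiv_def by (auto simp: equiv_def dest: symD)
    show "trans (generated_equiv A r)"
      unfolding trans_def generated_equiv_def by (auto simp: equiv_def dest: transD)
  qed (use sub in simp_all)
qed

lemma generated_equiv_upper: "r \<subseteq> generated_equiv A r"
  by (auto simp: generated_equiv_def)

lemma generated_equiv_least: "equiv A s \<Longrightarrow> r \<subseteq> s \<Longrightarrow> generated_equiv A r \<subseteq> s"
  by (auto simp: generated_equiv_def)

lemma lower_to_middle_verts: "x \<in> verts n \<Longrightarrow> lower_to_middle x \<in> verts3 n"
  and upper_to_middle_verts: "x \<in> verts n \<Longrightarrow> upper_to_middle x \<in> verts3 n"
  and verts_subset_verts3: "verts n \<subseteq> verts3 n"
  by (auto simp: verts_def verts3_def)

text \<open>
A colouring of the outer rows that respects the product extends to the middle row: a middle vertex gets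
the colour \<open>True\<close> if it is connected to an outer vertex of this colour. Conversely, the kernel of a
colouring of all three rows is an equivalence relation, and it contains the generated one as soon as it
contains the blocks of both factors.
\<close>

lemma product_consistent:
  assumes a: "partition_on (verts n) a" and b: "partition_on (verts n) b"
  shows product_partition: "partition_on (verts n) (partition_mult n a b)"
    and "consistent (same_block (partition_mult n a b)) s t
      \<longleftrightarrow> (\<exists>m. consistent (same_block a) s m \<and> consistent (same_block b) m t)"
proof -
  define R where "R = {(x, y). \<exists>B \<in> down a \<union> up b. x \<in> B \<and> y \<in> B}"
  have image_blocks: "(\<exists>B \<in> (\<lambda>B. f ` B) ` c. x \<in> B \<and> y \<in> B)
      \<longleftrightarrow> (\<exists>u v. (u, v) \<in> same_block c \<and> x = f u \<and> y = f v)" for f :: "vertex \<Rightarrow> vertex" and c x y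
    unfolding same_block_def by blast
  have R_iff: "(x, y) \<in> R \<longleftrightarrow>
      (\<exists>u v. (u, v) \<in> same_block a \<and> x = lower_to_middle u \<and> y = lower_to_middle v)
      \<or> (\<exists>u v. (u, v) \<in> same_block b \<and> x = upper_to_middle u \<and> y = upper_to_middle v)" for x y
    by (simp only: R_def down_def up_def bex_Un image_blocks mem_Collect_eq case_prod_conv)
  have blocks: "same_block a \<subseteq> verts n \<times> verts n" "same_block b \<subseteq> verts n \<times> verts n"
    using equiv_same_block[OF a] equiv_same_block[OF b] by (auto dest: equiv_type)
  have R_sub: "R \<subseteq> verts3 n \<times> verts3 n"
    using blocks lower_to_middle_verts upper_to_middle_verts by (auto simp: R_iff) blast+
  define E where "E = product_equiv n a b"
  have E: "equiv (verts3 n) E" "R \<subseteq> E" "\<And>s. equiv (verts3 n) s \<Longrightarrow> R \<subseteq> s \<Longrightarrow> E \<subseteq> s"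
    unfolding E_def product_equiv_def R_def[symmetric]
    using equiv_generated_equiv[OF R_sub] generated_equiv_upper generated_equiv_least by blast+
  define r where "r = E \<inter> verts n \<times> verts n"
  have r: "equiv (verts n) r"
    using E(1) verts_subset_verts3[of n] unfolding r_def equiv_def refl_on_def sym_def trans_def by blast
  have mult: "partition_mult n a b = verts n // r"
    by (simp add: partition_mult_def r_def E_def)
  show "partition_on (verts n) (partition_mult n a b)"
    unfolding mult by (rule partition_on_quotient[OF r])
  have "consistent r s t \<longleftrightarrow> (\<exists>m. consistent (same_block a) s m \<and> consistent (same_block b) m t)"
  proof
    assume cons: "consistent r s t"
    define V where "V v \<longleftrightarrow> (\<exists>u \<in> verts n. (u, v) \<in> E \<and> colour_of s t u)" for v
    have V_E: "V u = V v" if "(u, v) \<in> E" for u v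
      using that E(1) unfolding V_def by (meson equivE symD transD)
    have V_outer: "V v = colour_of s t v" if "v \<in> verts n" for v
    proof -
      have "(v, v) \<in> E" using that E(1) verts_subset_verts3 by (meson equivE refl_onD subsetD)
      then show ?thesis using cons that unfolding V_def r_def consistent_def by blast
    qed
    define m where "m i = V (Middle i)" for i
    have "V (lower_to_middle u) = colour_of s m u" if "u \<in> verts n" for u
      using that by (cases u) (auto simp: m_def V_outer)
    moreover have "V (upper_to_middle u) = colour_of m t u" if "u \<in> verts n" for u
      using that by (cases u) (auto simp: m_def V_outer)
    moreover have "(u, v) \<in> same_block a \<Longrightarrow> V (lower_to_middle u) = V (lower_to_middle v)" for u v
      by (intro V_E subsetD[OF E(2)]) (auto simp: R_iff)
    moreover have "(u, v) \<in> same_block b \<Longrightarrow> V (upper_to_middle u) = V (upper_to_middle v)" for u v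
      by (intro V_E subsetD[OF E(2)]) (auto simp: R_iff)
    ultimately have "consistent (same_block a) s m" "consistent (same_block b) m t"
      using blocks unfolding consistent_def by blast+
    then show "\<exists>m. consistent (same_block a) s m \<and> consistent (same_block b) m t" by blast
  next
    assume "\<exists>m. consistent (same_block a) s m \<and> consistent (same_block b) m t"
    then obtain m where m: "consistent (same_block a) s m" "consistent (same_block b) m t" by blast
    define V where "V v = (case v of Upper i \<Rightarrow> s i | Middle i \<Rightarrow> m i | Lower i \<Rightarrow> t i)" for v
    have Va: "V (lower_to_middle u) = colour_of s m u" if "u \<in> verts n" for u
      using that by (cases u) (auto simp: V_def)
    have Vb: "V (upper_to_middle u) = colour_of m t u" if "u \<in> verts n" for u
      using that by (cases u) (auto simp: V_def)
    have "V x = V y" if "(x, y) \<in> R" for x y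
      using that unfolding R_iff
    proof (elim disjE exE conjE)
      fix u v assume uv: "(u, v) \<in> same_block a" and xy: "x = lower_to_middle u" "y = lower_to_middle v"
      have "colour_of s m u = colour_of s m v" using m(1) uv by (auto simp: consistent_def)
      then show ?thesis using Va uv blocks(1) by (auto simp: xy)
    next
      fix u v assume uv: "(u, v) \<in> same_block b" and xy: "x = upper_to_middle u" "y = upper_to_middle v"
      have "colour_of m t u = colour_of m t v" using m(2) uv by (auto simp: consistent_def)
      then show ?thesis using Vb uv blocks(2) by (auto simp: xy)
    qed
    then have "R \<subseteq> {(x, y) \<in> verts3 n \<times> verts3 n. V x = V y}"
      using R_sub by blast
    then have "E \<subseteq> {(x, y) \<in> verts3 n \<times> verts3 n. V x = V y}"
      by (intro E(3)) (auto simp: equiv_def refl_on_def sym_def trans_def)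
    moreover have "V v = colour_of s t v" if "v \<in> verts n" for v
      using that by (cases v) (auto simp: V_def)
    ultimately show "consistent r s t" unfolding consistent_def r_def by fastforce
  qed
  then show "consistent (same_block (partition_mult n a b)) s t
      \<longleftrightarrow> (\<exists>m. consistent (same_block a) s m \<and> consistent (same_block b) m t)"
    by (simp add: mult same_block_quotient[OF r])
qed

lemma consistent_identity:
  "consistent (same_block {{Upper x, Lower x} |x. x \<in> X}) s t \<longleftrightarrow> (\<forall>i\<in>X. s i = t i)"
proof -
  have "same_block {{Upper x, Lower x} |x. x \<in> X}
      = (\<Union>x\<in>X. {Upper x, Lower x} \<times> {Upper x, Lower x})"
    unfolding same_block_def by blast
  then show ?thesis by (auto simp: consistent_def)
qed

lemma partition_identity: "partition_on (verts n) (identity_partition n)"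
  unfolding setcompr_eq_image by (rule partition_onI) (auto simp: verts_def disjnt_def)

lemma partition_assoc:
  assumes "partition_on (verts n) a" "partition_on (verts n) b" "partition_on (verts n) c"
  shows "partition_mult n (partition_mult n a b) c = partition_mult n a (partition_mult n b c)"
proof -
  note p = product_partition[OF assms(1,2)] product_partition[OF assms(2,3)]
  show ?thesis
  proof (rule partition_eqI_consistent[of n])
    fix s t
    show "consistent (same_block (partition_mult n (partition_mult n a b) c)) s t
      \<longleftrightarrow> consistent (same_block (partition_mult n a (partition_mult n b c))) s t"
      unfolding product_consistent(2)[OF p(1) assms(3)] product_consistent(2)[OF assms(1) p(2)]
        product_consistent(2)[OF assms(1,2)] product_consistent(2)[OF assms(2,3)] by blast
  qed (intro product_partition p assms)+
qed

lemma partition_identity_left: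
  assumes "partition_on (verts n) a"
  shows "partition_mult n (identity_partition n) a = a"
proof (rule partition_eqI_consistent[of n])
  fix s t
  have "consistent (same_block a) m t \<longleftrightarrow> consistent (same_block a) s t"
    if "\<forall>i\<in>{1..n}. s i = m i" for m
    by (rule consistent_cong[OF equiv_type[OF equiv_same_block[OF assms]]]) (use that in auto)
  then show "consistent (same_block (partition_mult n (identity_partition n) a)) s t
    \<longleftrightarrow> consistent (same_block a) s t"
    unfolding product_consistent(2)[OF partition_identity assms] consistent_identity by metis
qed (intro product_partition partition_identity assms)+

lemma partition_identity_right:
  assumes "partition_on (verts n) a"
  shows "partition_mult n a (identity_partition n) = a"
proof (rule partition_eqI_consistent[of n])
  fix s t
  have "consistent (same_block a) s m \<longleftrightarrow> consistent (same_block a) s t"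
    if "\<forall>i\<in>{1..n}. m i = t i" for m
    by (rule consistent_cong[OF equiv_type[OF equiv_same_block[OF assms]]]) (use that in auto)
  then show "consistent (same_block (partition_mult n a (identity_partition n))) s t
    \<longleftrightarrow> consistent (same_block a) s t"
    unfolding product_consistent(2)[OF assms partition_identity] consistent_identity by metis
qed (intro product_partition partition_identity assms)+

section \<open>The partition of a word\<close>

lemma letter_partition:
  assumes "z \<in> alphabet n"
  shows "partition_on (verts n) (letter_image n z)"
proof -
  from assms obtain p where p: "1 \<le> p" "p < n" "z = Lf p \<or> z = Lg p \<or> z = Lh p"
    unfolding alphabet_def by auto
  have verts: "verts n = {Upper p, Upper (p+1), Lower p, Lower (p+1)}
      \<union> (\<Union>x\<in>{1..n} - {p, p+1}. {Upper x, Lower x})"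
    using p by (auto simp: verts_def)
  from p(3) show ?thesis
    by (elim disjE; intro partition_onI;
        simp only: letter_image.simps fbar_def gbar_def hbar_def setcompr_eq_image)
      (auto simp: verts disjnt_def)
qed

lemma letter_consistent:
  assumes "z \<in> alphabet n"
  shows "consistent (same_block (letter_image n z)) s m
    \<longleftrightarrow> (\<exists>s'. colour_step z m = Some s' \<and> (\<forall>i\<in>{1..n}. s i = s' i))"
proof -
  from assms obtain p where p: "1 \<le> p" "p < n" "z = Lf p \<or> z = Lg p \<or> z = Lh p"
    unfolding alphabet_def by auto
  have split: "(\<forall>i\<in>{1..n}. P i) \<longleftrightarrow> P p \<and> P (p+1) \<and> (\<forall>i\<in>{1..n} - {p, p+1}. P i)" for P
    using p by auto
  have block: "consistent (same_block (insert B a)) s m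
      \<longleftrightarrow> (\<forall>x\<in>B. \<forall>y\<in>B. colour_of s m x = colour_of s m y) \<and> consistent (same_block a) s m" for B a
    unfolding consistent_def same_block_def by blast
  from p(3) show ?thesis
    by (elim disjE; simp only: letter_image.simps fbar_def gbar_def hbar_def Un_insert_left Un_empty_left block consistent_identity split)
      auto
qed

lemma xi_simps: "xi n [] = identity_partition n"
  "xi n (z # w) = partition_mult n (letter_image n z) (xi n w)"
  by (simp_all add: xi_def word_morphism_def planar_fd_monoid_def partition_monoid_def)

lemma xi_partition: "w \<in> words n \<Longrightarrow> partition_on (verts n) (xi n w)"
  by (induction w rule: list.induct)
    (auto simp: xi_simps intro: product_partition letter_partition partition_identity[simplified])

abbreviation yields :: "nat \<Rightarrow> letter list \<Rightarrow> (nat \<Rightarrow> bool) \<Rightarrow> (nat \<Rightarrow> bool) \<Rightarrow> bool" where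
  "yields n w t s \<equiv> \<exists>s'. colour w t = Some s' \<and> (\<forall>i\<in>{1..n}. s i = s' i)"

lemma xi_consistent:
  assumes "w \<in> words n"
  shows "consistent (same_block (xi n w)) s t \<longleftrightarrow> yields n w t s"
  using assms
proof (induction w arbitrary: s rule: list.induct)
  case Nil
  then show ?case unfolding xi_simps consistent_identity by simp
next
  case (Cons z w)
  then have z: "z \<in> alphabet n" and w: "w \<in> words n" by auto
  have "consistent (same_block (xi n (z # w))) s t
      \<longleftrightarrow> (\<exists>m. consistent (same_block (letter_image n z)) s m \<and> consistent (same_block (xi n w)) m t)"
    unfolding xi_simps by (rule product_consistent[OF letter_partition[OF z] xi_partition[OF w]])
  also have "\<dots> \<longleftrightarrow> (\<exists>m. consistent (same_block (letter_image n z)) s m \<and> colour w t = Some m)"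
  proof -
    have "consistent (same_block (letter_image n z)) s m \<longleftrightarrow> consistent (same_block (letter_image n z)) s m'"
      if "\<forall>i\<in>{1..n}. m i = m' i" for m m'
      by (rule consistent_cong[OF equiv_type[OF equiv_same_block[OF letter_partition[OF z]]]])
        (use that in auto)
    then show ?thesis unfolding Cons.IH[OF w] by (cases "colour w t") (simp, simp, metis)
  qed
  finally show ?case by (auto simp: letter_consistent[OF z] colour_Cons split: bind_splits)
qed

lemma xi_eq_iff_colour:
  assumes u: "u \<in> words n" and v: "v \<in> words n"
  shows "xi n u = xi n v \<longleftrightarrow> colour u = colour v"
proof
  assume "colour u = colour v"
  then show "xi n u = xi n v"
    by (intro partition_eqI_consistent[of n])
      (simp_all add: xi_partition[OF u] xi_partition[OF v] xi_consistent[OF u] xi_consistent[OF v])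
next
  assume eq: "xi n u = xi n v"
  have imp: "colour v t = Some s" if "colour u t = Some s" and u: "u \<in> words n" and v: "v \<in> words n"
    and eq: "xi n u = xi n v" for u v s t
  proof -
    have "consistent (same_block (xi n v)) s t"
      unfolding eq[symmetric] xi_consistent[OF u] using that(1) by blast
    then obtain s' where s': "colour v t = Some s'" "\<forall>i\<in>{1..n}. s i = s' i"
      using xi_consistent[OF v] by blast
    have zero: "colour w t = Some s \<Longrightarrow> s 0 = t 0" if "w \<in> words n" for w s
      using that
    proof (induction w arbitrary: s rule: list.induct)
      case (Cons z w)
      then show ?case
        by (auto simp: alphabet_def colour_Cons bind_eq_Some_conv split: if_splits)
    qed simp
    have "s i = s' i" for i
      using colour_outside[OF u that(1), of i] colour_outside[OF v s'(1), of i] zero[OF u that(1)]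
        zero[OF v s'(1)] s'(2) by (cases "i = 0"; cases "i \<le> n") auto
    then show ?thesis using s'(1) by presburger
  qed
  show "colour u = colour v"
  proof
    fix t show "colour u t = colour v t"
      using imp[OF _ u v eq, of t] imp[OF _ v u eq[symmetric], of t]
      by (cases "colour u t"; cases "colour v t") auto
  qed
qed

section \<open>Noncrossing relations\<close>

lemma equiv_rules:
  assumes "equiv A r"
  shows "(a, b) \<in> r \<Longrightarrow> (b, a) \<in> r" "(a, b) \<in> r \<Longrightarrow> (b, c) \<in> r \<Longrightarrow> (a, c) \<in> r"
    "(a, b) \<in> r \<Longrightarrow> a \<in> A \<and> b \<in> A" "a \<in> A \<Longrightarrow> (a, a) \<in> r"
  using assms by (auto simp: equiv_def refl_on_def dest: symD transD)

text \<open>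
The order of the vertices along the boundary of the rectangle: the lower row from left to right, then the
upper row from right to left.
\<close>

fun perimeter :: "nat \<Rightarrow> vertex \<Rightarrow> nat" where
  "perimeter n (Upper x) = 2 * n + 1 - x"
| "perimeter n (Middle x) = 0"
| "perimeter n (Lower x) = x"

text \<open>
If two related vertices \<open>c\<close>, \<open>d\<close> separate two related vertices \<open>x\<close>, \<open>y\<close> on the boundary, then all four
lie in one block. Admitting \<open>y\<close> on both sides of the pair lets either pair be regarded as the separating one.
\<close>

definition noncrossing :: "nat \<Rightarrow> (vertex \<times> vertex) set \<Rightarrow> bool" where
  "noncrossing n r \<longleftrightarrow> (\<forall>c d x y. (c, d) \<in> r \<longrightarrow> (x, y) \<in> r \<longrightarrow>
     perimeter n c < perimeter n x \<longrightarrow> perimeter n x < perimeter n d \<longrightarrow>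
     perimeter n y < perimeter n c \<or> perimeter n d < perimeter n y \<longrightarrow> (c, x) \<in> r)"

definition full_domain_rel :: "nat \<Rightarrow> (vertex \<times> vertex) set \<Rightarrow> bool" where
  "full_domain_rel n r \<longleftrightarrow> (\<forall>x\<in>{1..n}. \<exists>y. (Upper x, Lower y) \<in> r)"

lemma noncrossingD:
  "\<lbrakk>noncrossing n r; (c, d) \<in> r; (x, y) \<in> r; perimeter n c < perimeter n x; perimeter n x < perimeter n d;
    perimeter n y < perimeter n c \<or> perimeter n d < perimeter n y\<rbrakk> \<Longrightarrow> (c, x) \<in> r"
  unfolding noncrossing_def by blast

lemma perimeter_inj:
  "x \<in> verts n \<Longrightarrow> y \<in> verts n \<Longrightarrow> perimeter n x = perimeter n y \<Longrightarrow> x = y"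
  by (cases x; cases y) auto

lemma full_domain_iff:
  assumes "partition_on (verts n) a"
  shows "full_domain n a \<longleftrightarrow> full_domain_rel n (same_block a)"
proof -
  have "y \<in> {1..n}" if "B \<in> a" "Lower y \<in> B" for B y
    using partition_onD1[OF assms] that Lower_in_verts[of y n] by auto
  then have "(\<exists>B\<in>a. Upper x \<in> B \<and> (\<exists>y\<in>{1..n}. Lower y \<in> B))
      \<longleftrightarrow> (\<exists>y. \<exists>B\<in>a. Upper x \<in> B \<and> Lower y \<in> B)" for x
    by meson
  then show ?thesis by (simp add: full_domain_def full_domain_rel_def same_block_def)
qed

lemma noncrossing_pullback:
  assumes r: "equiv (verts n) r" and nc: "noncrossing n r"
    and \<psi>: "\<And>x. x \<in> verts m \<Longrightarrow> \<psi> x \<in> verts n"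
    and mono: "\<And>x y. \<lbrakk>x \<in> verts m; y \<in> verts m; perimeter m x < perimeter m y\<rbrakk>
      \<Longrightarrow> perimeter n (\<psi> x) \<le> perimeter n (\<psi> y)"
  shows "noncrossing m {(x, y) \<in> verts m \<times> verts m. (\<psi> x, \<psi> y) \<in> r}"
  unfolding noncrossing_def
proof (intro allI impI)
  let ?R = "{(x, y) \<in> verts m \<times> verts m. (\<psi> x, \<psi> y) \<in> r}"
  fix c d x y
  assume cd: "(c, d) \<in> ?R" and xy: "(x, y) \<in> ?R"
    and lt: "perimeter m c < perimeter m x" "perimeter m x < perimeter m d"
      "perimeter m y < perimeter m c \<or> perimeter m d < perimeter m y"
  from cd xy have v: "c \<in> verts m" "d \<in> verts m" "x \<in> verts m" "y \<in> verts m"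
    and r': "(\<psi> c, \<psi> d) \<in> r" "(\<psi> x, \<psi> y) \<in> r" by auto
  note in_verts = v[THEN \<psi>]
  note sym = equiv_rules(1)[OF r] and trans = equiv_rules(2)[OF r] and refl = equiv_rules(4)[OF r]
  let ?p = "\<lambda>v. perimeter n (\<psi> v)"
  have le: "?p c \<le> ?p x" "?p x \<le> ?p d" "?p y \<le> ?p c \<or> ?p d \<le> ?p y"
    using lt mono v by blast+
  consider "?p c = ?p x" | "?p x = ?p d" | "?p y = ?p c" | "?p y = ?p d"
    | "?p c < ?p x" "?p x < ?p d" "?p y < ?p c \<or> ?p d < ?p y"
    using le by linarith
  then have "(\<psi> c, \<psi> x) \<in> r"
  proof cases
    case 1
    then have "\<psi> c = \<psi> x" using in_verts by (intro perimeter_inj)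
    then show ?thesis using refl in_verts by simp
  next
    case 2
    then have "\<psi> x = \<psi> d" using in_verts by (intro perimeter_inj)
    then show ?thesis using r' by simp
  next
    case 3
    then have "\<psi> y = \<psi> c" using in_verts by (intro perimeter_inj)
    then show ?thesis using r' sym by simp
  next
    case 4
    then have "\<psi> y = \<psi> d" using in_verts by (intro perimeter_inj)
    then show ?thesis using r' sym trans by metis
  next
    case 5
    then show ?thesis using noncrossingD[OF nc r'] by simp
  qed
  then show "(c, x) \<in> ?R" using v by simp
qed

lemma equiv_pullback:
  assumes "equiv (verts n) r" "\<And>x. x \<in> verts m \<Longrightarrow> \<psi> x \<in> verts n"
  shows "equiv (verts m) {(x, y) \<in> verts m \<times> verts m. (\<psi> x, \<psi> y) \<in> r}"
  using assms unfolding equiv_def refl_on_def sym_def trans_def by blast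

lemma noncrossing_separate:
  assumes r: "equiv (verts n) r" and nc: "noncrossing n r"
    and uv: "(u, v) \<in> r" and ef: "(e, f) \<in> r"
    and "perimeter n e \<notin> {perimeter n u, perimeter n v}" "perimeter n f \<notin> {perimeter n u, perimeter n v}"
    and sep: "(perimeter n e \<in> {perimeter n u<..<perimeter n v} \<union> {perimeter n v<..<perimeter n u})
      \<noteq> (perimeter n f \<in> {perimeter n u<..<perimeter n v} \<union> {perimeter n v<..<perimeter n u})"
  shows "(u, e) \<in> r"
proof -
  note sym = equiv_rules(1)[OF r] and trans = equiv_rules(2)[OF r]
  have main: "(u, e) \<in> r \<and> (u, f) \<in> r"
    if "(u, v) \<in> r" "(e, f) \<in> r"
      "perimeter n u < perimeter n e" "perimeter n e < perimeter n v"
      "perimeter n f < perimeter n u \<or> perimeter n v < perimeter n f" for u v e f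
    using noncrossingD[OF nc that(1,2,3,4,5)] that(2) trans by blast
  have arith: "(a < x \<and> x < b \<and> (y < a \<or> b < y)) \<or> (a < y \<and> y < b \<and> (x < a \<or> b < x))
      \<or> (b < x \<and> x < a \<and> (y < b \<or> a < y)) \<or> (b < y \<and> y < a \<and> (x < b \<or> a < x))"
    if "x \<notin> {a, b}" "y \<notin> {a, b}"
      "(x \<in> {a<..<b} \<union> {b<..<a}) \<noteq> (y \<in> {a<..<b} \<union> {b<..<a})" for a b x y :: nat
    using that by (cases a b rule: linorder_cases) auto
  note uv' = sym[OF uv] and ef' = sym[OF ef]
  from arith[OF assms(5-7)] show ?thesis
  proof (elim disjE)
    assume "perimeter n u < perimeter n e \<and> perimeter n e < perimeter n v
        \<and> (perimeter n f < perimeter n u \<or> perimeter n v < perimeter n f)"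
    then show ?thesis using main[OF uv ef] by blast
  next
    assume "perimeter n u < perimeter n f \<and> perimeter n f < perimeter n v
        \<and> (perimeter n e < perimeter n u \<or> perimeter n v < perimeter n e)"
    then show ?thesis using main[OF uv ef'] by blast
  next
    assume "perimeter n v < perimeter n e \<and> perimeter n e < perimeter n u
        \<and> (perimeter n f < perimeter n v \<or> perimeter n u < perimeter n f)"
    then have "(v, e) \<in> r" using main[OF uv' ef] by blast
    then show ?thesis by (rule trans[OF uv])
  next
    assume "perimeter n v < perimeter n f \<and> perimeter n f < perimeter n u
        \<and> (perimeter n e < perimeter n v \<or> perimeter n u < perimeter n e)"
    then have "(v, e) \<in> r" using main[OF uv' ef'] by blast
    then show ?thesis by (rule trans[OF uv])
  qed
qed

text \<open>
The upper vertices \<open>p\<close> and \<open>p + 1\<close> are neighbours on the boundary, so a pair of related vertices outside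
the merged block has both of them on the same side. If it separated two vertices of the merged block, it
would separate one of these from the vertex \<open>p\<close> or \<open>p + 1\<close> in its old block.
\<close>

lemma noncrossing_merge:
  assumes r: "equiv (verts n) r" and nc: "noncrossing n r" and p: "1 \<le> p" "p < n"
    and K: "\<And>v. K v \<longleftrightarrow> (Upper p, v) \<in> r \<or> (Upper (Suc p), v) \<in> r"
  shows "noncrossing n (r \<union> {(x, y). K x \<and> K y})"
  unfolding noncrossing_def
proof (intro allI impI)
  let ?M = "r \<union> {(x, y). K x \<and> K y}"
  fix c d x y
  assume cd: "(c, d) \<in> ?M" and xy: "(x, y) \<in> ?M"
    and lt: "perimeter n c < perimeter n x" "perimeter n x < perimeter n d"
      "perimeter n y < perimeter n c \<or> perimeter n d < perimeter n y"
  note sym = equiv_rules(1)[OF r] and trans = equiv_rules(2)[OF r] and verts = equiv_rules(3)[OF r]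
  have K_verts: "K v \<Longrightarrow> v \<in> verts n" for v using K verts by blast
  have K_closed: "(a, b) \<in> r \<Longrightarrow> K a \<longleftrightarrow> K b" for a b
    using K sym trans by blast
  have up: "K (Upper p)" "K (Upper (Suc p))"
    using r p unfolding K equiv_def refl_on_def by auto
  have adj: "perimeter n (Upper p) = Suc (perimeter n (Upper (Suc p)))" using p by simp
  \<comment> \<open>A pair outside the merged block cannot separate two vertices of that block.\<close>
  have key: False if "(u, v) \<in> r" "\<not> K u" "K e" "K f"
      "(perimeter n e \<in> {perimeter n u<..<perimeter n v} \<union> {perimeter n v<..<perimeter n u})
      \<noteq> (perimeter n f \<in> {perimeter n u<..<perimeter n v} \<union> {perimeter n v<..<perimeter n u})" for u v e f
  proof -
    let ?in = "\<lambda>w. perimeter n w \<in> {perimeter n u<..<perimeter n v} \<union> {perimeter n v<..<perimeter n u}"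
    have ne: "perimeter n w \<notin> {perimeter n u, perimeter n v}" if "K w" for w
      using that perimeter_inj[of w n] verts[OF \<open>(u, v) \<in> r\<close>] K_verts[OF that] K_closed[OF \<open>(u, v) \<in> r\<close>] \<open>\<not> K u\<close>
      by auto
    have same_side: "?in (Upper p) \<longleftrightarrow> ?in (Upper (Suc p))"
      using ne[OF up(1)] ne[OF up(2)] adj by auto
    have "?in w \<longleftrightarrow> ?in (Upper p)" if "K w" for w
    proof (rule ccontr)
      assume side: "\<not> ?thesis"
      from that K obtain a where a: "(a, w) \<in> r" "a = Upper p \<or> a = Upper (Suc p)" by blast
      have "?in a \<noteq> ?in w" using a(2) side same_side by blast
      moreover have "K a" using a(2) up by blast
      ultimately have "(u, a) \<in> r"
        by (intro noncrossing_separate[OF r nc \<open>(u, v) \<in> r\<close> a(1) ne[OF \<open>K a\<close>] ne[OF that]])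
      then show False using K_closed \<open>K a\<close> \<open>\<not> K u\<close> by blast
    qed
    then show False using that by blast
  qed
  show "(c, x) \<in> ?M"
  proof (rule ccontr)
    assume not: "(c, x) \<notin> ?M"
    from cd xy consider "(c, d) \<in> r" "(x, y) \<in> r" | "(c, d) \<in> r" "K x" "K y" | "K c" "K d" "(x, y) \<in> r" | "K c" "K x" by blast
    then show False
    proof cases
      case 1
      then show False using noncrossingD[OF nc 1 lt] not by blast
    next
      case 2
      then have "\<not> K c" using not by blast
      from key[OF 2(1) this 2(2,3)] lt show False by auto
    next
      case 3
      then have "\<not> K x" using not by blast
      from key[OF 3(3) this 3(1,2)] lt show False by auto
    next
      case 4
      then show False using not by blast
    qed
  qed
qed

section \<open>Words give noncrossing partitions\<close>

definition move_upper :: "(nat \<Rightarrow> nat) \<Rightarrow> vertex \<Rightarrow> vertex" where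
  "move_upper \<phi> v = (case v of Upper i \<Rightarrow> Upper (\<phi> i) | _ \<Rightarrow> v)"

lemma move_upper_simps [simp]:
  "move_upper \<phi> (Upper i) = Upper (\<phi> i)" "move_upper \<phi> (Lower i) = Lower i" "move_upper \<phi> (Middle i) = Middle i"
  by (simp_all add: move_upper_def)

text \<open>
Multiplication on the left by a transformation of the points, such as \<open>f\<^sub>i\<close> or \<open>g\<^sub>i\<close>, pulls back the
blocks along that transformation of the upper row.
\<close>

lemma product_pullback:
  assumes a: "partition_on (verts n) a" and c: "partition_on (verts n) c"
    and \<phi>: "\<And>i. 1 \<le> i \<Longrightarrow> i \<le> n \<Longrightarrow> 1 \<le> \<phi> i \<and> \<phi> i \<le> n"
    and cons: "\<And>s t. consistent (same_block c) s t \<longleftrightarrow>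
      (\<exists>m. (\<forall>i\<in>{1..n}. s i = m (\<phi> i)) \<and> consistent (same_block a) m t)"
  shows "same_block c = {(x, y) \<in> verts n \<times> verts n. (move_upper \<phi> x, move_upper \<phi> y) \<in> same_block a}"
proof -
  have \<psi>: "move_upper \<phi> x \<in> verts n" if "x \<in> verts n" for x
    using that \<phi> by (cases x) auto
  have col: "colour_of s t x = colour_of m t (move_upper \<phi> x)"
    if "x \<in> verts n" "\<forall>i\<in>{1..n}. s i = m (\<phi> i)" for x s m t
    using that by (cases x) auto
  have "(x, y) \<in> same_block c \<longleftrightarrow> (move_upper \<phi> x, move_upper \<phi> y) \<in> same_block a"
    if xy: "x \<in> verts n" "y \<in> verts n" for x y
  proof -
    have "(x, y) \<in> same_block c \<longleftrightarrow> (\<forall>s t. consistent (same_block c) s t \<longrightarrow> colour_of s t x = colour_of s t y)"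
      using related_iff_consistent[OF equiv_same_block[OF c], of x y] xy by simp
    also have "\<dots> \<longleftrightarrow> (\<forall>m t. consistent (same_block a) m t \<longrightarrow>
        colour_of m t (move_upper \<phi> x) = colour_of m t (move_upper \<phi> y))"
    proof (rule iffI; intro allI impI)
      fix m t
      assume *: "\<forall>s t. consistent (same_block c) s t \<longrightarrow> colour_of s t x = colour_of s t y"
        and m: "consistent (same_block a) m t"
      define s where "s = (\<lambda>i. m (\<phi> i))"
      have "consistent (same_block c) s t" unfolding cons using m by (auto simp: s_def)
      then have "colour_of s t x = colour_of s t y" using * by blast
      then show "colour_of m t (move_upper \<phi> x) = colour_of m t (move_upper \<phi> y)"
        using col[of x s m t] col[of y s m t] xy by (simp add: s_def)
    next
      fix s t
      assume *: "\<forall>m t. consistent (same_block a) m t \<longrightarrow>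
          colour_of m t (move_upper \<phi> x) = colour_of m t (move_upper \<phi> y)"
        and s: "consistent (same_block c) s t"
      from s obtain m where m: "\<forall>i\<in>{1..n}. s i = m (\<phi> i)" "consistent (same_block a) m t"
        unfolding cons by blast
      then show "colour_of s t x = colour_of s t y"
        using * col[of x s m t] col[of y s m t] xy by metis
    qed
    also have "\<dots> \<longleftrightarrow> (move_upper \<phi> x, move_upper \<phi> y) \<in> same_block a"
      using related_iff_consistent[OF equiv_same_block[OF a], of "move_upper \<phi> x" "move_upper \<phi> y"]
        \<psi> xy by simp
    finally show ?thesis .
  qed
  moreover have "same_block c \<subseteq> verts n \<times> verts n" by (rule equiv_type[OF equiv_same_block[OF c]])
  ultimately show ?thesis by blast
qed

lemma noncrossing_identity:
  "noncrossing n (same_block (identity_partition n))"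
proof -
  have eq: "same_block (identity_partition n)
      = (\<Union>x\<in>{1..n}. {Upper x, Lower x} \<times> {Upper x, Lower x})"
    unfolding same_block_def by blast
  show ?thesis unfolding noncrossing_def eq by auto
qed

lemma xi_noncrossing_full_domain:
  assumes "w \<in> words n"
  shows "noncrossing n (same_block (xi n w)) \<and> full_domain_rel n (same_block (xi n w))"
  using assms
proof (induction w rule: list.induct)
  case Nil
  have "(Upper x, Lower x) \<in> same_block (identity_partition n)" if "x \<in> {1..n}" for x
    using that unfolding same_block_def by blast
  then show ?case unfolding xi_simps full_domain_rel_def
    using noncrossing_identity by blast
next
  case (Cons z w)
  define a where "a = xi n w"
  define c where "c = xi n (z # w)"
  from Cons.prems have w: "w \<in> words n" and z: "z \<in> alphabet n" by auto
  have a: "partition_on (verts n) a" and c: "partition_on (verts n) c"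
    using xi_partition Cons.prems w by (auto simp: a_def c_def)
  have IH: "noncrossing n (same_block a)" "full_domain_rel n (same_block a)"
    using Cons.IH[OF w] by (auto simp: a_def)
  have cons: "consistent (same_block c) s t \<longleftrightarrow> (\<exists>m. (\<exists>s'. colour_step z m = Some s' \<and> (\<forall>i\<in>{1..n}. s i = s' i))
      \<and> consistent (same_block a) m t)" for s t
    unfolding c_def xi_simps a_def product_consistent(2)[OF letter_partition[OF z] xi_partition[OF w]]
      letter_consistent[OF z] ..
  from z obtain p where p: "1 \<le> p" "p < n" "z = Lf p \<or> z = Lg p \<or> z = Lh p"
    unfolding alphabet_def by auto
  note ea = equiv_same_block[OF a] and ec = equiv_same_block[OF c]
  have "noncrossing n (same_block c) \<and> full_domain_rel n (same_block c)"
  proof (cases "z = Lh p")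
    case True
    have cons: "consistent (same_block c) s t \<longleftrightarrow> s p = s (Suc p) \<and> consistent (same_block a) s t" for s t
    proof -
      have same: "consistent (same_block a) m t \<longleftrightarrow> consistent (same_block a) s t"
        if "\<forall>i\<in>{1..n}. s i = m i" for m
        by (rule consistent_cong[OF equiv_type[OF ea]]) (use that in auto)
      have "(\<exists>m. (m p = m (Suc p) \<and> (\<forall>i\<in>{1..n}. s i = m i)) \<and> consistent (same_block a) m t)
          \<longleftrightarrow> s p = s (Suc p) \<and> consistent (same_block a) s t" (is "?l \<longleftrightarrow> ?r")
      proof (intro iffI)
        assume ?l
        then obtain m where m: "m p = m (Suc p)" "\<forall>i\<in>{1..n}. s i = m i" "consistent (same_block a) m t"
          by blast
        then have "s p = m p" "s (Suc p) = m (Suc p)" using p by auto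
        then show ?r using m same[OF m(2)] by simp
      next
        assume ?r
        then show ?l by blast
      qed
      moreover have "(\<exists>s'. colour_step z m = Some s' \<and> (\<forall>i\<in>{1..n}. s i = s' i))
          \<longleftrightarrow> m p = m (Suc p) \<and> (\<forall>i\<in>{1..n}. s i = m i)" for m
        by (simp add: True)
      ultimately show ?thesis unfolding cons by simp
    qed
    define K where "K v \<longleftrightarrow> (Upper p, v) \<in> same_block a \<or> (Upper (Suc p), v) \<in> same_block a" for v
    define M where "M = same_block a \<union> {(x, y). K x \<and> K y}"
    have ups: "K (Upper p)" "K (Upper (Suc p))" 
      using ea p unfolding K_def equiv_def refl_on_def by auto
    have K_closed: "(x, y) \<in> same_block a \<Longrightarrow> K x \<Longrightarrow> K y" for x y
      using ea unfolding K_def by (meson equivE transD)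
    have "equiv (verts n) M"
    proof (rule equivI)
      have K_verts: "K x \<Longrightarrow> x \<in> verts n" for x using equiv_type[OF ea] by (auto simp: K_def)
      then show "M \<subseteq> verts n \<times> verts n" using equiv_type[OF ea] by (auto simp: M_def)
      show "refl_on (verts n) M" using ea by (auto simp: M_def equiv_def refl_on_def)
      have sym: "\<And>x y. (x, y) \<in> same_block a \<Longrightarrow> (y, x) \<in> same_block a"
        using ea by (auto simp: equiv_def dest: symD)
      then show "sym M" by (auto simp: M_def sym_def)
      have "\<And>x y z. (x, y) \<in> same_block a \<Longrightarrow> (y, z) \<in> same_block a \<Longrightarrow> (x, z) \<in> same_block a"
        using ea by (auto simp: equiv_def dest: transD)
      then show "trans M" using K_closed sym unfolding M_def trans_def by blast
    qed
    moreover have "consistent M s t \<longleftrightarrow> consistent (same_block c) s t" for s t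
    proof -
      have "consistent M s t \<longleftrightarrow> consistent (same_block a) s t \<and> (\<forall>x y. K x \<longrightarrow> K y \<longrightarrow> colour_of s t x = colour_of s t y)"
        unfolding consistent_def M_def by auto
      also have "\<dots> \<longleftrightarrow> consistent (same_block a) s t \<and> s p = s (Suc p)"
      proof (intro conj_cong refl)
        assume "consistent (same_block a) s t"
        then have "colour_of s t x = colour_of s t (Upper p) \<or> colour_of s t x = colour_of s t (Upper (Suc p))" if "K x" for x
          using that by (fastforce simp: K_def consistent_def)
        then show "(\<forall>x y. K x \<longrightarrow> K y \<longrightarrow> colour_of s t x = colour_of s t y) \<longleftrightarrow> s p = s (Suc p)"
          using ups by (metis colour_of.simps(1))
      qed
      finally show ?thesis unfolding cons by blast
    qed
    ultimately have eq: "same_block c = M" using ec by (intro equiv_eqI_consistent) auto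
    have "noncrossing n M" unfolding M_def
      by (rule noncrossing_merge[OF ea IH(1) p(1,2) K_def])
    moreover have "full_domain_rel n M" using IH(2) by (auto simp: full_domain_rel_def M_def)
    ultimately show ?thesis by (simp add: eq)
  next
    case False
    define \<phi> where "\<phi> i = (if z = Lf p then if i = Suc p then p else i else if i = p then Suc p else i)" for i
    have \<phi>: "1 \<le> i \<Longrightarrow> i \<le> n \<Longrightarrow> 1 \<le> \<phi> i \<and> \<phi> i \<le> n" for i using p by (auto simp: \<phi>_def)
    have step: "colour_step z m = Some (\<lambda>i. m (\<phi> i))" for m
      using False p by (auto simp: \<phi>_def fun_eq_iff)
    have eq: "same_block c = {(x, y) \<in> verts n \<times> verts n. (move_upper \<phi> x, move_upper \<phi> y) \<in> same_block a}"
      by (rule product_pullback[OF a c \<phi>]) (simp_all add: cons step)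
    have \<psi>: "move_upper \<phi> x \<in> verts n" if "x \<in> verts n" for x
      using that \<phi> by (cases x) auto
    have "noncrossing n (same_block c)" unfolding eq
    proof (rule noncrossing_pullback[OF ea IH(1) \<psi>])
      fix x y assume "x \<in> verts n" "y \<in> verts n" "perimeter n x < perimeter n y"
      then show "perimeter n (move_upper \<phi> x) \<le> perimeter n (move_upper \<phi> y)"
        using p by (cases x; cases y) (auto simp: \<phi>_def)
    qed
    moreover have "full_domain_rel n (same_block c)"
      unfolding full_domain_rel_def
    proof
      fix x assume x: "x \<in> {1..n}"
      then have "\<phi> x \<in> {1..n}" using \<phi>[of x] by simp
      then obtain y where y: "(Upper (\<phi> x), Lower y) \<in> same_block a"
        using IH(2) unfolding full_domain_rel_def by blast
      then have "Lower y \<in> verts n" using equiv_type[OF ea] by auto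
      then show "\<exists>y. (Upper x, Lower y) \<in> same_block c" using x y by (auto simp: eq)
    qed
    ultimately show ?thesis ..
  qed
  then show ?case by (simp add: c_def)
qed

section \<open>Noncrossing partitions come from words\<close>

definition skip :: "nat \<Rightarrow> nat \<Rightarrow> nat" where
  "skip k x = (if x < k then x else Suc x)"

definition realises :: "nat \<Rightarrow> letter list \<Rightarrow> (vertex \<times> vertex) set \<Rightarrow> bool" where
  "realises n w r \<longleftrightarrow> (\<forall>s t. consistent r s t \<longleftrightarrow> yields n w t s)"

text \<open>
The vertex \<open>j\<close> is connected to the lower row, and this connection would cross the block of \<open>i\<close> and \<open>k\<close>.
\<close>

lemma upper_blocks_convex:
  assumes r: "equiv (verts n) r" and nc: "noncrossing n r" and fd: "full_domain_rel n r"
    and ik: "(Upper i, Upper k) \<in> r" and j: "i \<le> j" "j \<le> k"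
  shows "(Upper i, Upper j) \<in> r"
proof -
  note sym = equiv_rules(1)[OF r] and trans = equiv_rules(2)[OF r] and verts = equiv_rules(3)[OF r] and refl = equiv_rules(4)[OF r]
  have v: "1 \<le> i" "k \<le> n" using verts[OF ik] by auto
  consider "j = i" | "j = k" | "i < j" "j < k" using j by linarith
  then show ?thesis
  proof cases
    case 3
    then have "j \<in> {1..n}" using v by simp
    then obtain y where y: "(Upper j, Lower y) \<in> r" using fd unfolding full_domain_rel_def by blast
    then have "Lower y \<in> verts n" using verts by blast
    then have "(Upper k, Upper j) \<in> r"
      using 3 v by (intro noncrossingD[OF nc sym[OF ik] y]) auto
    then show ?thesis using ik trans by blast
  qed (use ik v refl verts[OF ik] in auto)
qed

text \<open>
By convexity no two upper vertices are related. Choosing a lower vertex in each of their blocks gives a strictly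
increasing map of \<open>{1..n}\<close> into itself, because connections do not cross, and this is the identity.
\<close>

lemma no_upper_cap_imp_identity:
  assumes r: "equiv (verts n) r" and nc: "noncrossing n r" and fd: "full_domain_rel n r"
    and no_cap: "\<And>m. (Upper m, Upper (Suc m)) \<notin> r"
  shows "realises n [] r"
proof -
  note sym = equiv_rules(1)[OF r] and trans = equiv_rules(2)[OF r] and verts = equiv_rules(3)[OF r]
  have inj: "i = k" if "(Upper i, Upper k) \<in> r" for i k
  proof -
    have "i = k" if "(Upper i, Upper k) \<in> r" "i \<le> k" for i k
      using upper_blocks_convex[OF r nc fd that(1), of "Suc i"] no_cap[of i] that(2) by fastforce
    from this[of i k] this[of k i] that sym show ?thesis by (metis nat_le_linear)
  qed
  have mono: "y < y'" if "(Upper x, Lower y) \<in> r" "(Upper x', Lower y') \<in> r" "x < x'" for x x' y y'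
  proof (rule ccontr)
    assume "\<not> y < y'"
    then consider "y = y'" | "y' < y" by linarith
    then have "(Upper x, Upper x') \<in> r"
    proof cases
      case 1
      then show ?thesis using that sym trans by metis
    next
      case 2
      have "(Lower y', Lower y) \<in> r"
        using verts[OF that(1)] verts[OF that(2)] 2 that(3)
        by (intro noncrossingD[OF nc sym[OF that(2)] sym[OF that(1)]]) auto
      then show ?thesis using that sym trans by metis
    qed
    then show False using inj that(3) by fastforce
  qed
  have ge: "\<forall>y. (Upper x, Lower y) \<in> r \<longrightarrow> x \<le> y" for x
  proof (induction x)
    case (Suc x)
    show ?case
    proof (intro allI impI)
      fix y assume y: "(Upper (Suc x), Lower y) \<in> r"
      show "Suc x \<le> y"
      proof (cases "x = 0")
        case True
        then show ?thesis using verts[OF y] by simp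
      next
        case False
        then have "x \<in> {1..n}" using verts[OF y] by simp
        then obtain y0 where y0: "(Upper x, Lower y0) \<in> r" using fd unfolding full_domain_rel_def by blast
        then show ?thesis using mono[OF y0 y] Suc.IH by fastforce
      qed
    qed
  qed simp
  have le: "(Upper (n - d), Lower y) \<in> r \<longrightarrow> y \<le> n - d" for d y
  proof (induction d arbitrary: y)
    case 0
    show ?case using verts by fastforce
  next
    case (Suc d)
    show ?case
    proof
      assume y: "(Upper (n - Suc d), Lower y) \<in> r"
      then have d: "Suc (n - Suc d) = n - d" "n - d \<in> {1..n}" using verts[OF y] by auto
      then obtain y1 where y1: "(Upper (n - d), Lower y1) \<in> r" using fd unfolding full_domain_rel_def by blast
      show "y \<le> n - Suc d" using mono[OF y y1] Suc.IH[of y1] y1 d(1) by linarith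
    qed
  qed
  have eq: "x = y" if "(Upper x, Lower y) \<in> r" for x y
    using ge[of x] le[of "n - x" y] that verts[OF that] by fastforce
  have diag: "(Upper x, Lower x) \<in> r" if "x \<in> {1..n}" for x
    using fd that eq unfolding full_domain_rel_def by metis
  have base: "\<exists>i\<in>{1..n}. u \<in> {Upper i, Lower i} \<and> v \<in> {Upper i, Lower i}" if uv: "(u, v) \<in> r" for u v
  proof -
    have up: "(Upper i, w) \<in> r \<Longrightarrow> w \<in> {Upper i, Lower i}" for i w
      using inj eq verts by (cases w) fastforce+
    obtain i where i: "i \<in> {1..n}" "u \<in> {Upper i, Lower i}"
      using verts[OF uv] by (cases u) auto
    then have "(Upper i, v) \<in> r" using uv diag[OF i(1)] trans by auto
    then show ?thesis using i up by blast
  qed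
  have "consistent r s t \<longleftrightarrow> (\<forall>i\<in>{1..n}. s i = t i)" for s t
  proof
    assume "consistent r s t"
    then show "\<forall>i\<in>{1..n}. s i = t i" using diag unfolding consistent_def by fastforce
  next
    assume st: "\<forall>i\<in>{1..n}. s i = t i"
    show "consistent r s t" unfolding consistent_def
    proof (intro ballI, clarify)
      fix u v assume "(u, v) \<in> r"
      from base[OF this] st show "colour_of s t u = colour_of s t v" by auto
    qed
  qed
  then show ?thesis by (simp add: realises_def)
qed

text \<open>
Two related lower vertices at the smallest distance are neighbours: a vertex strictly between them is
joined to some vertex, which by noncrossing lies between them as well, and so at a smaller distance. If no
two lower vertices are related and none is isolated, then each is joined to an upper vertex of its own,
which is impossible if two upper vertices are related.
\<close>

lemma lower_cup_exists:
  assumes r: "equiv (verts n) r" and nc: "noncrossing n r" and cap: "(Upper m, Upper (Suc m)) \<in> r"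
  obtains (single) i where "i \<in> {1..n}" "\<And>v. (Lower i, v) \<in> r \<Longrightarrow> v = Lower i"
    | (pair) i where "(Lower i, Lower (Suc i)) \<in> r"
proof (rule ccontr)
  assume "\<not> thesis"
  then have no_single: "\<And>i. i \<in> {1..n} \<Longrightarrow> \<exists>v. (Lower i, v) \<in> r \<and> v \<noteq> Lower i"
    and no_pair: "\<And>i. (Lower i, Lower (Suc i)) \<notin> r" using single pair by blast+
  note sym = equiv_rules(1)[OF r] and trans = equiv_rules(2)[OF r] and verts = equiv_rules(3)[OF r]
  have indep: "(Lower x, Lower y) \<notin> r" if "x < y" for x y
    using that
  proof (induction "y - x" arbitrary: x y rule: less_induct)
    case less
    show ?case
    proof
      assume xy: "(Lower x, Lower y) \<in> r"
      then have v: "1 \<le> x" "y \<le> n" using verts[OF xy] by auto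
      have "y \<noteq> Suc x" using xy no_pair by blast
      then have y: "Suc x < y" using less.prems by linarith
      then have "Suc x \<in> {1..n}" using v by simp
      then obtain v where vv: "(Lower (Suc x), v) \<in> r" "v \<noteq> Lower (Suc x)" using no_single by blast
      have not: "(Lower x, Lower (Suc x)) \<notin> r" by (rule no_pair)
      have "\<not> (perimeter n v < x \<or> y < perimeter n v)"
        using noncrossingD[OF nc xy vv(1)] y not by auto
      then obtain v' where v': "v = Lower v'" "x \<le> v'" "v' \<le> y"
        using verts[OF vv(1)] v by (cases v) auto
      have "v' \<noteq> x" using vv v' not sym by blast
      moreover have "v' \<noteq> y" using vv v' not xy sym trans by blast
      ultimately have "Suc x < v'" "v' < y" using v' vv(2) by (auto simp: le_less)
      then have "(Lower (Suc x), Lower v') \<notin> r" by (intro less.hyps) auto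
      then show False using vv v' by blast
    qed
  qed
  have "\<exists>u\<in>{1..n}. (Lower i, Upper u) \<in> r" if i: "i \<in> {1..n}" for i
  proof -
    obtain v where v: "(Lower i, v) \<in> r" "v \<noteq> Lower i" using no_single[OF i] by blast
    show ?thesis
    proof (cases v)
      case (Lower j)
      then show ?thesis using v indep[of i j] indep[of j i] sym by (metis linorder_neqE_nat)
    qed (use v verts[OF v(1)] in auto)
  qed
  then obtain \<tau> where \<tau>: "\<And>i. i \<in> {1..n} \<Longrightarrow> \<tau> i \<in> {1..n} \<and> (Lower i, Upper (\<tau> i)) \<in> r" by metis
  have same: "i = j" if "i \<in> {1..n}" "j \<in> {1..n}" "(Upper (\<tau> i), Upper (\<tau> j)) \<in> r" for i j
  proof -
    have "(Lower i, Lower j) \<in> r" using \<tau>[OF that(1)] \<tau>[OF that(2)] that(3) sym trans by blast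
    then show ?thesis using indep[of i j] indep[of j i] sym by (metis linorder_neqE_nat)
  qed
  have "inj_on \<tau> {1..n}"
  proof (rule inj_onI)
    fix i j assume ij: "i \<in> {1..n}" "j \<in> {1..n}" "\<tau> i = \<tau> j"
    then have "(Upper (\<tau> i), Upper (\<tau> j)) \<in> r" using \<tau>[OF ij(1)] sym trans by metis
    then show "i = j" by (rule same[OF ij(1,2)])
  qed
  then have "\<tau> ` {1..n} = {1..n}" using \<tau> by (intro endo_inj_surj) auto
  moreover have "m \<in> {1..n}" "Suc m \<in> {1..n}" using verts[OF cap] by auto
  ultimately obtain i j where "i \<in> {1..n}" "j \<in> {1..n}" "\<tau> i = m" "\<tau> j = Suc m" by (metis imageE)
  then show False using same[of i j] cap by auto
qed

lemma colour_ascent: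
  assumes "m \<le> k"
  shows "colour (map Lf [m..<k]) s = Some (\<lambda>y. if m < y \<and> y \<le> k then s (y - 1) else s y)"
  using assms
proof (induction m rule: inc_induct)
  case (step m)
  then have "[m..<k] = m # [Suc m..<k]" by (simp add: upt_conv_Cons)
  then show ?case using step by (auto simp: colour_Cons fun_eq_iff)
qed (auto simp: fun_eq_iff)

text \<open>
The word \<open>f\<^sub>m \<dots> f\<^sub>N w T\<^sub>q\<close> undoes the deletion of the upper vertex \<open>m + 1\<close>, which is joined to \<open>m\<close>, and of
the lower vertex \<open>q div 2 + 1\<close>, which is isolated or joined to its predecessor.
\<close>

lemma realise_extend:
  assumes r: "equiv (verts (Suc N)) r"
    and cap: "(Upper m, Upper (Suc m)) \<in> r"
    and q: "1 \<le> q" "q \<le> 2 * N + 1"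
    and single: "odd q \<Longrightarrow> \<forall>v. (Lower (Suc (q div 2)), v) \<in> r \<longrightarrow> v = Lower (Suc (q div 2))"
    and pair: "even q \<Longrightarrow> (Lower (q div 2), Lower (Suc (q div 2))) \<in> r"
    and \<iota>: "\<iota> = (\<lambda>v. case v of Upper i \<Rightarrow> Upper (skip (Suc m) i) | Lower i \<Rightarrow> Lower (skip (Suc (q div 2)) i) | Middle i \<Rightarrow> Middle i)"
    and w: "realises N w {(x, y) \<in> verts N \<times> verts N. (\<iota> x, \<iota> y) \<in> r}"
  shows "realises (Suc N) (map Lf [m..<Suc N] @ w @ insertion (Suc N) q) r"
  unfolding realises_def
proof (intro allI)
  fix s t :: "nat \<Rightarrow> bool"
  define k where "k = Suc (q div 2)"
  let ?r' = "{(x, y) \<in> verts N \<times> verts N. (\<iota> x, \<iota> y) \<in> r}"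
  define s1 where "s1 = (\<lambda>i. s (skip (Suc m) i))"
  define t1 where "t1 = (\<lambda>i. if k \<le> i \<and> i < Suc N then t (Suc i) else t i)"
  note sym = equiv_rules(1)[OF r] and trans = equiv_rules(2)[OF r] and verts = equiv_rules(3)[OF r] and refl = equiv_rules(4)[OF r]
  have m: "1 \<le> m" "m \<le> N" using verts[OF cap] by auto
  have k: "1 \<le> k" "k \<le> Suc N" using q by (auto simp: k_def)
  have \<iota>_simps: "\<iota> (Upper i) = Upper (skip (Suc m) i)" "\<iota> (Lower i) = Lower (skip k i)" for i
    by (auto simp: \<iota> k_def)
  have col: "colour_of s1 t1 x = colour_of s t (\<iota> x)" if "x \<in> verts N" for x
    using that by (cases x) (auto simp: \<iota>_simps s1_def t1_def skip_def)
  define tied where "tied \<longleftrightarrow> (even q \<longrightarrow> t (q div 2) = t k)"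
  have "consistent r s t \<longleftrightarrow> tied \<and> s m = s (Suc m) \<and> consistent ?r' s1 t1"
  proof
    assume cons: "consistent r s t"
    have "tied" using cons pair by (fastforce simp: tied_def k_def consistent_def)
    moreover have "s m = s (Suc m)" using cons cap by (fastforce simp: consistent_def)
    moreover have "consistent ?r' s1 t1" using cons col by (fastforce simp: consistent_def)
    ultimately show "tied \<and> s m = s (Suc m) \<and> consistent ?r' s1 t1" by blast
  next
    assume *: "tied \<and> s m = s (Suc m) \<and> consistent ?r' s1 t1"
    have rep: "(\<exists>x'\<in>verts N. (x, \<iota> x') \<in> r \<and> colour_of s t x = colour_of s t (\<iota> x'))
        \<or> (odd q \<and> x = Lower k)" if x: "x \<in> verts (Suc N)" for x
    proof (cases x)
      case (Upper i)
      consider "i \<le> m" | "i = Suc m" | "Suc m < i" by linarith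
      then show ?thesis
      proof cases
        case 1
        then have "\<iota> (Upper i) = x" "Upper i \<in> verts N" using Upper x m by (auto simp: \<iota>_simps skip_def)
        then show ?thesis using refl[OF x] by metis
      next
        case 2
        then have "\<iota> (Upper m) = Upper m" "Upper m \<in> verts N" using m by (auto simp: \<iota>_simps skip_def)
        then show ?thesis using 2 Upper sym[OF cap] * by (metis colour_of.simps(1))
      next
        case 3
        then have "\<iota> (Upper (i - 1)) = x" "Upper (i - 1) \<in> verts N" using Upper x m by (auto simp: \<iota>_simps skip_def)
        then show ?thesis using refl[OF x] by metis
      qed
    next
      case (Lower i)
      consider "i < k" | "i = k" "even q" | "i = k" "odd q" | "k < i" by linarith
      then show ?thesis
      proof cases
        case 1
        then have "\<iota> (Lower i) = x" "Lower i \<in> verts N" using Lower x k by (auto simp: \<iota>_simps skip_def)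
        then show ?thesis using refl[OF x] by metis
      next
        case 2
        then have "\<iota> (Lower (q div 2)) = Lower (q div 2)" "Lower (q div 2) \<in> verts N"
          using q by (auto simp: \<iota>_simps skip_def k_def elim!: evenE)
        moreover have "(x, Lower (q div 2)) \<in> r" using sym[OF pair[OF 2(2)]] Lower 2 by (simp add: k_def)
        moreover have "t (q div 2) = t k" using * 2 by (simp add: tied_def)
        ultimately show ?thesis using Lower 2 by (metis colour_of.simps(3))
      next
        case 3
        then show ?thesis using Lower by blast
      next
        case 4
        then have "\<iota> (Lower (i - 1)) = x" "Lower (i - 1) \<in> verts N" using Lower x k by (auto simp: \<iota>_simps skip_def)
        then show ?thesis using refl[OF x] by metis
      qed
    qed (use x in auto)
    have alone: "v = Lower k" if "odd q" "(Lower k, v) \<in> r" for v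
      using single that by (simp add: k_def)
    show "consistent r s t"
      unfolding consistent_def
    proof (intro ballI, clarify)
      fix x y assume xy: "(x, y) \<in> r"
      show "colour_of s t x = colour_of s t y"
      proof (cases "odd q \<and> (x = Lower k \<or> y = Lower k)")
        case True
        then have "x = y" using alone xy sym by blast
        then show ?thesis by simp
      next
        case False
        then have ex_x: "\<exists>x'\<in>verts N. (x, \<iota> x') \<in> r \<and> colour_of s t x = colour_of s t (\<iota> x')"
          and ex_y: "\<exists>y'\<in>verts N. (y, \<iota> y') \<in> r \<and> colour_of s t y = colour_of s t (\<iota> y')"
          using rep[of x] rep[of y] verts[OF xy] by blast+
        then obtain x' y' where x': "x' \<in> verts N" "(x, \<iota> x') \<in> r" "colour_of s t x = colour_of s t (\<iota> x')"
          and y': "y' \<in> verts N" "(y, \<iota> y') \<in> r" "colour_of s t y = colour_of s t (\<iota> y')"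
          using ex_x ex_y by blast
        then have "(\<iota> x', \<iota> y') \<in> r" using xy sym trans by blast
        then have "colour_of s1 t1 x' = colour_of s1 t1 y'"
          using * x' y' by (auto simp: consistent_def)
        then show ?thesis using x' y' col by simp
      qed
    qed
  qed
  also have "\<dots> \<longleftrightarrow> tied \<and> s m = s (Suc m) \<and> (\<exists>s2. colour w t1 = Some s2 \<and> (\<forall>i\<in>{1..N}. s1 i = s2 i))"
    using w by (simp add: realises_def)
  also have "\<dots> \<longleftrightarrow> yields (Suc N) (map Lf [m..<Suc N] @ w @ insertion (Suc N) q) t s"
  proof (cases tied)
    case True
    then have "colour (insertion (Suc N) q) t = Some t1"
      by (auto simp: colour_insertion tied_def t1_def k_def fun_eq_iff)
    moreover have "(s m = s (Suc m) \<and> (\<forall>i\<in>{1..N}. s1 i = s2 i))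
        \<longleftrightarrow> (\<forall>i\<in>{1..Suc N}. s i = (if m < i \<and> i \<le> Suc N then s2 (i - 1) else s2 i))" (is "?l \<longleftrightarrow> ?r") for s2
    proof
      assume l: ?l
      show ?r
      proof
        fix i assume i: "i \<in> {1..Suc N}"
        consider "i \<le> m" | "i = Suc m" | "Suc m < i" by linarith
        then show "s i = (if m < i \<and> i \<le> Suc N then s2 (i - 1) else s2 i)"
        proof cases
          case 1
          then show ?thesis using l i m by (auto simp: s1_def skip_def dest!: bspec[of _ _ i])
        next
          case 2
          then show ?thesis using l m by (auto simp: s1_def skip_def dest!: bspec[of _ _ m])
        next
          case 3
          then obtain j where j: "i = Suc j" "Suc m \<le> j" by (cases i) auto
          then have "j \<in> {1..N}" using i by auto
          then have "s1 j = s2 j" using l by blast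
          then show ?thesis using i j by (simp add: s1_def skip_def)
        qed
      qed
    next
      assume R: ?r
      have "s m = s2 m" "s (Suc m) = s2 m" using R m by auto
      moreover have "s1 i = s2 i" if "i \<in> {1..N}" for i
        using R[rule_format, of i] R[rule_format, of "Suc i"] that by (auto simp: s1_def skip_def)
      ultimately show ?l by blast
    qed
    ultimately show ?thesis using True m
      by (cases "colour w t1") (simp_all add: colour_append colour_ascent del: upt_Suc)
  next
    case False
    then have "colour (insertion (Suc N) q) t = None" by (auto simp: colour_insertion tied_def k_def)
    then show ?thesis using False by (simp add: colour_append)
  qed
  finally show "consistent r s t \<longleftrightarrow> yields (Suc N) (map Lf [m..<Suc N] @ w @ insertion (Suc N) q) t s" .
qed

lemma noncrossing_realised:
  assumes "equiv (verts n) r" "noncrossing n r" "full_domain_rel n r"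
  shows "\<exists>w \<in> words n. realises n w r"
  using assms
proof (induction n arbitrary: r)
  case 0
  have "realises 0 [] r" using equiv_type[OF 0(1)] by (auto simp: realises_def consistent_def verts_def)
  then show ?case by auto
next
  case (Suc N)
  note r = Suc.prems(1) and nc = Suc.prems(2) and fd = Suc.prems(3)
  show ?case
  proof (cases "\<exists>m. (Upper m, Upper (Suc m)) \<in> r")
    case False
    then have "realises (Suc N) [] r" by (intro no_upper_cap_imp_identity[OF r nc fd]) auto
    then show ?thesis by auto
  next
    case True
    then obtain m where cap: "(Upper m, Upper (Suc m)) \<in> r" by blast
    note sym = equiv_rules(1)[OF r] and trans = equiv_rules(2)[OF r] and verts = equiv_rules(3)[OF r]
    have m: "1 \<le> m" "m \<le> N" using verts[OF cap] by auto
    obtain q where q: "1 \<le> q" "q \<le> 2 * N + 1"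
      and single: "odd q \<Longrightarrow> \<forall>v. (Lower (Suc (q div 2)), v) \<in> r \<longrightarrow> v = Lower (Suc (q div 2))"
      and pair: "even q \<Longrightarrow> (Lower (q div 2), Lower (Suc (q div 2))) \<in> r"
    proof (rule lower_cup_exists[OF r nc cap])
      fix i assume i: "i \<in> {1..Suc N}" "\<And>v. (Lower i, v) \<in> r \<Longrightarrow> v = Lower i"
      then obtain j where "i = Suc j" by (cases i) auto
      then show thesis using i by (intro that[of "2 * j + 1"]) auto
    next
      fix i assume i: "(Lower i, Lower (Suc i)) \<in> r"
      then show thesis using verts[OF i] by (intro that[of "2 * i"]) auto
    qed
    define k where "k = Suc (q div 2)"
    define \<iota> where "\<iota> = (\<lambda>v. case v of Upper i \<Rightarrow> Upper (skip (Suc m) i) | Lower i \<Rightarrow> Lower (skip (Suc (q div 2)) i) | Middle i \<Rightarrow> Middle i)"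
    have \<iota>_simps: "\<iota> (Upper i) = Upper (skip (Suc m) i)" "\<iota> (Lower i) = Lower (skip k i)" for i
      by (auto simp: \<iota>_def k_def)
    let ?r' = "{(x, y) \<in> verts N \<times> verts N. (\<iota> x, \<iota> y) \<in> r}"
    have \<iota>_verts: "\<iota> x \<in> verts (Suc N)" if "x \<in> verts N" for x
      using that by (cases x) (auto simp: \<iota>_simps skip_def)
    have "equiv (verts N) ?r'" by (rule equiv_pullback[OF r \<iota>_verts])
    moreover have "noncrossing N ?r'"
    proof (rule noncrossing_pullback[OF r nc \<iota>_verts])
      fix x y assume "x \<in> verts N" "y \<in> verts N" "perimeter N x < perimeter N y"
      then show "perimeter (Suc N) (\<iota> x) \<le> perimeter (Suc N) (\<iota> y)"
        by (cases x; cases y) (auto simp: \<iota>_simps skip_def)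
    qed
    moreover have "full_domain_rel N ?r'"
      unfolding full_domain_rel_def
    proof
      fix x assume x: "x \<in> {1..N}"
      then have "skip (Suc m) x \<in> {1..Suc N}" by (auto simp: skip_def)
      then obtain y where y: "(Upper (skip (Suc m) x), Lower y) \<in> r"
        using fd unfolding full_domain_rel_def by blast
      have "\<exists>y'. Lower y' \<in> verts N \<and> (Upper (skip (Suc m) x), Lower (skip k y')) \<in> r"
      proof -
        consider "y < k" | "k < y" | "y = k" "odd q" | "y = k" "even q" by linarith
        then show ?thesis
        proof cases
          case 1
          then show ?thesis using y verts[OF y] q by (intro exI[of _ y]) (auto simp: skip_def k_def)
        next
          case 2
          then show ?thesis using y verts[OF y] by (intro exI[of _ "y - 1"]) (auto simp: skip_def k_def)
        next
          case 3
          then show ?thesis using y single sym by (fastforce simp: k_def)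
        next
          case 4
          then have "(Upper (skip (Suc m) x), Lower (q div 2)) \<in> r"
            using y pair sym trans by (metis k_def)
          then show ?thesis using 4 verts[OF pair[OF 4(2)]]
            by (intro exI[of _ "q div 2"]) (auto simp: skip_def k_def)
        qed
      qed
      then show "\<exists>y. (Upper x, Lower y) \<in> ?r'" using x by (auto simp: \<iota>_simps)
    qed
    ultimately obtain w where w: "w \<in> words N" "realises N w ?r'"
      using Suc.IH by blast
    have "realises (Suc N) (map Lf [m..<Suc N] @ w @ insertion (Suc N) q) r"
      by (rule realise_extend[OF r cap q single pair \<iota>_def w(2)])
    moreover have "map Lf [m..<Suc N] \<in> words (Suc N)" "w \<in> words (Suc N)"
      using m w(1) by (auto simp: alphabet_def)
    moreover have "insertion (Suc N) q \<in> words (Suc N)"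
      using q by (intro insertion_in_alphabet) auto
    ultimately show ?thesis by (intro bexI[of _ "map Lf [m..<Suc N] @ w @ insertion (Suc N) q"]) auto
  qed
qed

section \<open>Planar partitions are noncrossing\<close>

definition point :: "real \<Rightarrow> real \<Rightarrow> real^2" where
  "point x y = vector [x, y]"

lemma point_simps [simp]: "point x y $ 1 = x" "point x y $ 2 = y"
  by (simp_all add: point_def)

lemma point_eq_iff: "p = q \<longleftrightarrow> p $ 1 = q $ 1 \<and> p $ 2 = q $ 2" for p q :: "real^2"
  by (simp add: vec_eq_iff forall_2)

lemma mem_cbox_point:
  "p \<in> cbox (point a b) (point c d) \<longleftrightarrow> a \<le> p $ 1 \<and> p $ 1 \<le> c \<and> b \<le> p $ 2 \<and> p $ 2 \<le> d"
  by (auto simp: mem_box_cart forall_2)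

lemma position_point:
  "position (Upper x) = point (real x) 1" "position (Lower x) = point (real x) 0"
  by (simp_all add: point_def)

abbreviation rectangle :: "nat \<Rightarrow> (real^2) set" where
  "rectangle n \<equiv> cbox (point 1 0) (point (real n) 1)"

lemma position_in_rectangle: "v \<in> verts n \<Longrightarrow> position v \<in> rectangle n"
  by (cases v) (auto simp del: position.simps simp: position_point mem_cbox_point)

lemma position_inj: "u \<in> verts n \<Longrightarrow> v \<in> verts n \<Longrightarrow> position u = position v \<Longrightarrow> u = v"
  by (cases u; cases v) (auto simp del: position.simps simp: position_point point_eq_iff)

abbreviation foot :: "nat \<Rightarrow> vertex \<Rightarrow> real^2" where
  "foot n v \<equiv> point (real (perimeter n v)) 0"

text \<open>
A path from the upper vertex \<open>x\<close> around the right end of the rectangle to the point of the lower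
line whose first coordinate is \<open>perimeter n (Upper x)\<close>. The detours of different vertices are nested,
and they meet the rectangle only at their starting points. With them all blocks end on one line, as the
Fashoda meet theorem requires.
\<close>

definition detour :: "nat \<Rightarrow> nat \<Rightarrow> (real^2) set" where
  "detour n x =
     cbox (point (real x) 1) (point (real x) (real n + 2 - real x))
     \<union> cbox (point (real x) (real n + 2 - real x)) (point (2 * real n + 1 - real x) (real n + 2 - real x))
     \<union> cbox (point (2 * real n + 1 - real x) 0) (point (2 * real n + 1 - real x) (real n + 2 - real x))"

lemma detour_disjoint:
  assumes "1 \<le> x" "x \<le> n" "1 \<le> y" "y \<le> n" "x \<noteq> y"
  shows "detour n x \<inter> detour n y = {}"
proof -
  have "detour n x \<inter> detour n y = {}" if "1 \<le> x" "x < y" "y \<le> n" for x y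
  proof -
    have "real x + 1 \<le> real y" "1 \<le> real x" "real y \<le> real n" using that by linarith+
    then show ?thesis unfolding detour_def by (auto simp: mem_cbox_point)
  qed
  from this[of x y] this[of y x] assms show ?thesis by (metis Int_commute linorder_neqE_nat)
qed

lemma detour_rectangle:
  assumes "1 \<le> x" "x \<le> n" "z \<in> detour n x" "z \<in> rectangle n"
  shows "z = position (Upper x)"
proof -
  have "1 \<le> real x" "real x \<le> real n" using assms by linarith+
  then show ?thesis using assms(3,4) unfolding detour_def position_point
    by (auto simp: mem_cbox_point point_eq_iff)
qed

lemma detour_path_component:
  assumes "1 \<le> x" "x \<le> n"
  shows "path_component (detour n x) (foot n (Upper x)) (position (Upper x))"
proof -
  have x: "1 \<le> real x" "real x \<le> real n" using assms by linarith+
  have per: "real (perimeter n (Upper x)) = 2 * real n + 1 - real x" using assms by simp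
  let ?H = "real n + 2 - real x" and ?X = "2 * real n + 1 - real x"
  have seg: "path_component (detour n x) p q" if "{p, q} \<subseteq> B" "B = cbox l u" "B \<subseteq> detour n x" for p q l u B
  proof -
    have "closed_segment p q \<subseteq> B" unfolding that(2)
      by (rule closed_segment_subset) (use that in \<open>auto simp: convex_box\<close>)
    then show ?thesis using that(3) by (meson path_component_linepath subset_trans)
  qed
  have "path_component (detour n x) (point ?X 0) (point ?X ?H)"
    by (rule seg[OF _ refl, of _ _ "point ?X 0" "point ?X ?H"]) (use x in \<open>auto simp: detour_def mem_cbox_point\<close>)
  moreover have "path_component (detour n x) (point ?X ?H) (point (real x) ?H)"
    by (rule seg[OF _ refl, of _ _ "point (real x) ?H" "point ?X ?H"]) (use x in \<open>auto simp: detour_def mem_cbox_point\<close>)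
  moreover have "path_component (detour n x) (point (real x) ?H) (point (real x) 1)"
    by (rule seg[OF _ refl, of _ _ "point (real x) 1" "point (real x) ?H"]) (use x in \<open>auto simp: detour_def mem_cbox_point\<close>)
  ultimately show ?thesis unfolding per position_point using path_component_trans by blast
qed

definition drawn_block :: "nat \<Rightarrow> vertex set set \<Rightarrow> (vertex set \<Rightarrow> real \<Rightarrow> real^2) \<Rightarrow> vertex set \<Rightarrow> (real^2) set" where
  "drawn_block n E \<gamma> C = position ` C \<union> (\<Union>e\<in>{e \<in> E. e \<subseteq> C}. path_image (\<gamma> e))"

definition extended_block :: "nat \<Rightarrow> vertex set set \<Rightarrow> (vertex set \<Rightarrow> real \<Rightarrow> real^2) \<Rightarrow> vertex set \<Rightarrow> (real^2) set" where
  "extended_block n E \<gamma> C = drawn_block n E \<gamma> C \<union> (\<Union>x\<in>{x. Upper x \<in> C}. detour n x)"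

lemma hull_rectangle: "convex hull (position ` verts n) \<subseteq> rectangle n"
  by (rule hull_minimal) (use position_in_rectangle in \<open>auto simp: convex_box\<close>)

lemma planar_drawing_edge:
  assumes "planar_drawing n E \<gamma>" "e \<in> E"
  shows "arc (\<gamma> e)" "{pathstart (\<gamma> e), pathfinish (\<gamma> e)} = position ` e"
    "path_image (\<gamma> e) \<subseteq> rectangle n" "path_image (\<gamma> e) \<inter> position ` verts n = position ` e"
proof -
  have "path_image (\<gamma> e) \<subseteq> convex hull (position ` verts n)"
    using assms unfolding planar_drawing_def by simp
  then show "path_image (\<gamma> e) \<subseteq> rectangle n" using hull_rectangle by (rule subset_trans)
qed (use assms in \<open>simp_all add: planar_drawing_def\<close>)

lemma planar_drawing_crossing:
  "\<lbrakk>planar_drawing n E \<gamma>; e \<in> E; f \<in> E; e \<noteq> f; z \<in> path_image (\<gamma> e); z \<in> path_image (\<gamma> f)\<rbrakk>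
    \<Longrightarrow> z \<in> position ` (e \<inter> f)"
  unfolding planar_drawing_def by (meson IntI subsetD)

lemma drawn_block_rectangle:
  assumes "planar_drawing n E \<gamma>" "C \<subseteq> verts n"
  shows "drawn_block n E \<gamma> C \<subseteq> rectangle n"
  unfolding drawn_block_def
proof (intro Un_least UN_least)
  show "position ` C \<subseteq> rectangle n" using position_in_rectangle assms(2) by blast
  show "path_image (\<gamma> e) \<subseteq> rectangle n" if "e \<in> {e \<in> E. e \<subseteq> C}" for e
    using planar_drawing_edge(3)[OF assms(1), of e] that by blast
qed

lemma drawn_block_vertices:
  assumes d: "planar_drawing n E \<gamma>" and C: "C \<subseteq> verts n" and v: "v \<in> verts n" "position v \<in> drawn_block n E \<gamma> C"
  shows "v \<in> C"
proof -
  from v(2) consider (p) u where "u \<in> C" "position v = position u" | (e) e where "e \<in> E" "e \<subseteq> C" "position v \<in> path_image (\<gamma> e)"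
    unfolding drawn_block_def by blast
  then show ?thesis
  proof cases
    case p
    then show ?thesis using position_inj[of v n u] v(1) C by blast
  next
    case e
    then have "position v \<in> position ` e" using planar_drawing_edge(4)[OF d e(1)] v(1) by blast
    then obtain u where "u \<in> e" "position v = position u" by blast
    then show ?thesis using position_inj[of v n u] v(1) C e by blast
  qed
qed

lemma extended_blocks_disjoint:
  assumes d: "planar_drawing n E \<gamma>" and C: "C \<subseteq> verts n" and D: "D \<subseteq> verts n" and CD: "C \<inter> D = {}"
  shows "extended_block n E \<gamma> C \<inter> extended_block n E \<gamma> D = {}"
proof -
  have core: "drawn_block n E \<gamma> C \<inter> drawn_block n E \<gamma> D = {}"
  proof (rule equals0I)
    fix z assume z: "z \<in> drawn_block n E \<gamma> C \<inter> drawn_block n E \<gamma> D"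
    have "\<exists>v\<in>verts n. z = position v"
    proof (rule ccontr)
      assume "\<not> ?thesis"
      then obtain e f where ef: "e \<in> E" "e \<subseteq> C" "z \<in> path_image (\<gamma> e)" "f \<in> E" "f \<subseteq> D" "z \<in> path_image (\<gamma> f)"
        using z C D unfolding drawn_block_def by blast
      show False
      proof (cases "e = f")
        case True
        then have "e = {}" using ef CD by blast
        then show False using planar_drawing_edge(2)[OF d ef(1)] by simp
      next
        case False
        then have "z \<in> position ` (e \<inter> f)"
          by (rule planar_drawing_crossing[OF d ef(1,4) _ ef(3,6)])
        moreover have "e \<inter> f = {}" using ef CD by blast
        ultimately show False by simp
      qed
    qed
    then obtain v where "v \<in> verts n" "z = position v" by blast
    then show False using z drawn_block_vertices[OF d C] drawn_block_vertices[OF d D] CD by blast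
  qed
  have mixed: False if "X \<subseteq> verts n" "x \<in> {1..n}" "Upper x \<notin> X" "z \<in> detour n x" "z \<in> drawn_block n E \<gamma> X" for X x z
  proof -
    have "z \<in> rectangle n" using drawn_block_rectangle[OF d that(1)] that(5) by blast
    then have "z = position (Upper x)" using detour_rectangle that by auto
    then show False using drawn_block_vertices[OF d that(1), of "Upper x"] that by auto
  qed
  have up: "x \<in> {1..n}" if "Upper x \<in> C \<or> Upper x \<in> D" for x
    using that C D Upper_in_verts[of x n] by auto
  have nomix: "Upper x \<in> C \<Longrightarrow> Upper x \<notin> D" for x using CD by blast
  show ?thesis
  proof (rule equals0I)
    fix z assume "z \<in> extended_block n E \<gamma> C \<inter> extended_block n E \<gamma> D"
    then consider "z \<in> drawn_block n E \<gamma> C" "z \<in> drawn_block n E \<gamma> D"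
      | x where "Upper x \<in> C" "z \<in> detour n x" "z \<in> drawn_block n E \<gamma> D"
      | x where "Upper x \<in> D" "z \<in> detour n x" "z \<in> drawn_block n E \<gamma> C"
      | x y where "Upper x \<in> C" "z \<in> detour n x" "Upper y \<in> D" "z \<in> detour n y"
      unfolding extended_block_def by blast
    then show False
    proof cases
      case 1
      then show False using core by blast
    next
      case (2 x)
      then show False using mixed[OF D _ nomix] up by blast
    next
      case (3 x)
      then show False using mixed[OF C] nomix up by blast
    next
      case (4 x y)
      then have "x \<noteq> y" using nomix by blast
      then show False using detour_disjoint[of x n y] up[of x] up[of y] 4 by auto
    qed
  qed
qed

abbreviation frame :: "nat \<Rightarrow> (real^2) set" where
  "frame n \<equiv> cbox (point 1 0) (point (2 * real n) (real n + 2))"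

lemma extended_block_bounded:
  assumes d: "planar_drawing n E \<gamma>" and C: "C \<subseteq> verts n"
  shows "extended_block n E \<gamma> C \<subseteq> frame n"
proof -
  have "rectangle n \<subseteq> frame n"
    by (auto simp: mem_cbox_point)
  moreover have "detour n x \<subseteq> frame n" if "Upper x \<in> C" for x
  proof -
    have "Upper x \<in> verts n" using that C by blast
    then have "1 \<le> real x" "real x \<le> real n" by auto
    then show ?thesis by (auto simp: detour_def mem_cbox_point)
  qed
  ultimately show ?thesis using drawn_block_rectangle[OF d C] unfolding extended_block_def by blast
qed

text \<open>
A walk along the edges of the graph becomes a path of arcs, to which the two detours are attached.
\<close>

lemma extended_block_connected:
  assumes d: "planar_drawing n E \<gamma>" and C: "C \<subseteq> verts n"
    and closed: "\<forall>u v. u \<in> C \<longrightarrow> {u, v} \<in> E \<longrightarrow> v \<in> C"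
    and u: "u \<in> C" and uv: "(u, v) \<in> {(x, y). {x, y} \<in> E}\<^sup>*"
  shows "path_component (extended_block n E \<gamma> C) (foot n u) (foot n v)"
proof -
  have "v \<in> C \<and> path_component (drawn_block n E \<gamma> C) (position u) (position v)"
    using uv
  proof (induction rule: rtrancl_induct)
    case base
    have "position u \<in> drawn_block n E \<gamma> C" using u by (simp add: drawn_block_def)
    then show ?case using u by (simp add: path_component_refl)
  next
    case (step v w)
    then have e: "{v, w} \<in> E" "v \<in> C" by auto
    then have w: "w \<in> C" using closed by blast
    have arc: "arc (\<gamma> {v, w})" "{pathstart (\<gamma> {v, w}), pathfinish (\<gamma> {v, w})} = {position v, position w}"
      using planar_drawing_edge(1,2)[OF d e(1)] by simp_all
    have sub: "path_image (\<gamma> {v, w}) \<subseteq> drawn_block n E \<gamma> C"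
      using e w unfolding drawn_block_def by blast
    have "path_component (drawn_block n E \<gamma> C) (pathstart (\<gamma> {v, w})) (pathfinish (\<gamma> {v, w}))"
      unfolding path_component_def using sub arc(1) arc_imp_path by blast
    then have "path_component (drawn_block n E \<gamma> C) (position v) (position w)"
      using arc(2) path_component_sym by (metis doubleton_eq_iff)
    then show ?case using w step.IH path_component_trans by blast
  qed
  then have v: "v \<in> C" and "path_component (drawn_block n E \<gamma> C) (position u) (position v)" by auto
  then have mid: "path_component (extended_block n E \<gamma> C) (position u) (position v)"
    using path_component_of_subset[of "drawn_block n E \<gamma> C"] by (auto simp: extended_block_def)
  have ends: "path_component (extended_block n E \<gamma> C) (foot n w) (position w)" if w: "w \<in> C" for w
  proof (cases w)
    case (Upper x)
    have "Upper x \<in> verts n" using w C Upper by blast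
    then have "path_component (detour n x) (foot n w) (position w)"
      unfolding Upper by (intro detour_path_component) auto
    moreover have "detour n x \<subseteq> extended_block n E \<gamma> C" using w Upper by (auto simp: extended_block_def)
    ultimately show ?thesis by (rule path_component_of_subset[rotated])
  next
    case (Lower x)
    have "position w \<in> extended_block n E \<gamma> C" using w by (auto simp: extended_block_def drawn_block_def)
    moreover have "position w = foot n w" using Lower by (simp add: point_def)
    ultimately show ?thesis by (metis path_component_refl)
  next
    case (Middle x)
    then show ?thesis using w C Middle_in_verts[of x n] by blast
  qed
  show ?thesis using ends[OF u] mid ends[OF v] path_component_sym path_component_trans by metis
qed

text \<open>
If two blocks crossed, their extended drawings would contain paths with interlacing end points on the
lower line. Such paths meet, whereas the extended drawings of different blocks are disjoint.
\<close>

lemma planar_imp_noncrossing: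
  assumes "planar n a"
  shows "noncrossing n (same_block a)"
proof -
  from assms obtain E \<gamma> where E: "E \<subseteq> {e. e \<subseteq> verts n \<and> card e = 2}"
    and a: "graph_components (verts n) E = a" and d: "planar_drawing n E \<gamma>"
    unfolding planar_def by blast
  define A where "A = {(x, y). {x, y} \<in> E}"
  have "sym A" by (auto simp: A_def sym_def insert_commute)
  then have symA: "sym (A\<^sup>*)" by (rule sym_rtrancl)
  define r where "r = {(u, v). u \<in> verts n \<and> v \<in> verts n \<and> (u, v) \<in> A\<^sup>*}"
  have r: "equiv (verts n) r"
    using symA unfolding equiv_def refl_on_def sym_def trans_def r_def by (auto intro: rtrancl_trans)
  have "a = verts n // r" using a by (simp add: graph_components_def r_def A_def)
  then have block: "same_block a = r" by (simp add: same_block_quotient[OF r])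
  have comp: "(c, x) \<in> r" if cd: "(c, d) \<in> r" and xy: "(x, y) \<in> r"
    and lt: "perimeter n c < perimeter n x" "perimeter n x < perimeter n d" "perimeter n d < perimeter n y" for c d x y
  proof (rule ccontr)
    assume not: "(c, x) \<notin> r"
    define C where "C = r `` {c}"
    define D where "D = r `` {x}"
    have sub: "C \<subseteq> verts n" "D \<subseteq> verts n" by (auto simp: C_def D_def r_def)
    have disj: "C \<inter> D = {}" unfolding C_def D_def using not r by (auto simp: equiv_def dest: symD transD)
    have closed: "v \<in> X" if "u \<in> X" "{u, v} \<in> E" "X = r `` {w}" for u v w X
    proof -
      have "(u, v) \<in> A" using that by (simp add: A_def)
      moreover have "v \<in> verts n" using that E by blast
      ultimately show ?thesis using that by (auto simp: r_def intro: rtrancl_into_rtrancl)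
    qed
    have mem: "c \<in> C" "x \<in> D" using cd xy r by (auto simp: C_def D_def r_def)
    have closed_C: "\<forall>u v. u \<in> C \<longrightarrow> {u, v} \<in> E \<longrightarrow> v \<in> C"
      and closed_D: "\<forall>u v. u \<in> D \<longrightarrow> {u, v} \<in> E \<longrightarrow> v \<in> D"
      using closed C_def D_def by blast+
    have edges: "(c, d) \<in> {(x, y). {x, y} \<in> E}\<^sup>*" "(x, y) \<in> {(x, y). {x, y} \<in> E}\<^sup>*"
      using cd xy by (simp_all add: r_def A_def)
    obtain f where f: "path f" "path_image f \<subseteq> extended_block n E \<gamma> C"
      "pathstart f = foot n c" "pathfinish f = foot n d"
      using extended_block_connected[OF d sub(1) closed_C mem(1) edges(1)]
      unfolding path_component_def by blast
    obtain g where g: "path g" "path_image g \<subseteq> extended_block n E \<gamma> D"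
      "pathstart g = foot n x" "pathfinish g = foot n y"
      using extended_block_connected[OF d sub(2) closed_D mem(2) edges(2)]
      unfolding path_component_def by blast
    obtain z where "z \<in> path_image f" "z \<in> path_image g"
    proof (rule fashoda_interlace[OF f(1) g(1)])
      show "path_image f \<subseteq> frame n"
        "path_image g \<subseteq> frame n"
        using f(2) g(2) extended_block_bounded[OF d] sub by blast+
    qed (use f g lt in auto)
    then show False using f g extended_blocks_disjoint[OF d sub disj] by blast
  qed
  note sym = equiv_rules(1)[OF r] and trans = equiv_rules(2)[OF r]
  show ?thesis unfolding block noncrossing_def
  proof (intro allI impI)
    fix c d x y assume *: "(c, d) \<in> r" "(x, y) \<in> r" "perimeter n c < perimeter n x" "perimeter n x < perimeter n d"
      "perimeter n y < perimeter n c \<or> perimeter n d < perimeter n y"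
    from *(5) show "(c, x) \<in> r"
    proof
      assume "perimeter n y < perimeter n c"
      then have "(y, c) \<in> r" using comp[OF sym[OF *(2)] *(1)] * by blast
      then show ?thesis using * sym trans by blast
    next
      assume "perimeter n d < perimeter n y"
      then show ?thesis using comp[OF *(1,2)] * by blast
    qed
  qed
qed

section \<open>Noncrossing full-domain partitions are planar\<close>

text \<open>
Segments between the rows have slope at least \<open>1 / n\<close> in absolute value. The constant is chosen such that the
parabolas \<open>flatness n * (x - p) * (q - x)\<close> stay strictly below them, apart from common end points on the lower
row.
\<close>

definition flatness :: "nat \<Rightarrow> real" where
  "flatness n = 1 / (real n ^ 2 + 1)"

lemma flatness: "0 < flatness n" "flatness n * real n ^ 2 < 1"
proof -
  have "0 < real n ^ 2 + 1" by (simp add: add_nonneg_pos)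
  then show "0 < flatness n" "flatness n * real n ^ 2 < 1" by (simp_all add: flatness_def)
qed

text \<open>
With this height the curve between the lower vertices \<open>p\<close> and \<open>q\<close> is the parabola
\<open>y = flatness n * (x - p) * (q - x)\<close>.
\<close>

fun curve_height :: "nat \<Rightarrow> vertex \<Rightarrow> vertex \<Rightarrow> real" where
  "curve_height n (Lower p) (Lower q) = flatness n * (real q - real p) ^ 2"
| "curve_height n _ _ = 0"

definition curve :: "nat \<Rightarrow> vertex \<Rightarrow> vertex \<Rightarrow> real \<Rightarrow> real^2" where
  "curve n u v t = (1 - t) *\<^sub>R position u + t *\<^sub>R position v + (curve_height n u v * t * (1 - t)) *\<^sub>R point 0 1"

text \<open>
Neighbours in the upper row, the leftmost upper and the leftmost lower vertex of a block, and consecutive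
lower vertices of a block. The direction of an edge is fixed, so that it has only one representation.
\<close>

inductive_set edges_of :: "(vertex \<times> vertex) set \<Rightarrow> (vertex \<times> vertex) set" for r where
  top: "(Upper i, Upper (Suc i)) \<in> r \<Longrightarrow> (Upper i, Upper (Suc i)) \<in> edges_of r"
| side: "\<lbrakk>(Upper u, Lower l) \<in> r; \<And>j. j < u \<Longrightarrow> (Upper j, Upper u) \<notin> r; \<And>j. j < l \<Longrightarrow> (Lower j, Lower l) \<notin> r\<rbrakk>
    \<Longrightarrow> (Upper u, Lower l) \<in> edges_of r"
| bottom: "\<lbrakk>(Lower p, Lower q) \<in> r; p < q; \<And>k. p < k \<Longrightarrow> k < q \<Longrightarrow> (Lower p, Lower k) \<notin> r\<rbrakk>
    \<Longrightarrow> (Lower p, Lower q) \<in> edges_of r"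

text \<open>
Sets given by equations and inequalities that contain the images of the curves.
\<close>

fun trace :: "nat \<Rightarrow> vertex \<Rightarrow> vertex \<Rightarrow> (real^2) set" where
  "trace n (Upper i) (Upper j) = {z. real i \<le> z $ 1 \<and> z $ 1 \<le> real j \<and> z $ 2 = 1}"
| "trace n (Upper u) (Lower l) = {z. 0 \<le> z $ 2 \<and> z $ 2 \<le> 1 \<and> z $ 1 = real l + (real u - real l) * z $ 2}"
| "trace n (Lower p) (Lower q) = {z. real p \<le> z $ 1 \<and> z $ 1 \<le> real q
      \<and> z $ 2 = flatness n * ((z $ 1 - real p) * (real q - z $ 1))}"
| "trace n _ _ = {}"

lemma curve_components:
  "curve n (Upper i) (Upper j) t $ 1 = real i + (real j - real i) * t"
  "curve n (Upper i) (Upper j) t $ 2 = 1"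
  "curve n (Upper u) (Lower l) t $ 1 = real u + (real l - real u) * t"
  "curve n (Upper u) (Lower l) t $ 2 = 1 - t"
  "curve n (Lower p) (Lower q) t $ 1 = real p + (real q - real p) * t"
  "curve n (Lower p) (Lower q) t $ 2 = flatness n * (real q - real p) ^ 2 * t * (1 - t)"
  by (simp_all add: curve_def algebra_simps)

lemma curve_in_trace:
  assumes "(u, v) \<in> edges_of r" "0 \<le> t" "t \<le> 1"
  shows "curve n u v t \<in> trace n u v"
  using assms(1)
proof cases
  case (bottom p q)
  then have "(real q - real p) * t \<le> real q - real p" "0 \<le> (real q - real p) * t"
    using assms by (auto intro: mult_left_le)
  then show ?thesis unfolding bottom
    by (simp add: curve_components) (simp add: power2_eq_square algebra_simps)
qed (use assms in \<open>auto simp: curve_components algebra_simps\<close>)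

lemma arc_curve:
  assumes "(u, v) \<in> edges_of r"
  shows "arc (curve n u v)" "pathstart (curve n u v) = position u" "pathfinish (curve n u v) = position v"
proof -
  have "continuous_on {0..1} (curve n u v)" unfolding curve_def by (intro continuous_intros)
  moreover have "inj_on (curve n u v) {0..1}"
  proof (rule inj_onI)
    fix s t assume "curve n u v s = curve n u v t"
    then have eq: "curve n u v s $ 1 = curve n u v t $ 1" "curve n u v s $ 2 = curve n u v t $ 2" by simp_all
    from assms show "s = t" by cases (use eq in \<open>auto simp: curve_components\<close>)
  qed
  ultimately show "arc (curve n u v)" by (simp add: arc_def path_def)
qed (simp_all add: pathstart_def pathfinish_def curve_def)

lemma point_in_hull:
  assumes n: "2 \<le> n" and z: "z \<in> rectangle n"
  shows "z \<in> convex hull (position ` verts n)"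
proof -
  let ?C = "convex hull (position ` verts n)"
  define u where "u = (z $ 1 - 1) / (real n - 1)"
  have z': "1 \<le> z $ 1" "z $ 1 \<le> real n" "0 \<le> z $ 2" "z $ 2 \<le> 1" using z by (auto simp: mem_cbox_point)
  have n': "real n - 1 > 0" using n by simp
  have u: "0 \<le> u" "u \<le> 1" "1 + u * (real n - 1) = z $ 1" using z' n' by (auto simp: u_def field_simps)
  have "position v \<in> ?C" if "v \<in> verts n" for v using that by (simp add: hull_inc)
  from this[of "Upper 1"] this[of "Upper n"] this[of "Lower 1"] this[of "Lower n"] n
  have corners: "point 1 1 \<in> ?C" "point (real n) 1 \<in> ?C" "point 1 0 \<in> ?C" "point (real n) 0 \<in> ?C"
    by (simp_all add: point_def)
  have cvx: "convex ?C" by simp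
  have row: "point (z $ 1) y \<in> ?C" if "point 1 y \<in> ?C" "point (real n) y \<in> ?C" for y
  proof -
    have "(1 - u) *\<^sub>R point 1 y + u *\<^sub>R point (real n) y \<in> ?C"
      by (rule convexD[OF cvx that]) (use u in auto)
    moreover have "(1 - u) *\<^sub>R point 1 y + u *\<^sub>R point (real n) y = point (z $ 1) y"
      using u(3) by (simp add: point_eq_iff algebra_simps)
    ultimately show ?thesis by simp
  qed
  have "(1 - z $ 2) *\<^sub>R point (z $ 1) 0 + z $ 2 *\<^sub>R point (z $ 1) 1 \<in> ?C"
    by (rule convexD[OF cvx row row]) (use corners z' in auto)
  moreover have "(1 - z $ 2) *\<^sub>R point (z $ 1) 0 + z $ 2 *\<^sub>R point (z $ 1) 1 = z"
    by (simp add: point_eq_iff algebra_simps)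
  ultimately show ?thesis by simp
qed

lemma bottom_height:
  assumes "1 \<le> p" "q \<le> n" "real p \<le> x" "x \<le> real q"
  shows "0 \<le> flatness n * ((x - real p) * (real q - x))" "flatness n * ((x - real p) * (real q - x)) < 1"
proof -
  show "0 \<le> flatness n * ((x - real p) * (real q - x))"
    using assms flatness(1)[of n] by simp
  have "real q \<le> real n" using assms by simp
  then have "(x - real p) * (real q - x) \<le> real n * real n"
    using assms by (intro mult_mono) auto
  then have "flatness n * ((x - real p) * (real q - x)) \<le> flatness n * real n ^ 2"
    using flatness(1)[of n] by (simp add: power2_eq_square)
  then show "flatness n * ((x - real p) * (real q - x)) < 1" using flatness(2)[of n] by linarith
qed

locale noncrossing_diagram =
  fixes n :: nat and r :: "(vertex \<times> vertex) set"
  assumes r: "equiv (verts n) r" and nc: "noncrossing n r" and fd: "full_domain_rel n r"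
begin

lemmas r_sym = equiv_rules(1)[OF r] and r_trans = equiv_rules(2)[OF r]
  and r_verts = equiv_rules(3)[OF r] and r_refl = equiv_rules(4)[OF r]

lemma edges_related: "(u, v) \<in> edges_of r \<Longrightarrow> (u, v) \<in> r"
  by (auto elim: edges_of.cases)

lemma trace_rectangle:
  assumes "(u, v) \<in> edges_of r"
  shows "trace n u v \<subseteq> rectangle n"
proof
  fix z assume z: "z \<in> trace n u v"
  from assms show "z \<in> rectangle n"
  proof cases
    case (top i)
    then have "1 \<le> real i" "real (Suc i) \<le> real n" using r_verts[of u v] by auto
    then show ?thesis using z top by (simp add: mem_cbox_point)
  next
    case (side u' l)
    then have b: "1 \<le> real u'" "real u' \<le> real n" "1 \<le> real l" "real l \<le> real n" using r_verts[of u v] by auto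
    have z': "0 \<le> z $ 2" "z $ 2 \<le> 1" "z $ 1 = (1 - z $ 2) * real l + z $ 2 * real u'"
      using z side by (simp_all add: algebra_simps)
    have "(1 - z $ 2) * 1 + z $ 2 * 1 \<le> z $ 1" "z $ 1 \<le> (1 - z $ 2) * real n + z $ 2 * real n"
      unfolding z'(3) using z' b by (intro add_mono mult_left_mono; simp)+
    then show ?thesis using z' by (simp add: mem_cbox_point algebra_simps)
  next
    case (bottom p q)
    then have b: "1 \<le> p" "q \<le> n" using r_verts[of u v] by auto
    then have "1 \<le> real p" "real q \<le> real n" by simp_all
    then show ?thesis using z bottom bottom_height[OF b, of "z $ 1"] by (simp add: mem_cbox_point)
  qed
qed

lemma trace_vertices:
  assumes uv: "(u, v) \<in> edges_of r" and w: "w \<in> verts n" "position w \<in> trace n u v"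
  shows "w = u \<or> w = v"
  using uv
proof cases
  case (top i)
  then show ?thesis using w by (cases w) (auto simp del: position.simps simp: position_point)
next
  case (side u' l)
  then show ?thesis using w by (cases w) (auto simp del: position.simps simp: position_point)
next
  case (bottom p q)
  then have b: "1 \<le> p" "q \<le> n" using r_verts[of u v] by auto
  show ?thesis
  proof (cases w)
    case (Upper x)
    then show ?thesis using w bottom bottom_height(2)[OF b, of "real x"]
      by (simp del: position.simps add: position_point)
  next
    case (Lower x)
    then show ?thesis using w bottom flatness(1)[of n]
      by (auto simp del: position.simps simp: position_point)
  qed (use w in simp)
qed

lemma trace_disjoint_top_top:
  assumes "(Upper i, Upper (Suc i)) \<in> r" "(Upper j, Upper (Suc j)) \<in> r" "i < j"
    and "z \<in> trace n (Upper i) (Upper (Suc i))" "z \<in> trace n (Upper j) (Upper (Suc j))"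
  shows "j = Suc i \<and> z = position (Upper j)"
proof -
  have "real i + 1 \<le> real j" using assms(3) by linarith
  then have "real j = real i + 1" "z $ 1 = real j" "z $ 2 = 1" using assms(4,5) by auto
  then show ?thesis by (auto simp del: position.simps simp: position_point point_eq_iff)
qed

lemma trace_top_side:
  assumes "z \<in> trace n (Upper i) (Upper (Suc i))" "z \<in> trace n (Upper u) (Lower l)"
  shows "(u = i \<or> u = Suc i) \<and> z = position (Upper u)"
proof -
  have z: "z $ 2 = 1" "z $ 1 = real u" "real i \<le> real u" "real u \<le> real (Suc i)" using assms by auto
  then have "i \<le> u" "u \<le> Suc i" by simp_all
  then show ?thesis using z by (auto simp del: position.simps simp: position_point point_eq_iff)
qed

lemma trace_side_side:
  assumes e: "(Upper u, Lower l) \<in> edges_of r" "(Upper u', Lower l') \<in> edges_of r"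
    and ne: "(u, l) \<noteq> (u', l')"
  shows "trace n (Upper u) (Lower l) \<inter> trace n (Upper u') (Lower l') = {}"
proof -
  have "trace n (Upper u) (Lower l) \<inter> trace n (Upper u') (Lower l') = {}"
    if e: "(Upper u, Lower l) \<in> edges_of r" "(Upper u', Lower l') \<in> edges_of r"
      and ne: "(u, l) \<noteq> (u', l')" and le: "u \<le> u'" for u l u' l'
  proof -
    have rel: "(Upper u, Lower l) \<in> r" "(Upper u', Lower l') \<in> r" using e edges_related by auto
    have min_u: "j < u' \<Longrightarrow> (Upper j, Upper u') \<notin> r" and min_l': "j < l' \<Longrightarrow> (Lower j, Lower l') \<notin> r" for j
      using e(2) by (auto elim: edges_of.cases)
    have min_l: "j < l \<Longrightarrow> (Lower j, Lower l) \<notin> r" for j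
      using e(1) by (auto elim: edges_of.cases)
    have diff: "(Upper u, Upper u') \<notin> r"
    proof
      assume *: "(Upper u, Upper u') \<in> r"
      then have "u = u'" using min_u[of u] le by fastforce
      moreover have "(Lower l, Lower l') \<in> r" using rel * r_sym r_trans by blast
      ultimately show False using min_l[of l'] min_l'[of l] r_sym ne by (metis linorder_neqE_nat)
    qed
    then have "u \<noteq> u'" using r_refl r_verts[OF rel(1)] by blast
    then have uu: "u < u'" using le by simp
    have "l < l'"
    proof (rule ccontr)
      assume "\<not> l < l'"
      then consider "l = l'" | "l' < l" by linarith
      then show False
      proof cases
        case 1
        then show False using rel diff r_sym r_trans by blast
      next
        case 2
        have "(Lower l', Lower l) \<in> r"
          using 2 uu r_verts[OF rel(1)] r_verts[OF rel(2)]
          by (intro noncrossingD[OF nc r_sym[OF rel(2)] r_sym[OF rel(1)]]) auto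
        then show False using rel diff r_sym r_trans by blast
      qed
    qed
    have False if z: "z \<in> trace n (Upper u) (Lower l)" "z \<in> trace n (Upper u') (Lower l')" for z
    proof -
      have "(1 - z $ 2) * real l + z $ 2 * real u = (1 - z $ 2) * real l' + z $ 2 * real u'"
        and b: "0 \<le> z $ 2" "z $ 2 \<le> 1" using z by (simp_all add: algebra_simps)
      then have eq: "(1 - z $ 2) * (real l' - real l) + z $ 2 * (real u' - real u) = 0" by (simp add: algebra_simps)
      have pos: "0 < real l' - real l" "0 < real u' - real u" using \<open>l < l'\<close> uu by simp_all
      have "0 \<le> (1 - z $ 2) * (real l' - real l)" "0 \<le> z $ 2 * (real u' - real u)" using b pos by simp_all
      then have "(1 - z $ 2) * (real l' - real l) = 0" "z $ 2 * (real u' - real u) = 0" using eq by linarith+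
      then show False using pos by simp
    qed
    then show ?thesis by blast
  qed
  from this[OF e ne] this[OF e(2,1)] ne show ?thesis by (metis Int_commute nat_le_linear)
qed

text \<open>
The foot \<open>l\<close> of the segment is not strictly between \<open>p\<close> and \<open>q\<close>. At height \<open>y\<close> the segment has moved
sideways by at most \<open>n y\<close>, where the parabola has height at most \<open>flatness n * n y * n < y\<close> unless
\<open>y = 0\<close>.
\<close>

lemma trace_side_bottom:
  assumes s: "(Upper u, Lower l) \<in> edges_of r" and b: "(Lower p, Lower q) \<in> edges_of r"
    and z: "z \<in> trace n (Upper u) (Lower l)" "z \<in> trace n (Lower p) (Lower q)"
  shows "(l = p \<or> l = q) \<and> z = position (Lower l)"
proof -
  have rel: "(Upper u, Lower l) \<in> r" "(Lower p, Lower q) \<in> r" using s b edges_related by auto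
  have pq: "p < q" "\<And>k. p < k \<Longrightarrow> k < q \<Longrightarrow> (Lower p, Lower k) \<notin> r" using b by (auto elim: edges_of.cases)
  have v: "1 \<le> u" "u \<le> n" "1 \<le> l" "l \<le> n" "1 \<le> p" "q \<le> n" using r_verts[OF rel(1)] r_verts[OF rel(2)] by auto
  have out: "l \<le> p \<or> q \<le> l"
  proof (rule ccontr)
    assume "\<not> ?thesis"
    then have "p < l" "l < q" by auto
    then have "(Lower p, Lower l) \<in> r"
      using v by (intro noncrossingD[OF nc rel(2) r_sym[OF rel(1)]]) auto
    then show False using pq(2) \<open>p < l\<close> \<open>l < q\<close> by blast
  qed
  define x where "x = z $ 1"
  define y where "y = z $ 2"
  have zx: "x = real l + (real u - real l) * y" "0 \<le> y" "y \<le> 1" "real p \<le> x" "x \<le> real q"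
    "y = flatness n * ((x - real p) * (real q - x))" using z by (auto simp: x_def y_def)
  have rv: "real u - real l \<le> real n" "real l - real u \<le> real n" "real q - real p \<le> real n" "0 \<le> real n" using v by auto
  have n1: "(real u - real l) * y \<le> real n * y" "(real l - real u) * y \<le> real n * y"
    using rv zx(2) by (auto intro: mult_right_mono)
  have "(x - real p) * (real q - x) \<le> (real n * y) * real n"
  proof (cases "l \<le> p")
    case True
    then have "real l \<le> real p" by simp
    then have "x - real p \<le> real n * y" "real q - x \<le> real n" using zx n1 rv by linarith+
    then show ?thesis by (rule mult_mono) (use zx(2,5) rv(4) in simp_all)
  next
    case False
    then have "real q \<le> real l" using out by simp
    then have "real q - x \<le> (real l - real u) * y" using zx(1) by (simp add: algebra_simps)
    then have "real q - x \<le> real n * y" "x - real p \<le> real n" using zx n1 rv by linarith+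
    then have "(real q - x) * (x - real p) \<le> (real n * y) * real n"
      by (rule mult_mono) (use zx(2,4) rv(4) in simp_all)
    then show ?thesis by (simp only: mult.commute)
  qed
  then have "y \<le> flatness n * ((real n * y) * real n)"
    using zx(6) flatness(1)[of n] by (metis mult_left_mono less_imp_le)
  then have "y \<le> (flatness n * real n ^ 2) * y" by (simp add: power2_eq_square algebra_simps)
  then have "\<not> 0 < y" using mult_strict_right_mono[OF flatness(2)[of n], of y] by auto
  then have "y = 0" using zx(2) by simp
  then have "flatness n * ((x - real p) * (real q - x)) = 0" using zx(6) by simp
  then have "(x - real p) * (real q - x) = 0" using flatness(1)[of n] by simp
  moreover have "x = real l" using zx(1) \<open>y = 0\<close> by simp
  ultimately have "l = p \<or> l = q" by auto
  then show ?thesis using \<open>x = real l\<close> \<open>y = 0\<close>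
    by (auto simp del: position.simps simp: position_point point_eq_iff x_def y_def)
qed

text \<open>
Two lower edges are side by side or nested. In the nested case both factors of
\<open>(x - p) * (q - x)\<close> are larger for the outer edge.
\<close>

lemma trace_bottom_bottom:
  assumes e: "(Lower p, Lower q) \<in> edges_of r" "(Lower p', Lower q') \<in> edges_of r"
    and ne: "(p, q) \<noteq> (p', q')" and le: "p \<le> p'"
    and z: "z \<in> trace n (Lower p) (Lower q)" "z \<in> trace n (Lower p') (Lower q')"
  shows "p' = q \<and> z = position (Lower q)"
proof -
  have rel: "(Lower p, Lower q) \<in> r" "(Lower p', Lower q') \<in> r" using e edges_related by auto
  have pq: "p < q" "p' < q'" "\<And>k. p < k \<Longrightarrow> k < q \<Longrightarrow> (Lower p, Lower k) \<notin> r"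
    "\<And>k. p' < k \<Longrightarrow> k < q' \<Longrightarrow> (Lower p', Lower k) \<notin> r" using e by (auto elim: edges_of.cases)
  have "p \<noteq> p'"
  proof
    assume "p = p'"
    then show False using pq(3)[of q'] pq(4)[of q] rel pq(1,2) ne by (metis linorder_neqE_nat)
  qed
  then have pp: "p < p'" using le by simp
  have "q \<le> p' \<or> q' < q"
  proof (rule ccontr)
    assume "\<not> ?thesis"
    then have *: "p' < q" "q \<le> q'" by auto
    have "(Lower p, Lower p') \<in> r"
    proof (cases "q = q'")
      case True
      then show ?thesis using rel r_sym r_trans by blast
    next
      case False
      then show ?thesis using * pp by (intro noncrossingD[OF nc rel]) auto
    qed
    then show False using pq(3) pp * by blast
  qed
  then show ?thesis
  proof
    assume "q \<le> p'"
    moreover have "real p' \<le> z $ 1" "z $ 1 \<le> real q" using z by auto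
    ultimately have "p' = q" "z $ 1 = real q" by auto
    then show ?thesis using z by (auto simp del: position.simps simp: position_point point_eq_iff)
  next
    assume "q' < q"
    define x where "x = z $ 1"
    have x: "real p' \<le> x" "x \<le> real q'" using z by (auto simp: x_def)
    have "real p < real p'" "real q' < real q" using pp \<open>q' < q\<close> by simp_all
    then have "(x - real p') * (real q' - x) \<le> (x - real p') * (real q - x)"
      "(x - real p') * (real q - x) < (x - real p) * (real q - x)"
      using x by (intro mult_left_mono mult_strict_right_mono; simp)+
    then have "flatness n * ((x - real p') * (real q' - x)) < flatness n * ((x - real p) * (real q - x))"
      using flatness(1)[of n] by simp
    moreover have "z $ 2 = flatness n * ((x - real p) * (real q - x))"
      using z(1) by (simp add: x_def)
    moreover have "z $ 2 = flatness n * ((x - real p') * (real q' - x))"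
      using z(2) by (simp add: x_def)
    ultimately show ?thesis by linarith
  qed
qed

lemma trace_intersection:
  assumes e: "(u, v) \<in> edges_of r" "(u', v') \<in> edges_of r" and ne: "(u, v) \<noteq> (u', v')"
    and z: "z \<in> trace n u v" "z \<in> trace n u' v'"
  shows "z \<in> position ` ({u, v} \<inter> {u', v'})"
proof -
  have low: False if "z $ 2 = 1" "(Lower p, Lower q) \<in> edges_of r" "z \<in> trace n (Lower p) (Lower q)" for p q
    using bottom_height(2)[of p q n "z $ 1"] r_verts[OF edges_related[OF that(2)]] that by auto
  from e(1) show ?thesis
  proof cases
    case uv: (top i)
    from e(2) show ?thesis
    proof cases
      case (top j)
      have zz: "z \<in> trace n (Upper i) (Upper (Suc i))" "z \<in> trace n (Upper j) (Upper (Suc j))"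
        using z unfolding uv(1,2) top(1,2) .
      have "i \<noteq> j" using ne unfolding uv(1,2) top(1,2) by blast
      then have "j = Suc i \<and> z = position (Upper j) \<or> i = Suc j \<and> z = position (Upper i)"
        using trace_disjoint_top_top[OF uv(3) top(3) _ zz] trace_disjoint_top_top[OF top(3) uv(3) _ zz(2,1)]
        by (metis linorder_neqE_nat)
      then show ?thesis unfolding uv(1,2) top(1,2) by blast
    next
      case (side u2 l)
      then show ?thesis using uv z trace_top_side[of z i u2 l] by (auto simp del: position.simps)
    next
      case (bottom p q)
      then show ?thesis using uv z low[of p q] e by auto
    qed
  next
    case uv: (side u1 l1)
    from e(2) show ?thesis
    proof cases
      case (top j)
      then show ?thesis using uv z trace_top_side[of z j u1 l1] by (auto simp del: position.simps)
    next
      case (side u2 l2)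
      then show ?thesis using uv z e ne trace_side_side[of u1 l1 u2 l2] by blast
    next
      case (bottom p q)
      then show ?thesis using uv z e trace_side_bottom[of u1 l1 p q z] by (auto simp del: position.simps trace.simps)
    qed
  next
    case uv: (bottom p q)
    from e(2) show ?thesis
    proof cases
      case (top j)
      then show ?thesis using uv z low[of p q] e by auto
    next
      case (side u2 l2)
      then show ?thesis using uv z e trace_side_bottom[of u2 l2 p q z] by (auto simp del: position.simps trace.simps)
    next
      case (bottom p2 q2)
      then show ?thesis using uv z e ne trace_bottom_bottom[of p q p2 q2 z] trace_bottom_bottom[of p2 q2 p q z]
        by (cases "p \<le> p2") (auto simp del: position.simps trace.simps)
    qed
  qed
qed

definition edge_set :: "vertex set set" where
  "edge_set = (\<lambda>(u, v). {u, v}) ` edges_of r"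

definition drawing :: "vertex set \<Rightarrow> real \<Rightarrow> real^2" where
  "drawing e = (let uv = SOME uv. uv \<in> edges_of r \<and> e = {fst uv, snd uv}
     in curve n (fst uv) (snd uv))"

lemma edge_set_cases:
  assumes "e \<in> edge_set"
  obtains u v where "(u, v) \<in> edges_of r" "e = {u, v}" "drawing e = curve n u v"
proof -
  have ex: "\<exists>uv. uv \<in> edges_of r \<and> e = {fst uv, snd uv}" using assms by (auto simp: edge_set_def)
  define uv where "uv = (SOME uv. uv \<in> edges_of r \<and> e = {fst uv, snd uv})"
  have uv: "uv \<in> edges_of r \<and> e = {fst uv, snd uv}"
    unfolding uv_def by (rule someI_ex[OF ex])
  have "drawing e = curve n (fst uv) (snd uv)" by (simp only: drawing_def Let_def uv_def)
  then show thesis using uv by (intro that[of "fst uv" "snd uv"]) auto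
qed

lemma path_image_curve:
  "(u, v) \<in> edges_of r \<Longrightarrow> path_image (curve n u v) \<subseteq> trace n u v"
  using curve_in_trace by (auto simp: path_image_def)

lemma planar_drawing_edge_set:
  assumes n: "2 \<le> n"
  shows "planar_drawing n edge_set drawing"
  unfolding planar_drawing_def
proof (intro conjI ballI impI)
  fix e assume "e \<in> edge_set"
  then obtain u v where uv: "(u, v) \<in> edges_of r" and e: "e = {u, v}" "drawing e = curve n u v"
    by (rule edge_set_cases)
  have verts: "u \<in> verts n" "v \<in> verts n" using r_verts[OF edges_related[OF uv]] by auto
  show "arc (drawing e)" using arc_curve[OF uv] e by simp
  show ends: "{pathstart (drawing e), pathfinish (drawing e)} = position ` e" using arc_curve[OF uv] e by simp
  have "path_image (drawing e) \<subseteq> rectangle n" using path_image_curve[OF uv] trace_rectangle[OF uv] e by simp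
  moreover have "rectangle n \<subseteq> convex hull (position ` verts n)"
    by (rule subsetI) (rule point_in_hull[OF n])
  ultimately show "path_image (drawing e) \<subseteq> convex hull position ` verts n" by (rule subset_trans)
  show "path_image (drawing e) \<inter> position ` verts n = position ` e"
  proof (intro equalityI subsetI)
    fix z assume "z \<in> path_image (drawing e) \<inter> position ` verts n"
    then obtain w where w: "w \<in> verts n" "z = position w" "z \<in> path_image (curve n u v)"
      unfolding e(2) by blast
    then have "position w \<in> trace n u v" using path_image_curve[OF uv] by blast
    then show "z \<in> position ` e" using trace_vertices[OF uv w(1)] w(2) unfolding e(1) by blast
  next
    fix z assume z: "z \<in> position ` e"
    then have "z = pathstart (drawing e) \<or> z = pathfinish (drawing e)" using ends by blast
    then have "z \<in> path_image (drawing e)" by auto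
    moreover have "z \<in> position ` verts n" using z verts unfolding e(1) by blast
    ultimately show "z \<in> path_image (drawing e) \<inter> position ` verts n" by blast
  qed
next
  fix e f assume ef: "e \<in> edge_set" "f \<in> edge_set" "e \<noteq> f"
  obtain u v where uv: "(u, v) \<in> edges_of r" and e: "e = {u, v}" "drawing e = curve n u v"
    using ef(1) by (rule edge_set_cases)
  obtain u' v' where uv': "(u', v') \<in> edges_of r" and f: "f = {u', v'}" "drawing f = curve n u' v'"
    using ef(2) by (rule edge_set_cases)
  have "(u, v) \<noteq> (u', v')" using ef(3) e f by blast
  then have "z \<in> position ` (e \<inter> f)" if "z \<in> path_image (drawing e)" "z \<in> path_image (drawing f)" for z
    using trace_intersection[OF uv uv', of z] path_image_curve[OF uv] path_image_curve[OF uv'] that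
    unfolding e(2) f(2) unfolding e(1) f(1) by (simp add: subset_iff)
  then show "path_image (drawing e) \<inter> path_image (drawing f) \<subseteq> position ` (e \<inter> f)"
    by (intro subsetI) simp
qed

text \<open>
Edges connect every upper vertex of a block with the leftmost one, by convexity of the upper part, and
likewise every lower vertex; a further edge connects these two leftmost vertices.
\<close>

lemma drawing_components: "graph_components (verts n) edge_set = verts n // r"
proof -
  define A where "A = {(x, y). {x, y} \<in> edge_set}"
  have symA: "sym (A\<^sup>*)" by (rule sym_rtrancl) (auto simp: A_def sym_def insert_commute)
  have edge: "(u, v) \<in> A" if "(u, v) \<in> edges_of r" for u v
    using that by (auto simp: A_def edge_set_def)
  have A_r: "(x, y) \<in> r" if "(x, y) \<in> A" for x y
  proof -
    from that obtain u v where "(u, v) \<in> edges_of r" "{x, y} = {u, v}"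
      by (auto simp: A_def edge_set_def)
    then show ?thesis using edges_related r_sym by (metis doubleton_eq_iff)
  qed
  have sub: "(x, y) \<in> r" if "(x, y) \<in> A\<^sup>*" "x \<in> verts n" for x y
    using that(1) by (induction rule: rtrancl_induct) (use that(2) r_refl A_r r_trans in blast)+
  have upper: "(Upper i, Upper k) \<in> A\<^sup>*" if "(Upper i, Upper k) \<in> r" "i \<le> k" for i k
    using that(2,1)
  proof (induction k rule: dec_induct)
    case (step k)
    have ik: "(Upper i, Upper k) \<in> r" using upper_blocks_convex[OF r nc fd step.prems, of k] step.hyps by simp
    then have "(Upper k, Upper (Suc k)) \<in> r" using step.prems r_sym r_trans by blast
    then have "(Upper k, Upper (Suc k)) \<in> A" by (intro edge edges_of.top)
    then show ?case using step.IH[OF ik] by (rule rtrancl_into_rtrancl[rotated])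
  qed simp
  have lower: "(Lower p, Lower q) \<in> A\<^sup>*" if "(Lower p, Lower q) \<in> r" "p \<le> q" for p q
    using that
  proof (induction "q - p" arbitrary: p q rule: less_induct)
    case less
    show ?case
    proof (cases "\<exists>k. p < k \<and> k < q \<and> (Lower p, Lower k) \<in> r")
      case True
      then obtain k where k: "p < k" "k < q" "(Lower p, Lower k) \<in> r" by blast
      then have "(Lower k, Lower q) \<in> r" using less.prems(1) r_sym r_trans by blast
      then have "(Lower p, Lower k) \<in> A\<^sup>*" "(Lower k, Lower q) \<in> A\<^sup>*"
        using less.hyps[of k p] less.hyps[of q k] k by auto
      then show ?thesis by (rule rtrancl_trans)
    next
      case False
      show ?thesis
      proof (cases "p = q")
        case False': False
        then have "(Lower p, Lower q) \<in> A"
          using less.prems False by (intro edge edges_of.bottom) auto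
        then show ?thesis by blast
      qed simp
    qed
  qed
  have across: "(Upper u, Lower l) \<in> A\<^sup>*" if ul: "(Upper u, Lower l) \<in> r" for u l
  proof -
    define u0 where "u0 = (LEAST j. (Upper j, Upper u) \<in> r)"
    define l0 where "l0 = (LEAST j. (Lower j, Lower l) \<in> r)"
    have uu: "(Upper u, Upper u) \<in> r" and ll: "(Lower l, Lower l) \<in> r" using r_refl r_verts[OF ul] by auto
    have u0: "(Upper u0, Upper u) \<in> r" "u0 \<le> u" using uu unfolding u0_def by (auto intro: LeastI Least_le)
    have l0: "(Lower l0, Lower l) \<in> r" "l0 \<le> l" using ll unfolding l0_def by (auto intro: LeastI Least_le)
    have "(Upper u0, Lower l0) \<in> edges_of r"
    proof (rule edges_of.side)
      show "(Upper u0, Lower l0) \<in> r" using u0(1) ul l0(1) r_sym r_trans by blast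
      show "(Upper j, Upper u0) \<notin> r" if "j < u0" for j
        using not_less_Least[OF that[unfolded u0_def]] u0(1) r_trans by blast
      show "(Lower j, Lower l0) \<notin> r" if "j < l0" for j
        using not_less_Least[OF that[unfolded l0_def]] l0(1) r_trans by blast
    qed
    then have "(Upper u0, Lower l0) \<in> A" by (rule edge)
    moreover have "(Upper u, Upper u0) \<in> A\<^sup>*" using upper[OF u0] symA by (auto dest: symD)
    ultimately show ?thesis using lower[OF l0] by (meson rtrancl_into_rtrancl rtrancl_trans)
  qed
  have conn: "(x, y) \<in> A\<^sup>*" if xy: "(x, y) \<in> r" for x y
  proof (cases x)
    case x: (Upper i)
    show ?thesis
    proof (cases y)
      case (Upper k)
      then show ?thesis using x xy upper[of i k] upper[of k i] r_sym symA by (metis nat_le_linear symD)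
    next
      case (Lower l)
      then show ?thesis using x xy across by simp
    qed (use r_verts[OF xy] in simp)
  next
    case x: (Lower p)
    show ?thesis
    proof (cases y)
      case (Upper k)
      then show ?thesis using x across[of k p] xy r_sym symA by (metis symD)
    next
      case (Lower q)
      then show ?thesis using x xy lower[of p q] lower[of q p] r_sym symA by (metis nat_le_linear symD)
    qed (use r_verts[OF xy] in simp)
  qed (use r_verts[OF xy] in simp)
  have "{(u, v). u \<in> verts n \<and> v \<in> verts n \<and> (u, v) \<in> A\<^sup>*} = r"
    using sub conn r_verts by auto
  then show ?thesis by (simp add: graph_components_def A_def)
qed

lemma planar_quotient:
  assumes "2 \<le> n"
  shows "planar n (verts n // r)"
proof -
  have "edge_set \<subseteq> {e. e \<subseteq> verts n \<and> card e = 2}"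
  proof
    fix e assume "e \<in> edge_set"
    then obtain u v where uv: "(u, v) \<in> edges_of r" "e = {u, v}" by (auto simp: edge_set_def)
    have "u \<noteq> v" using uv(1) by cases auto
    then show "e \<in> {e. e \<subseteq> verts n \<and> card e = 2}" using r_verts[OF edges_related[OF uv(1)]] uv(2) by auto
  qed
  then show ?thesis unfolding planar_def
    using drawing_components planar_drawing_edge_set[OF assms] by blast
qed

end

section \<open>The monoid and its presentation\<close>

lemma planar_fd_monoid_simps [simp]:
  "mult (planar_fd_monoid n) = partition_mult n"
  "one (planar_fd_monoid n) = xi n []"
  by (simp_all add: planar_fd_monoid_def partition_monoid_def xi_simps)

lemma mem_planar_fd_monoid:
  "a \<in> carrier (planar_fd_monoid n) \<longleftrightarrow> partition_on (verts n) a \<and> full_domain n a \<and> planar n a"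
  by (auto simp: planar_fd_monoid_def partition_monoid_def)

lemma carrier_planar_fd_monoid:
  assumes n: "2 \<le> n"
  shows "carrier (planar_fd_monoid n) = xi n ` words n"
proof (intro equalityI subsetI)
  fix a assume "a \<in> carrier (planar_fd_monoid n)"
  then have a: "partition_on (verts n) a" "full_domain n a" "planar n a"
    unfolding mem_planar_fd_monoid by auto
  obtain w where w: "w \<in> words n" "realises n w (same_block a)"
    using noncrossing_realised[OF equiv_same_block[OF a(1)] planar_imp_noncrossing[OF a(3)]] full_domain_iff[OF a(1)] a(2)
    by blast
  have "a = xi n w"
    by (rule partition_eqI_consistent[OF a(1) xi_partition[OF w(1)]])
      (use w(2) in \<open>simp add: realises_def xi_consistent[OF w(1)]\<close>)
  then show "a \<in> xi n ` words n" using w(1) by blast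
next
  fix a assume "a \<in> xi n ` words n"
  then obtain w where w: "w \<in> words n" and a: "a = xi n w" by blast
  have p: "partition_on (verts n) a" unfolding a by (rule xi_partition[OF w])
  have nf: "noncrossing n (same_block a)" "full_domain_rel n (same_block a)"
    unfolding a using xi_noncrossing_full_domain[OF w] by auto
  interpret noncrossing_diagram n "same_block a"
    by unfold_locales (rule equiv_same_block[OF p], rule nf, rule nf)
  have "planar n a" using planar_quotient[OF n] unfolding quotient_same_block[OF p] .
  then show "a \<in> carrier (planar_fd_monoid n)"
    using p nf(2) full_domain_iff[OF p] unfolding mem_planar_fd_monoid by blast
qed

lemma xi_append:
  assumes u: "u \<in> words n" and v: "v \<in> words n"
  shows "xi n (u @ v) = partition_mult n (xi n u) (xi n v)"
  using u
proof (induction u rule: list.induct)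
  case Nil
  show ?case using partition_identity_left[OF xi_partition[OF v]] by (simp add: xi_simps)
next
  case (Cons z u)
  then have z: "z \<in> alphabet n" and u: "u \<in> words n" by auto
  then show ?case
    using Cons.IH partition_assoc[OF letter_partition[OF z] xi_partition[OF u] xi_partition[OF v]]
    by (simp add: xi_simps)
qed

lemma monoid_planar_fd_monoid:
  assumes "2 \<le> n"
  shows "monoid (planar_fd_monoid n)"
proof (rule monoidI)
  note C = carrier_planar_fd_monoid[OF assms]
  show "x \<otimes>\<^bsub>planar_fd_monoid n\<^esub> y \<in> carrier (planar_fd_monoid n)"
    if xy: "x \<in> carrier (planar_fd_monoid n)" "y \<in> carrier (planar_fd_monoid n)" for x y
  proof -
    obtain u v where uv: "u \<in> words n" "v \<in> words n" "x = xi n u" "y = xi n v"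
      using xy unfolding C by blast
    have "u @ v \<in> words n" using uv by simp
    then show ?thesis unfolding C using xi_append[OF uv(1,2)] uv(3,4)
      by (metis imageI planar_fd_monoid_simps(1))
  qed
  show "\<one>\<^bsub>planar_fd_monoid n\<^esub> \<in> carrier (planar_fd_monoid n)" unfolding C by simp
next
  fix x y z
  assume "x \<in> carrier (planar_fd_monoid n)" "y \<in> carrier (planar_fd_monoid n)" "z \<in> carrier (planar_fd_monoid n)"
  then show "x \<otimes>\<^bsub>planar_fd_monoid n\<^esub> y \<otimes>\<^bsub>planar_fd_monoid n\<^esub> z
    = x \<otimes>\<^bsub>planar_fd_monoid n\<^esub> (y \<otimes>\<^bsub>planar_fd_monoid n\<^esub> z)"
    unfolding mem_planar_fd_monoid by (simp add: partition_assoc)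
next
  fix x assume "x \<in> carrier (planar_fd_monoid n)"
  then have "partition_on (verts n) x" unfolding mem_planar_fd_monoid by blast
  then show "\<one>\<^bsub>planar_fd_monoid n\<^esub> \<otimes>\<^bsub>planar_fd_monoid n\<^esub> x = x"
    "x \<otimes>\<^bsub>planar_fd_monoid n\<^esub> \<one>\<^bsub>planar_fd_monoid n\<^esub> = x"
    using partition_identity_left partition_identity_right by (simp_all add: xi_simps)
qed

lemma relations_in_lists: "relations n \<subseteq> words n \<times> words n"
  unfolding relations_def by blast

text \<open>
The first conjunct is needed in the induction: intermediate words of a chain of rewriting steps are again
words over the alphabet.
\<close>

lemma congr_in_congruence:
  assumes r: "monoid_congruence (free_monoid (alphabet n)) r" and rel: "relations n \<subseteq> r"
    and uv: "congr n u v"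
  shows "(u \<in> words n \<longleftrightarrow> v \<in> words n) \<and> (u \<in> words n \<longrightarrow> (u, v) \<in> r)"
proof -
  let ?L = "words n"
  have eq: "equiv ?L r" and ctx: "\<And>u v w. (u, v) \<in> r \<Longrightarrow> w \<in> ?L \<Longrightarrow> (w @ u, w @ v) \<in> r \<and> (u @ w, v @ w) \<in> r"
    using r unfolding monoid_congruence_def free_monoid_def by auto
  have refl: "\<And>u. u \<in> ?L \<Longrightarrow> (u, u) \<in> r" and sym: "\<And>u v. (u, v) \<in> r \<Longrightarrow> (v, u) \<in> r"
    and trans: "\<And>u v w. (u, v) \<in> r \<Longrightarrow> (v, w) \<in> r \<Longrightarrow> (u, w) \<in> r"
    using eq by (auto simp: equiv_def refl_on_def dest: symD transD)
  show ?thesis using uv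
  proof (induction rule: congr.induct)
    case (base u v)
    then show ?case using relations_in_lists rel by blast
  next
    case (embed u v a b)
    have "(a @ u @ b, a @ v @ b) \<in> r" if "a \<in> ?L" "b \<in> ?L" "(u, v) \<in> r"
    proof -
      have "(u @ b, v @ b) \<in> r" using ctx that by blast
      then show ?thesis using ctx that(1) by blast
    qed
    moreover have "x @ y \<in> ?L \<longleftrightarrow> x \<in> ?L \<and> y \<in> ?L" for x y by auto
    ultimately show ?case using embed.IH by metis
  next
    case (reflexive u)
    then show ?case using refl by blast
  next
    case (symmetric u v)
    then show ?case using sym by blast
  next
    case (transitive u v w)
    then show ?case using trans by blast
  qed
qed

lemma kernel_xi:
  "{(u, v). u \<in> words n \<and> v \<in> words n \<and> xi n u = xi n v}
    = generated_congruence (free_monoid (alphabet n)) (relations n)" (is "?K = _")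
proof
  show "?K \<subseteq> generated_congruence (free_monoid (alphabet n)) (relations n)"
  proof (rule subrelI)
    fix u v assume "(u, v) \<in> ?K"
    then have uv: "u \<in> words n" "v \<in> words n" "xi n u = xi n v" by auto
    have "congr n u v" using uv xi_eq_iff_colour[OF uv(1,2)] by (intro congr_complete) auto
    then have "(u, v) \<in> r" if "monoid_congruence (free_monoid (alphabet n)) r" "relations n \<subseteq> r" for r
      using congr_in_congruence[OF that] uv(1) by blast
    then show "(u, v) \<in> generated_congruence (free_monoid (alphabet n)) (relations n)"
      unfolding generated_congruence_def by blast
  qed
next
  have "monoid_congruence (free_monoid (alphabet n)) ?K"
    unfolding monoid_congruence_def
  proof
    show "equiv (carrier (free_monoid (alphabet n))) ?K"
      by (auto simp: free_monoid_def equiv_def refl_on_def sym_def trans_def)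
    show "\<forall>(u, v)\<in>?K. \<forall>w\<in>carrier (free_monoid (alphabet n)).
       (w \<otimes>\<^bsub>free_monoid (alphabet n)\<^esub> u, w \<otimes>\<^bsub>free_monoid (alphabet n)\<^esub> v) \<in> ?K
       \<and> (u \<otimes>\<^bsub>free_monoid (alphabet n)\<^esub> w, v \<otimes>\<^bsub>free_monoid (alphabet n)\<^esub> w) \<in> ?K"
      using xi_append by (auto simp: free_monoid_def simp del: in_listsD)
  qed
  moreover have "relations n \<subseteq> ?K"
  proof (rule subrelI)
    fix u v assume uv: "(u, v) \<in> relations n"
    then have L: "u \<in> words n" "v \<in> words n" using relations_in_lists by blast+
    have "colour u = colour v" by (rule congr_colour) (rule congr.base[OF uv])
    then show "(u, v) \<in> ?K" using L xi_eq_iff_colour[OF L] by simp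
  qed
  ultimately show "generated_congruence (free_monoid (alphabet n)) (relations n) \<subseteq> ?K"
    unfolding generated_congruence_def by blast
qed

theorem presentation:
  assumes "n \<ge> 2"
  shows "has_monoid_presentation (planar_fd_monoid n) (alphabet n) (relations n) (xi n)"
proof -
  note C = carrier_planar_fd_monoid[OF assms]
  have "xi n \<in> hom (free_monoid (alphabet n)) (planar_fd_monoid n)"
    unfolding hom_def C by (auto simp: free_monoid_def xi_append)
  then have "monoid_morphism (free_monoid (alphabet n)) (planar_fd_monoid n) (xi n)"
    by (simp add: monoid_morphism_def free_monoid_def)
  then show ?thesis
    unfolding has_monoid_presentation_def
    using monoid_planar_fd_monoid[OF assms] C kernel_xi by auto
qed

theorem idempotents_generate:
  assumes "n \<ge> 2"
  shows "idempotent_generated (planar_fd_monoid n)"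
proof -
  let ?M = "planar_fd_monoid n"
  note C = carrier_planar_fd_monoid[OF assms]
  have mon: "monoid ?M" by (rule monoid_planar_fd_monoid[OF assms])
  have letter: "letter_image n z \<in> carrier ?M \<and> letter_image n z \<otimes>\<^bsub>?M\<^esub> letter_image n z = letter_image n z"
    if z: "z \<in> alphabet n" for z
  proof -
    have zz: "[z] \<in> words n" using z by simp
    have x: "xi n [z] = letter_image n z"
      using partition_identity_right[OF letter_partition[OF z]] by (simp add: xi_simps)
    have "colour [z, z] = colour [z]" by (cases z) (auto simp: colour_Cons fun_eq_iff)
    then have "xi n ([z] @ [z]) = xi n [z]" using zz xi_eq_iff_colour[of "[z, z]" n "[z]"] by simp
    then show ?thesis using xi_append[OF zz zz] zz unfolding C x by (metis imageI planar_fd_monoid_simps(1) x)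
  qed
  have "a \<in> H" if H: "submonoid H ?M" "{e \<in> carrier ?M. e \<otimes>\<^bsub>?M\<^esub> e = e} \<subseteq> H" and a: "a \<in> carrier ?M" for a H
  proof -
    obtain w where w: "w \<in> words n" "a = xi n w" using a unfolding C by blast
    have "xi n w \<in> H" using w(1)
    proof (induction w rule: list.induct)
      case Nil
      show ?case using submonoid.one_closed[OF H(1)] by simp
    next
      case (Cons z w)
      then have "letter_image n z \<in> H" "xi n w \<in> H" using letter H(2) by auto
      then show ?case using submonoid.m_closed[OF H(1)] by (simp add: xi_simps)
    qed
    then show ?thesis using w by simp
  qed
  moreover have "submonoid (carrier ?M) ?M"
    using monoid.m_closed[OF mon] monoid.one_closed[OF mon] by (auto intro!: submonoid.intro)
  ultimately show ?thesis
    unfolding idempotent_generated_def generated_submonoid_def by blast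
qed

theorem theorem3p46:
  fixes n :: nat
  assumes "n \<ge> 2"
  shows "has_monoid_presentation (planar_fd_monoid n) (alphabet n) (relations n) (xi n)
    \<and> idempotent_generated (planar_fd_monoid n)"
  using presentation[OF assms] idempotents_generate[OF assms] by blast

end
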